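(* Let $d,k\in\mathbb N$ and let $(U,\mathcal F)$ be an instance of \textsc{$d$-Hitting Set} with $n=|\mathcal F|$ sets and $m=|U|$ elements. The static kernel $(U',\mathcal F')$ of $(U,\mathcal F)$, where $\mathcal F'$ is the family of inclusion-minimal good sets (defined in the context) and $U'=\bigcup_{S\in\mathcal F'}S$, can be computed in $O(3^d n+m)$ time.
   Context: An instance $(U,\mathcal F)$ of \textsc{$d$-Hitting Set} consists of a finite universe $U$ and a family $\mathcal F$ of subsets of $U$, each of cardinality exactly $d$; running times are on a word-RAM. For $r\in\mathbb N$ let $\nu_r = r!\,(k+1)^r$. The notion of an "$(\ell,r)$-good" set is defined inductively, in decreasing order of $\ell$ from $d$ to $1$, and for fixed $\ell<d$, for increasing $r$ from $1$ to $d-\ell$: \begin{itemize} \item The $(d,r)$-good sets are the sets $S\in\mathcal F$ (for every $r$). \item A set $S\subseteq U$ is $\ell$-good if $S$ is $(\ell,r)$-good for some $r$. \item A set $S\subseteq U$ is $(\ell',r)$-strong if $S$ is $\ell'$-good and does not contain any $(\ell'-j,j)$-good subset for any $j\in\{1,\dots,r-1\}$. \item For $\ell<d$, a set $S\subseteq U$ is $(\ell,r)$-good if $|S|=\ell$ and $S$ is contained in at least $\nu_r$ sets that are $(\ell+r,r)$-strong. \item A set $S\subseteq U$ is good if $S$ is $\ell$-good for $\ell=|S|$. \end{itemize} $\mathcal F'$ consists of those sets $S\subseteq U$ that are good and none of whose proper subsets are good; $U'$ consists of all $u\in U$ contained in some set of $\mathcal F'$. *)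

theory Defs
  imports Main
begin

section \<open>Hitting set instances and the static kernel\<close>

definition hitting_set_instance :: "nat \<Rightarrow> 'a set \<Rightarrow> 'a set set \<Rightarrow> bool" where
  "hitting_set_instance d U F \<longleftrightarrow> finite U \<and> (\<forall>S\<in>F. S \<subseteq> U \<and> card S = d)"

definition nu :: "nat \<Rightarrow> nat \<Rightarrow> nat" where
  "nu k r = fact r * (k + 1) ^ r"

context
  fixes d k :: nat and U :: "'a set" and F :: "'a set set"
begin

text \<open>
  \<open>lr_good l r S\<close>, \<open>l_good l S\<close> and \<open>lr_strong l r S\<close> say that \<open>S\<close> is \<open>(l,r)\<close>-good, \<open>l\<close>-good and
  \<open>(l,r)\<close>-strong. For \<open>l < d\<close>, the notion \<open>(l,r)\<close>-good is introduced only for \<open>1 \<le> l\<close> and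
  \<open>1 \<le> r \<le> d - l\<close>; outside this range no set is \<open>(l,r)\<close>-good. In particular the empty set
  is never good when \<open>d > 0\<close>. Within this range the subtraction \<open>l - j\<close> in \<open>lr_strong\<close> does not
  truncate.
\<close>

function lr_good :: "nat \<Rightarrow> nat \<Rightarrow> 'a set \<Rightarrow> bool"
  and l_good :: "nat \<Rightarrow> 'a set \<Rightarrow> bool"
  and lr_strong :: "nat \<Rightarrow> nat \<Rightarrow> 'a set \<Rightarrow> bool" where
  "lr_good l r S =
     (if l = d then S \<in> F
      else if 1 \<le> l \<and> l < d \<and> 1 \<le> r \<and> r \<le> d - l
      then S \<subseteq> U \<and> card S = l \<and> nu k r \<le> card {T. T \<subseteq> U \<and> S \<subseteq> T \<and> lr_strong (l + r) r T}
      else False)"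
| "l_good l S = (\<exists>r. lr_good l r S)"
| "lr_strong l r S = (l_good l S \<and> \<not> (\<exists>j\<in>{1..<r}. \<exists>T\<subseteq>S. lr_good (l - j) j T))"
  by pat_completeness auto
termination
  by (relation "measure (\<lambda>x. case x of
        Inl (l, r, S) \<Rightarrow> 3 * (d + 1 - l)
      | Inr (Inl (l, S)) \<Rightarrow> 3 * (d + 1 - l) + 1
      | Inr (Inr (l, r, S)) \<Rightarrow> 3 * (d + 1 - (l - (r - 1))) + 2)") auto

declare lr_good.simps [simp del] l_good.simps [simp del] lr_strong.simps [simp del]

definition good :: "'a set \<Rightarrow> bool" where
  "good S \<longleftrightarrow> l_good (card S) S"

definition kernel_sets :: "'a set set" where
  "kernel_sets = {S. S \<subseteq> U \<and> good S \<and> (\<forall>T. T \<subset> S \<longrightarrow> \<not> good T)}"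

definition kernel_universe :: "'a set" where
  "kernel_universe = {u \<in> U. \<exists>S\<in>kernel_sets. u \<in> S}"

end


section \<open>The word RAM\<close>

text \<open>
  A word of length \<open>w\<close> is a natural number below \<open>2 ^ w\<close>. A program is a finite list of
  instructions operating on registers and on a random-access memory addressed by words, with
  unit cost per instruction. The machine halts when the program counter leaves the program.
\<close>

datatype binop = Add | Sub | Mul | Div | Mod | And | Or | Xor | Shl | Shr

text \<open>All operations wrap around modulo \<open>2 ^ w\<close>; division by zero yields zero.\<close>

fun alu :: "nat \<Rightarrow> binop \<Rightarrow> nat \<Rightarrow> nat \<Rightarrow> nat" where
  "alu w Add x y = (x + y) mod 2 ^ w"
| "alu w Sub x y = (x + 2 ^ w - y) mod 2 ^ w"
| "alu w Mul x y = (x * y) mod 2 ^ w"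
| "alu w Div x y = (x div y) mod 2 ^ w"
| "alu w Mod x y = (x mod y) mod 2 ^ w"
| "alu w And x y = (Bit_Operations.and x y) mod 2 ^ w"
| "alu w Or x y = (Bit_Operations.or x y) mod 2 ^ w"
| "alu w Xor x y = (Bit_Operations.xor x y) mod 2 ^ w"
| "alu w Shl x y = (x * 2 ^ y) mod 2 ^ w"
| "alu w Shr x y = (x div 2 ^ y) mod 2 ^ w"

type_synonym reg = nat

datatype instr =
    Const reg nat
  | Move reg reg
  | Arith binop reg reg reg
  | Load reg reg
  | Store reg reg
  | Jump nat
  | JumpEq reg reg nat
  | JumpLess reg reg nat

text \<open>A configuration consists of the program counter, the registers and the memory.\<close>

type_synonym config = "nat \<times> (reg \<Rightarrow> nat) \<times> (nat \<Rightarrow> nat)"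

fun exec_instr :: "nat \<Rightarrow> instr \<Rightarrow> config \<Rightarrow> config" where
  "exec_instr w (Const a c) (pc, R, M) = (pc + 1, R(a := c mod 2 ^ w), M)"
| "exec_instr w (Move a b) (pc, R, M) = (pc + 1, R(a := R b), M)"
| "exec_instr w (Arith f a b c) (pc, R, M) = (pc + 1, R(a := alu w f (R b) (R c)), M)"
| "exec_instr w (Load a b) (pc, R, M) = (pc + 1, R(a := M (R b)), M)"
| "exec_instr w (Store a b) (pc, R, M) = (pc + 1, R, M(R a := R b))"
| "exec_instr w (Jump l) (pc, R, M) = (l, R, M)"
| "exec_instr w (JumpEq a b l) (pc, R, M) = (if R a = R b then l else pc + 1, R, M)"
| "exec_instr w (JumpLess a b l) (pc, R, M) = (if R a < R b then l else pc + 1, R, M)"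

definition halted :: "instr list \<Rightarrow> config \<Rightarrow> bool" where
  "halted P cf \<longleftrightarrow> length P \<le> fst cf"

definition step :: "nat \<Rightarrow> instr list \<Rightarrow> config \<Rightarrow> config" where
  "step w P cf = (if halted P cf then cf else exec_instr w (P ! fst cf) cf)"

text \<open>
  Started with \<open>xs\<close> in the memory cells \<open>0, 1, \<dots>\<close> and zero in all other cells and registers,
  the program halts after at most \<open>t\<close> steps, and \<open>ys\<close> then occupies consecutive memory cells
  from the address in register \<open>0\<close> onwards.
\<close>

definition initial_config :: "nat list \<Rightarrow> config" where
  "initial_config xs = (0, (\<lambda>_. 0), (\<lambda>a. if a < length xs then xs ! a else 0))"

definition outputs_within :: "nat \<Rightarrow> instr list \<Rightarrow> nat list \<Rightarrow> nat \<Rightarrow> nat list \<Rightarrow> bool" where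
  "outputs_within w P xs t ys \<longleftrightarrow>
     (\<exists>pc R M. (step w P ^^ t) (initial_config xs) = (pc, R, M) \<and> halted P (pc, R, M) \<and>
        R 0 + length ys \<le> 2 ^ w \<and> (\<forall>i<length ys. M (R 0 + i) = ys ! i))"


section \<open>Encoding of instances and kernels\<close>

definition lists_set :: "'a list \<Rightarrow> 'a set \<Rightarrow> bool" where
  "lists_set xs A \<longleftrightarrow> distinct xs \<and> set xs = A"

definition lists_family :: "'a list list \<Rightarrow> 'a set set \<Rightarrow> bool" where
  "lists_family xss A \<longleftrightarrow> (\<forall>xs\<in>set xss. distinct xs) \<and> lists_set (map set xss) A"

text \<open>
  The elements of the universe are represented by the numbers below \<open>m\<close> through a numbering
  \<open>num\<close>. Sets and families are listed without repetitions, in any order. All sets of an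
  instance have size \<open>d\<close>, those of a kernel are preceded by their size.
\<close>

definition instance_words ::
  "('a \<Rightarrow> nat) \<Rightarrow> nat \<Rightarrow> nat \<Rightarrow> nat \<Rightarrow> 'a list list \<Rightarrow> nat list" where
  "instance_words num d k m xss = [d, k, length xss, m] @ map num (concat xss)"

definition kernel_words :: "('a \<Rightarrow> nat) \<Rightarrow> 'a list \<Rightarrow> 'a list list \<Rightarrow> nat list" where
  "kernel_words num us yss =
     length us # map num us @
     length yss # concat (map (\<lambda>ys. length ys # map num ys) yss)"

end

theory Submission
  imports Defs
begin

text \<open>
  The elements of the universe are processed in increasing order, and every input set grows by one
  element at a time, so that the subsets of the input sets form a trie whose construction needs no
  dictionary: the children \<open>S \<union> {u}\<close> created for the current \<open>u\<close> are kept in an array indexed by \<open>S\<close>.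
  Each distinct subset \<open>T\<close> stores the list of its own subsets; there are at most \<open>3 ^ d * n\<close> pairs
  \<open>S \<subseteq> T\<close> in total. Distributing these pairs into buckets by \<open>(card S, card T - card S)\<close> makes it
  possible to evaluate the definition of goodness in the order of its recursion, with every pair
  being inspected a constant number of times.

  The algorithm is written in a small structured language over variables and arrays, whose semantics
  counts the steps of the compiled word RAM program.
\<close>

section \<open>A structured language for the word RAM\<close>

text \<open>The obstacle is a deterministic bound linear in \<open>3 ^ d * n + m\<close>: a search
  tree of subsets would add a logarithmic factor, and hashing would be randomised. The number
  \<open>3 ^ d\<close> arises because a pair S within T inside an input set E sends each element of
  E to one of three places: S, T - S or E - T. Inserting elements in increasing order gives each
  subset one parent, the set without its largest element, so two input sets can create the same
  subset only while the same \<open>u\<close> is current; stamps \<open>u + 1\<close> detect this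
  and are never cleared. One flag per set suffices for strength, because every witness
  \<open>(l + r - j, j)\<close> with \<open>1 <= j < r\<close> against a set of size
  \<open>l + r\<close> is larger than \<open>l\<close> and so was found in an earlier round. There
  is no allocator: memory is cut into 32 arrays of one length \<open>L\<close>, computed at run
  time; the input lies in array 0 and the initial zeros of the memory initialise the others. The
  roughly \<open>(d + 1) ^ 2\<close> buckets and rounds are within budget only if some input set
  exists, so \<open>n = 0\<close> is answered separately.\<close>

datatype aexp = Lit nat | Var nat | Plus aexp aexp | Minus aexp aexp | Times aexp aexp
  | Divide aexp aexp | Ld nat aexp

datatype bexp = Less aexp aexp | Equal aexp aexp

datatype com = Skip | Assign nat aexp (infix "::=" 61) | Write nat aexp aexp
  | Seq com com (infixr ";;" 60) | Cond bexp com com | While bexp com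

primrec aval :: "aexp \<Rightarrow> (nat \<Rightarrow> nat) \<Rightarrow> (nat \<Rightarrow> nat \<Rightarrow> nat) \<Rightarrow> nat" where
  "aval (Lit c) R A = c"
| "aval (Var v) R A = R v"
| "aval (Plus a b) R A = aval a R A + aval b R A"
| "aval (Minus a b) R A = aval a R A - aval b R A"
| "aval (Times a b) R A = aval a R A * aval b R A"
| "aval (Divide a b) R A = aval a R A div aval b R A"
| "aval (Ld j a) R A = A j (aval a R A)"

primrec bval :: "bexp \<Rightarrow> (nat \<Rightarrow> nat) \<Rightarrow> (nat \<Rightarrow> nat \<Rightarrow> nat) \<Rightarrow> bool" where
  "bval (Less a b) R A \<longleftrightarrow> aval a R A < aval b R A"
| "bval (Equal a b) R A \<longleftrightarrow> aval a R A = aval b R A"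

text \<open>
  Evaluation is safe if no intermediate result leaves the word range \<open>W\<close> and no array index
  leaves the common array length \<open>L\<close>. The bound 32 on literals and array names keeps the
  addresses \<open>j * L + i\<close> below \<open>32 * L \<le> W\<close>.
\<close>

primrec aok :: "nat \<Rightarrow> nat \<Rightarrow> aexp \<Rightarrow> (nat \<Rightarrow> nat) \<Rightarrow> (nat \<Rightarrow> nat \<Rightarrow> nat) \<Rightarrow> bool" where
  "aok L W (Lit c) R A \<longleftrightarrow> c < 32"
| "aok L W (Var v) R A \<longleftrightarrow> True"
| "aok L W (Plus a b) R A \<longleftrightarrow> aok L W a R A \<and> aok L W b R A \<and> aval a R A + aval b R A < W"
| "aok L W (Minus a b) R A \<longleftrightarrow> aok L W a R A \<and> aok L W b R A \<and> aval b R A \<le> aval a R A"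
| "aok L W (Times a b) R A \<longleftrightarrow> aok L W a R A \<and> aok L W b R A \<and> aval a R A * aval b R A < W"
| "aok L W (Divide a b) R A \<longleftrightarrow> aok L W a R A \<and> aok L W b R A"
| "aok L W (Ld j a) R A \<longleftrightarrow> j < 32 \<and> aok L W a R A \<and> aval a R A < L"

primrec bok :: "nat \<Rightarrow> nat \<Rightarrow> bexp \<Rightarrow> (nat \<Rightarrow> nat) \<Rightarrow> (nat \<Rightarrow> nat \<Rightarrow> nat) \<Rightarrow> bool" where
  "bok L W (Less a b) R A \<longleftrightarrow> aok L W a R A \<and> aok L W b R A"
| "bok L W (Equal a b) R A \<longleftrightarrow> aok L W a R A \<and> aok L W b R A"

primrec acost :: "aexp \<Rightarrow> nat" where
  "acost (Lit c) = 1"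
| "acost (Var v) = 1"
| "acost (Plus a b) = acost a + acost b + 1"
| "acost (Minus a b) = acost a + acost b + 1"
| "acost (Times a b) = acost a + acost b + 1"
| "acost (Divide a b) = acost a + acost b + 1"
| "acost (Ld j a) = acost a + 4"

primrec bcost :: "bexp \<Rightarrow> nat" where
  "bcost (Less a b) = acost a + acost b"
| "bcost (Equal a b) = acost a + acost b"

text \<open>The third component of a state counts the machine steps of the compiled program.\<close>

type_synonym state = "(nat \<Rightarrow> nat) \<times> (nat \<Rightarrow> nat \<Rightarrow> nat) \<times> nat"

text \<open>The surcharges mirror the code layout of \<open>compC\<close>. The else branch follows
  the test directly and must jump over the then branch, hence the extra step in
  \<open>exec_CondF\<close> only; a loop pays one jump back per iteration and one jump out at the
  end.\<close>

inductive exec :: "nat \<Rightarrow> nat \<Rightarrow> com \<Rightarrow> state \<Rightarrow> state \<Rightarrow> bool" for L W where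
  exec_Skip: "exec L W Skip s s"
| exec_Assign: "aok L W a R A \<Longrightarrow>
    exec L W (v ::= a) (R, A, t) (R(v := aval a R A), A, t + acost a + 1)"
| exec_Write: "\<lbrakk>j < 32; aok L W a R A; aok L W b R A; aval a R A < L\<rbrakk> \<Longrightarrow>
    exec L W (Write j a b) (R, A, t)
      (R, A(j := (A j)(aval a R A := aval b R A)), t + acost a + acost b + 4)"
| exec_Seq: "\<lbrakk>exec L W c s s'; exec L W c' s' s''\<rbrakk> \<Longrightarrow> exec L W (c ;; c') s s''"
| exec_CondT: "\<lbrakk>bok L W b R A; bval b R A; exec L W c (R, A, t + bcost b + 1) s'\<rbrakk> \<Longrightarrow>
    exec L W (Cond b c c') (R, A, t) s'"
| exec_CondF: "\<lbrakk>bok L W b R A; \<not> bval b R A; exec L W c' (R, A, t + bcost b + 1) (R', A', t')\<rbrakk> \<Longrightarrow>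
    exec L W (Cond b c c') (R, A, t) (R', A', t' + 1)"
| exec_WhileT: "\<lbrakk>bok L W b R A; bval b R A; exec L W c (R, A, t + bcost b + 1) (R', A', t');
    exec L W (While b c) (R', A', t' + 1) s''\<rbrakk> \<Longrightarrow> exec L W (While b c) (R, A, t) s''"
| exec_WhileF: "\<lbrakk>bok L W b R A; \<not> bval b R A\<rbrakk> \<Longrightarrow>
    exec L W (While b c) (R, A, t) (R, A, t + bcost b + 2)"

text \<open>One derivation of \<open>exec\<close> yields safety, termination and the step count
  together, and \<open>compC_correct\<close> turns any derivation into a machine run; therefore
  existence is the right modality.\<close>

definition wp :: "nat \<Rightarrow> nat \<Rightarrow> com \<Rightarrow> (state \<Rightarrow> bool) \<Rightarrow> state \<Rightarrow> bool" where
  "wp L W c Q s \<longleftrightarrow> (\<exists>s'. exec L W c s s' \<and> Q s')"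

lemma wp_mono: "\<lbrakk>wp L W c Q s; \<And>R A t. Q (R, A, t) \<Longrightarrow> Q' (R, A, t)\<rbrakk> \<Longrightarrow> wp L W c Q' s"
  unfolding wp_def by (metis prod_cases3)

lemma exec_Skip_iff: "exec L W Skip s s' \<longleftrightarrow> s' = s"
  by (subst exec.simps) auto

lemma exec_Assign_iff: "exec L W (v ::= a) (R, A, t) s' \<longleftrightarrow>
    aok L W a R A \<and> s' = (R(v := aval a R A), A, t + acost a + 1)"
  by (subst exec.simps) auto

lemma exec_Write_iff: "exec L W (Write j a b) (R, A, t) s' \<longleftrightarrow>
    j < 32 \<and> aok L W a R A \<and> aok L W b R A \<and> aval a R A < L \<and>
    s' = (R, A(j := (A j)(aval a R A := aval b R A)), t + acost a + acost b + 4)"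
  by (subst exec.simps) auto

lemma exec_Seq_iff: "exec L W (c ;; c') s s'' \<longleftrightarrow> (\<exists>s'. exec L W c s s' \<and> exec L W c' s' s'')"
  by (subst exec.simps) simp

lemma exec_Cond_iff: "exec L W (Cond b c c') (R, A, t) s' \<longleftrightarrow> bok L W b R A \<and>
    (if bval b R A then exec L W c (R, A, t + bcost b + 1) s'
     else \<exists>R' A' t'. exec L W c' (R, A, t + bcost b + 1) (R', A', t') \<and> s' = (R', A', t' + 1))"
  by (subst exec.simps) auto

lemma wp_Skip [simp]: "wp L W Skip Q s \<longleftrightarrow> Q s"
  unfolding wp_def exec_Skip_iff by blast

lemma wp_Assign [simp]:
  "wp L W (v ::= a) Q (R, A, t) \<longleftrightarrow>
    aok L W a R A \<and> Q (R(v := aval a R A), A, t + acost a + 1)"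
  unfolding wp_def exec_Assign_iff by blast

lemma wp_Write [simp]:
  "wp L W (Write j a b) Q (R, A, t) \<longleftrightarrow>
    j < 32 \<and> aok L W a R A \<and> aok L W b R A \<and> aval a R A < L \<and>
    Q (R, A(j := (A j)(aval a R A := aval b R A)), t + acost a + acost b + 4)"
  unfolding wp_def exec_Write_iff by blast

lemma wp_Seq [simp]: "wp L W (c ;; c') Q s \<longleftrightarrow> wp L W c (wp L W c' Q) s"
  unfolding wp_def exec_Seq_iff by blast

lemma wp_Cond [simp]:
  "wp L W (Cond b c c') Q (R, A, t) \<longleftrightarrow> bok L W b R A \<and>
    (if bval b R A then wp L W c Q (R, A, t + bcost b + 1)
     else wp L W c' (\<lambda>(R', A', t'). Q (R', A', t' + 1)) (R, A, t + bcost b + 1))"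
  unfolding wp_def exec_Cond_iff by auto

lemma wp_state_cong: "wp L W c Q s \<Longrightarrow> s' = s \<Longrightarrow> wp L W c Q s'"
  by simp

lemma wp_CondI:
  assumes "bok L W b R A" "bval b R A \<Longrightarrow> wp L W c Q (R, A, t + bcost b + 1)"
    "\<not> bval b R A \<Longrightarrow> wp L W c' (\<lambda>(R', A', t'). Q (R', A', t' + 1)) (R, A, t + bcost b + 1)"
  shows "wp L W (Cond b c c') Q (R, A, t)"
  using assms by simp

text \<open>The list of items still ahead is ghost data: it indexes the invariant and, losing one
  item per iteration, also proves termination. It serves counting loops, linked lists and chains of
  parents alike.\<close>

lemma wp_While_list:
  assumes "I xs (R, A, t)"
    and step: "\<And>x xs R A t. I (x # xs) (R, A, t) \<Longrightarrow> bok L W b R A \<and> bval b R A \<and>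
      wp L W c (\<lambda>(R', A', t'). I xs (R', A', t' + 1)) (R, A, t + bcost b + 1)"
    and final: "\<And>R A t. I [] (R, A, t) \<Longrightarrow> bok L W b R A \<and> \<not> bval b R A \<and> Q (R, A, t + bcost b + 2)"
  shows "wp L W (While b c) Q (R, A, t)"
  using assms(1)
proof (induction xs arbitrary: R A t)
  case Nil
  then show ?case using final[OF Nil] unfolding wp_def by (blast intro: exec_WhileF)
next
  case (Cons x xs)
  from step[OF Cons.prems] obtain R' A' t' where
    "exec L W c (R, A, t + bcost b + 1) (R', A', t')" "I xs (R', A', t' + 1)"
    unfolding wp_def by auto
  then show ?case using Cons.IH step[OF Cons.prems] unfolding wp_def
    by (blast intro: exec_WhileT)
qed

lemma wp_While_count:
  assumes "I i (R, A, t)" "i \<le> n"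
    and step: "\<And>i R A t. \<lbrakk>I i (R, A, t); i < n\<rbrakk> \<Longrightarrow> bok L W b R A \<and> bval b R A \<and>
      wp L W c (\<lambda>(R', A', t'). I (Suc i) (R', A', t' + 1)) (R, A, t + bcost b + 1)"
    and final: "\<And>R A t. I n (R, A, t) \<Longrightarrow> bok L W b R A \<and> \<not> bval b R A \<and> Q (R, A, t + bcost b + 2)"
  shows "wp L W (While b c) Q (R, A, t)"
\<comment> \<open>Only the length of the list matters here: it is the number of iterations
  left.\<close>
proof (rule wp_While_list[where I = "\<lambda>xs s. \<exists>i\<le>n. length xs = n - i \<and> I i s" and xs = "[i..<n]"])
  show "\<exists>i'\<le>n. length [i..<n] = n - i' \<and> I i' (R, A, t)" using assms(1,2) by auto
next
  fix x :: nat and xs R A t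
  assume "\<exists>i\<le>n. length (x # xs) = n - i \<and> I i (R, A, t)"
  then obtain i where i: "i < n" "length xs = n - Suc i" "I i (R, A, t)" by (force simp: nat_less_le)
  have "wp L W c (\<lambda>(R', A', t'). I (Suc i) (R', A', t' + 1)) (R, A, t + bcost b + 1)"
    using step[OF i(3,1)] by simp
  then have "wp L W c (\<lambda>(R', A', t'). \<exists>i\<le>n. length xs = n - i \<and> I i (R', A', t' + 1))
      (R, A, t + bcost b + 1)"
    by (rule wp_mono) (use i in \<open>auto intro!: exI[of _ "Suc i"]\<close>)
  then show "bok L W b R A \<and> bval b R A \<and>
    wp L W c (\<lambda>(R', A', t'). \<exists>i\<le>n. length xs = n - i \<and> I i (R', A', t' + 1))
      (R, A, t + bcost b + 1)"
    using step[OF i(3,1)] by simp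
next
  fix R A t assume "\<exists>i\<le>n. length [] = n - i \<and> I i (R, A, t)"
  then show "bok L W b R A \<and> \<not> bval b R A \<and> Q (R, A, t + bcost b + 2)"
    using final by auto
qed

section \<open>Compilation\<close>

text \<open>
  Variable \<open>v\<close> lives in register \<open>2 * v + 1\<close>, register \<open>0\<close> holds \<open>L\<close>, and the
  remaining even registers are used for temporaries.
\<close>

primrec compA :: "aexp \<Rightarrow> nat \<Rightarrow> instr list" where
  "compA (Lit c) i = [Const (2 * i) c]"
| "compA (Var v) i = [Move (2 * i) (2 * v + 1)]"
| "compA (Plus a b) i = compA a i @ compA b (i + 1) @ [Arith Add (2 * i) (2 * i) (2 * (i + 1))]"
| "compA (Minus a b) i = compA a i @ compA b (i + 1) @ [Arith Sub (2 * i) (2 * i) (2 * (i + 1))]"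
| "compA (Times a b) i = compA a i @ compA b (i + 1) @ [Arith Mul (2 * i) (2 * i) (2 * (i + 1))]"
| "compA (Divide a b) i = compA a i @ compA b (i + 1) @ [Arith Div (2 * i) (2 * i) (2 * (i + 1))]"
| "compA (Ld j a) i = compA a i @ [Const (2 * (i + 1)) j, Arith Mul (2 * (i + 1)) (2 * (i + 1)) 0,
     Arith Add (2 * i) (2 * i) (2 * (i + 1)), Load (2 * i) (2 * i)]"

primrec compB :: "bexp \<Rightarrow> nat \<Rightarrow> instr list" where
  "compB (Less a b) l = compA a 1 @ compA b 2 @ [JumpLess 2 4 l]"
| "compB (Equal a b) l = compA a 1 @ compA b 2 @ [JumpEq 2 4 l]"

primrec compC :: "com \<Rightarrow> nat \<Rightarrow> instr list" where
  "compC Skip pc = []"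
| "compC (v ::= a) pc = compA a 1 @ [Move (2 * v + 1) 2]"
| "compC (Write j a b) pc = compA a 1 @ [Const 4 j, Arith Mul 4 4 0, Arith Add 2 2 4] @
     compA b 2 @ [Store 2 4]"
| "compC (c ;; c') pc = compC c pc @ compC c' (pc + length (compC c pc))"
| "compC (Cond b c c') pc =
    (let pc1 = pc + bcost b + 1; C' = compC c' pc1; pc2 = pc1 + length C' + 1; C = compC c pc2
     in compB b pc2 @ C' @ [Jump (pc2 + length C)] @ C)"
| "compC (While b c) pc =
    (let pc1 = pc + bcost b + 2; C = compC c pc1
     in compB b pc1 @ [Jump (pc1 + length C + 1)] @ C @ [Jump pc])"

definition code_at :: "instr list \<Rightarrow> nat \<Rightarrow> instr list \<Rightarrow> bool" where
  "code_at P pc is \<longleftrightarrow> (\<exists>xs ys. P = xs @ is @ ys \<and> length xs = pc)"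

lemma code_at_append:
  "code_at P pc (is @ js) \<Longrightarrow> code_at P pc is \<and> code_at P (pc + length is) js"
  unfolding code_at_def by (metis append.assoc length_append)

definition runs :: "nat \<Rightarrow> instr list \<Rightarrow> nat \<Rightarrow> config \<Rightarrow> config \<Rightarrow> bool" where
  "runs w P n cf cf' \<longleftrightarrow> (step w P ^^ n) cf = cf'"

lemma runs_0: "runs w P 0 cf cf"
  by (simp add: runs_def)

lemma runs_trans: "\<lbrakk>runs w P a x y; runs w P b y z\<rbrakk> \<Longrightarrow> runs w P (a + b) x z"
  unfolding runs_def by (subst add.commute) (simp add: funpow_add)

lemma code_at_step:
  "\<lbrakk>code_at P pc is; k < length is\<rbrakk> \<Longrightarrow> step w P (pc + k, Z, M) = exec_instr w (is ! k) (pc + k, Z, M)"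
  unfolding code_at_def step_def halted_def by (auto simp: nth_append)

lemma runs_one: "runs w P 1 cf cf' \<longleftrightarrow> step w P cf = cf'"
  by (simp add: runs_def)

lemma runs_1: "code_at P pc [i] \<Longrightarrow> exec_instr w i (pc, Z, M) = cf \<Longrightarrow> runs w P 1 (pc, Z, M) cf"
  using code_at_step[of P pc "[i]" 0] by (simp add: runs_def)

lemma length_compA: "length (compA a i) = acost a"
  by (induction a arbitrary: i) auto

lemma length_compB: "length (compB b l) = bcost b + 1"
  by (cases b) (auto simp: length_compA)

text \<open>Memory contents are tied to the state inside the 32 arrays only. The word bounds on all
  registers and cells belong to the relation because values read from them must be known to fit into
  a word.\<close>

definition sim :: "nat \<Rightarrow> nat \<Rightarrow> (nat \<Rightarrow> nat) \<Rightarrow> (nat \<Rightarrow> nat \<Rightarrow> nat) \<Rightarrow> (nat \<Rightarrow> nat) \<Rightarrow> (nat \<Rightarrow> nat) \<Rightarrow> bool"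
  where
  "sim L w R A Z M \<longleftrightarrow> Z 0 = L \<and> (\<forall>v. Z (2 * v + 1) = R v) \<and>
    (\<forall>j i. j < 32 \<longrightarrow> i < L \<longrightarrow> M (j * L + i) = A j i) \<and> (\<forall>v. Z v < 2 ^ w) \<and> (\<forall>a. M a < 2 ^ w)"

lemma addr_less:
  assumes "j < 32" "i < L" "32 * L \<le> (W::nat)"
  shows "j * L + i < W"
proof -
  have "j * L + L \<le> 32 * L" using mult_le_mono1[of "Suc j" 32 L] assms(1) by simp
  then show ?thesis using assms(2,3) by linarith
qed

lemma addr_inj:
  assumes "i < L" "i' < L"
  shows "j * L + i = j' * L + i' \<longleftrightarrow> j = j' \<and> i = (i'::nat)"
proof
  assume eq: "j * L + i = j' * L + i'"
  have "(j * L + i) div L = j" "(j' * L + i') div L = j'" using assms by simp_all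
  then show "j = j' \<and> i = i'" using eq by simp
qed simp

lemma sim_temp: "\<lbrakk>sim L w R A Z M; 0 < i; x < 2 ^ w\<rbrakk> \<Longrightarrow> sim L w R A (Z(2 * i := x)) M"
  unfolding sim_def by (auto simp: Suc_double_not_eq_double)

lemma alu_exact:
  assumes "x < 2 ^ w"
  shows "x + y < 2 ^ w \<Longrightarrow> alu w Add x y = x + y"
    and "y \<le> x \<Longrightarrow> alu w Sub x y = x - y"
    and "x * y < 2 ^ w \<Longrightarrow> alu w Mul x y = x * y"
    and "alu w Div x y = x div y"
proof -
  show "y \<le> x \<Longrightarrow> alu w Sub x y = x - y"
  proof -
    assume "y \<le> x"
    then have "x + 2 ^ w - y = (x - y) + 2 ^ w" by (rule add_diff_assoc2[symmetric])
    moreover have "x - y < 2 ^ w" using assms by linarith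
    ultimately show ?thesis by (simp only: alu.simps mod_add_self2 mod_less)
  qed
  show "alu w Div x y = x div y"
    using order.strict_trans1[OF div_le_dividend assms] by (simp only: alu.simps mod_less)
  show "x + y < 2 ^ w \<Longrightarrow> alu w Add x y = x + y" "x * y < 2 ^ w \<Longrightarrow> alu w Mul x y = x * y"
    by (simp_all only: alu.simps mod_less)
qed

lemma aval_less:
  "\<lbrakk>aok L (2 ^ w) a R A; sim L w R A Z M; (32::nat) \<le> 2 ^ w\<rbrakk> \<Longrightarrow> aval a R A < 2 ^ w"
proof (induction a)
  case (Var v)
  then show ?case by (simp add: sim_def) metis
next
  case (Ld j a)
  then show ?case by (simp add: sim_def) metis
next
  case (Divide a b)
  then show ?case using order.strict_trans1[OF div_le_dividend] by simp
qed auto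

lemma compA_binop:
  assumes a: "\<And>pc i Z. \<lbrakk>code_at P pc (compA a i); sim L w R A Z M; 0 < i\<rbrakk> \<Longrightarrow>
      \<exists>Z'. runs w P (acost a) (pc, Z, M) (pc + acost a, Z', M) \<and> Z' (2 * i) = aval a R A \<and>
        (\<forall>i'<i. Z' (2 * i') = Z (2 * i')) \<and> sim L w R A Z' M"
    and b: "\<And>pc i Z. \<lbrakk>code_at P pc (compA b i); sim L w R A Z M; 0 < i\<rbrakk> \<Longrightarrow>
      \<exists>Z'. runs w P (acost b) (pc, Z, M) (pc + acost b, Z', M) \<and> Z' (2 * i) = aval b R A \<and>
        (\<forall>i'<i. Z' (2 * i') = Z (2 * i')) \<and> sim L w R A Z' M"
    and code: "code_at P pc (compA a i @ compA b (i + 1) @ [Arith f (2 * i) (2 * i) (2 * (i + 1))])"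
    and sim: "sim L w R A Z M" "0 < i"
    and alu: "alu w f (aval a R A) (aval b R A) = x" "x < 2 ^ w"
  shows "\<exists>Z'. runs w P (acost a + acost b + 1) (pc, Z, M) (pc + (acost a + acost b + 1), Z', M) \<and>
    Z' (2 * i) = x \<and> (\<forall>i'<i. Z' (2 * i') = Z (2 * i')) \<and> sim L w R A Z' M"
proof -
  note c = code_at_append[OF code] code_at_append[OF code_at_append[OF code, THEN conjunct2]]
  obtain Z1 where Z1: "runs w P (acost a) (pc, Z, M) (pc + acost a, Z1, M)" "Z1 (2 * i) = aval a R A"
    "\<forall>i'<i. Z1 (2 * i') = Z (2 * i')" "sim L w R A Z1 M"
    using a[of pc i Z] c sim by auto
  obtain Z2 where Z2: "runs w P (acost b) (pc + acost a, Z1, M) (pc + acost a + acost b, Z2, M)"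
    "Z2 (2 * (i + 1)) = aval b R A" "\<forall>i'<i+1. Z2 (2 * i') = Z1 (2 * i')" "sim L w R A Z2 M"
    using b[of "pc + acost a" "i + 1" Z1] c Z1(4) by (auto simp: length_compA)
  have "runs w P 1 (pc + acost a + acost b, Z2, M) (pc + acost a + acost b + 1, Z2(2 * i := x), M)"
    using c Z1(2) Z2(2,3) alu
    by (intro runs_1[of _ _ "Arith f (2 * i) (2 * i) (2 * (i + 1))"]) (auto simp: length_compA)
  note run = runs_trans[OF runs_trans[OF Z1(1) Z2(1)] this]
  have "\<forall>i'<i. (Z2(2 * i := x)) (2 * i') = Z (2 * i')" using Z1(3) Z2(3) by simp
  moreover have "(Z2(2 * i := x)) (2 * i) = x" by simp
  ultimately show ?thesis
    using run[unfolded add.assoc] sim_temp[OF Z2(4) sim(2) alu(2)] unfolding add.assoc by blast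
qed

text \<open>Temporaries form a stack: evaluation at depth \<open>i\<close> leaves its value in
  register \<open>2 * i\<close> and may overwrite only higher temporaries, so a left operand
  survives the evaluation of the right one. \<open>0 < i\<close> protects register 0, which holds
  \<open>L\<close>.\<close>

lemma compA_correct:
  assumes "code_at P pc (compA a i)" "aok L (2 ^ w) a R A" "sim L w R A Z M" "0 < i"
    "32 * L \<le> 2 ^ w" "(32::nat) \<le> 2 ^ w"
  shows "\<exists>Z'. runs w P (acost a) (pc, Z, M) (pc + acost a, Z', M) \<and> Z' (2 * i) = aval a R A \<and>
    (\<forall>i'<i. Z' (2 * i') = Z (2 * i')) \<and> sim L w R A Z' M"
  using assms(1-4)
proof (induction a arbitrary: pc i Z)
  case (Lit c)
  have "c < 2 ^ w" using Lit.prems(2) assms(6) by simp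
  then show ?case using Lit.prems runs_1[of P pc "Const (2 * i) c" w Z M]
    by (intro exI[of _ "Z(2 * i := c)"] conjI sim_temp) (simp_all add: fun_upd_def)
next
  case (Var v)
  have "R v < 2 ^ w" using Var.prems(3) by (simp add: sim_def) metis
  moreover have "Z (2 * v + 1) = R v" using Var.prems(3) by (simp add: sim_def)
  ultimately show ?case using Var.prems runs_1[of P pc "Move (2 * i) (2 * v + 1)" w Z M]
    by (intro exI[of _ "Z(2 * i := R v)"] conjI sim_temp) (simp_all add: fun_upd_def)
next
  case (Ld j a)
  let ?is = "[Const (2 * (i + 1)) j, Arith Mul (2 * (i + 1)) (2 * (i + 1)) 0,
    Arith Add (2 * i) (2 * i) (2 * (i + 1)), Load (2 * i) (2 * i)]"
  have code: "code_at P pc (compA a i)" and code2: "code_at P (pc + acost a) ?is"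
    using code_at_append[of P pc "compA a i"] Ld.prems(1) by (auto simp: length_compA)
  from Ld.IH[OF code _ Ld.prems(3,4)] Ld.prems(2) obtain Z1 where
    Z1: "runs w P (acost a) (pc, Z, M) (pc + acost a, Z1, M)" "Z1 (2 * i) = aval a R A"
      "\<forall>i'<i. Z1 (2 * i') = Z (2 * i')" "sim L w R A Z1 M" by auto
  have bd: "j * L + aval a R A < 2 ^ w" using addr_less Ld.prems(2) assms(5) by simp
  then have bd2: "j * L < 2 ^ w" "j < 2 ^ w" using Ld.prems(2) assms(6) by auto
  let ?Z = "Z1(2 * (i + 1) := j * L, 2 * i := A j (aval a R A))"
  have Z0: "Z1 0 = L" "M (j * L + aval a R A) = A j (aval a R A)"
    using Z1(4) Ld.prems(2) by (auto simp: sim_def)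
  have A: "A j (aval a R A) < 2 ^ w"
    using Z0(2) Z1(4) unfolding sim_def by metis
  have s: "\<And>k Z M. k < 4 \<Longrightarrow> step w P (pc + acost a + k, Z, M) =
      exec_instr w (?is ! k) (pc + acost a + k, Z, M)"
    using code_at_step[OF code2] by simp
  let ?Z1 = "Z1(2 * (i + 1) := j)" and ?Z2 = "Z1(2 * (i + 1) := j * L)"
  let ?Z3 = "Z1(2 * (i + 1) := j * L, 2 * i := j * L + aval a R A)"
  have 1: "step w P (pc + acost a, Z1, M) = (pc + acost a + 1, ?Z1, M)"
    using s[of 0] bd2 by simp
  have 2: "step w P (pc + acost a + 1, ?Z1, M) = (pc + acost a + 2, ?Z2, M)"
    using s[of 1 ?Z1] bd2 Z0 by simp
  have 3: "step w P (pc + acost a + 2, ?Z2, M) = (pc + acost a + 3, ?Z3, M)"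
    using s[of 2 ?Z2] bd Z1(2) by (simp add: add.commute)
  have 4: "step w P (pc + acost a + 3, ?Z3, M) = (pc + acost a + 4, ?Z, M)"
    using s[of 3 ?Z3] Z0(2) by simp
  have "runs w P 4 (pc + acost a, Z1, M) (pc + acost a + 4, ?Z, M)"
    using runs_trans[OF runs_trans[OF runs_trans[OF 1[folded runs_one] 2[folded runs_one]]
      3[folded runs_one]] 4[folded runs_one]] by (simp add: eval_nat_numeral)
  then have run: "runs w P (acost a + 4) (pc, Z, M) (pc + (acost a + 4), ?Z, M)"
    using runs_trans[OF Z1(1)] by (simp add: add.assoc)
  have "sim L w R A ?Z M"
    using sim_temp[OF sim_temp[OF Z1(4), of "i + 1" "j * L"], of i] \<open>0 < i\<close> A bd2 by simp
  moreover have "\<forall>i'<i. ?Z (2 * i') = Z (2 * i')" using Z1(3) by simp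
  moreover have "?Z (2 * i) = A j (aval a R A)" by simp
  ultimately show ?case using run unfolding acost.simps aval.simps by blast
next
  case (Plus a b)
  have "aval a R A < 2 ^ w" using Plus.prems assms(6) by (auto intro: aval_less)
  with Plus show ?case
    using compA_binop[of P a L w R A M b pc i Add Z "aval a R A + aval b R A"] alu_exact(1)
    by simp
next
  case (Minus a b)
  have "aval a R A < 2 ^ w" using Minus.prems assms(6) by (auto intro: aval_less)
  with Minus show ?case
    using compA_binop[of P a L w R A M b pc i Sub Z "aval a R A - aval b R A"] alu_exact(2)
    by simp
next
  case (Times a b)
  have "aval a R A < 2 ^ w" using Times.prems assms(6) by (auto intro: aval_less)
  with Times show ?case
    using compA_binop[of P a L w R A M b pc i Mul Z "aval a R A * aval b R A"] alu_exact(3)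
    by simp
next
  case (Divide a b)
  have "aval a R A < 2 ^ w" using Divide.prems assms(6) by (auto intro: aval_less)
  with Divide show ?case
    using compA_binop[of P a L w R A M b pc i Div Z "aval a R A div aval b R A"] alu_exact(4)
      order.strict_trans1[OF div_le_dividend, of "aval a R A" "2 ^ w" "aval b R A"]
    by simp
qed

text \<open>Leaving the addresses from \<open>32 * L\<close> on untouched is recorded for the stage
  that computes \<open>L\<close>: it runs with array length 0, and then this clause says that the
  input survives in memory.\<close>

definition reaches :: "instr list \<Rightarrow> nat \<Rightarrow> nat \<Rightarrow> nat \<Rightarrow> config \<Rightarrow> nat \<Rightarrow>
    (nat \<Rightarrow> nat) \<Rightarrow> (nat \<Rightarrow> nat \<Rightarrow> nat) \<Rightarrow> bool" where
  "reaches P w L n cf pc R A \<longleftrightarrow> (\<exists>Z M. runs w P n cf (pc, Z, M) \<and> sim L w R A Z M \<and>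
    (\<forall>a\<ge>32 * L. M a = snd (snd cf) a))"

lemma reaches_runs:
  "\<lbrakk>runs w P n (pc, Z, M) (pc', Z', M'); \<forall>a\<ge>32 * L. M' a = M a; reaches P w L n' (pc', Z', M') pc'' R A\<rbrakk> \<Longrightarrow>
    reaches P w L (n + n') (pc, Z, M) pc'' R A"
  unfolding reaches_def by (auto dest: runs_trans)

lemma reaches_trans:
  assumes "reaches P w L n (pc, Z, M) pc' R A"
    and "\<And>Z' M'. sim L w R A Z' M' \<Longrightarrow> reaches P w L n' (pc', Z', M') pc'' R' A'"
  shows "reaches P w L (n + n') (pc, Z, M) pc'' R' A'"
proof -
  obtain Z' M' where 1: "runs w P n (pc, Z, M) (pc', Z', M')" "sim L w R A Z' M'" "\<forall>a\<ge>32 * L. M' a = M a"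
    using assms(1) unfolding reaches_def by auto
  show ?thesis by (rule reaches_runs[OF 1(1,3) assms(2)[OF 1(2)]])
qed

lemma reaches_sim: "sim L w R A Z M \<Longrightarrow> reaches P w L 0 (pc, Z, M) pc R A"
  unfolding reaches_def using runs_0 by fastforce

lemma sim_assign:
  assumes "sim L w R A Z M" "x < 2 ^ w"
  shows "sim L w (R(v := x)) A (Z(2 * v + 1 := x)) M"
  using assms unfolding sim_def by auto

lemma sim_write:
  assumes "sim L w R A Z M" "x < 2 ^ w" "i < L" "j < 32"
  shows "sim L w R (A(j := (A j)(i := x))) Z (M(j * L + i := x))"
  using assms unfolding sim_def by (auto simp: addr_inj)

lemma compB_correct:
  assumes "code_at P pc (compB b l)" "bok L (2 ^ w) b R A" "sim L w R A Z M"
    "32 * L \<le> 2 ^ w" "(32::nat) \<le> 2 ^ w"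
  shows "reaches P w L (bcost b + 1) (pc, Z, M) (if bval b R A then l else pc + (bcost b + 1)) R A"
proof -
  obtain a a' where b: "b = Less a a' \<or> b = Equal a a'" by (cases b) auto
  let ?i = "if b = Less a a' then JumpLess 2 4 l else JumpEq 2 4 l"
  have code: "code_at P pc (compA a 1 @ compA a' 2 @ [?i])" using assms(1) b by auto
  note c = code_at_append[OF code] code_at_append[OF code_at_append[OF code, THEN conjunct2]]
  have ok: "aok L (2 ^ w) a R A" "aok L (2 ^ w) a' R A" and cost: "bcost b = acost a + acost a'"
    using assms(2) b by auto
  obtain Z1 where Z1: "runs w P (acost a) (pc, Z, M) (pc + acost a, Z1, M)" "Z1 2 = aval a R A"
    "sim L w R A Z1 M"
    using compA_correct[of P pc a 1 L w R A Z M] c ok(1) assms(3-5) by auto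
  obtain Z2 where Z2: "runs w P (acost a') (pc + acost a, Z1, M) (pc + acost a + acost a', Z2, M)"
    "Z2 4 = aval a' R A" "Z2 2 = Z1 2" "sim L w R A Z2 M"
    using compA_correct[of P "pc + acost a" a' 2 L w R A Z1 M] c ok(2) Z1(3) assms(4,5)
    by (auto simp: length_compA dest!: spec[of _ 1])
  have "runs w P 1 (pc + acost a + acost a', Z2, M)
      (if bval b R A then l else pc + acost a + acost a' + 1, Z2, M)"
    using c b Z1(2) Z2(2,3) by (intro runs_1[of _ _ ?i]) (auto simp: length_compA)
  from runs_trans[OF runs_trans[OF Z1(1) Z2(1)] this]
  have "runs w P (bcost b + 1) (pc, Z, M) (if bval b R A then l else pc + (bcost b + 1), Z2, M)"
    unfolding cost add.assoc .
  from reaches_runs[OF this _ reaches_sim[OF Z2(4)]] show ?thesis by simp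
qed

lemma reaches_jump:
  "\<lbrakk>code_at P pc [Jump l]; reaches P w L n (l, Z, M) pc' R A\<rbrakk> \<Longrightarrow> reaches P w L (Suc n) (pc, Z, M) pc' R A"
  using reaches_runs[OF runs_1[of P pc "Jump l"]] by fastforce

text \<open>The induction is on the derivation rather than on the command, since a loop runs the
  same code again. The counter is exact: the machine takes precisely \<open>t' - t\<close>
  steps.\<close>

theorem compC_correct:
  assumes "exec L (2 ^ w) c s s'" "32 * L \<le> 2 ^ w" "(32::nat) \<le> 2 ^ w"
  shows "\<lbrakk>s = (R, A, t); s' = (R', A', t'); code_at P pc (compC c pc); sim L w R A Z M\<rbrakk> \<Longrightarrow>
    \<exists>n. t' = t + n \<and> reaches P w L n (pc, Z, M) (pc + length (compC c pc)) R' A'"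
  using assms(1)
proof (induction arbitrary: pc R A t R' A' t' Z M rule: exec.induct)
  case (exec_Skip s)
  then show ?case using reaches_sim by simp
next
  case (exec_Assign a R1 A1 v t1)
  then have eq: "R1 = R" "A1 = A" "t1 = t" "R' = R(v := aval a R A)" "A' = A" "t' = t + acost a + 1"
    by auto
  note c = code_at_append[of P pc "compA a 1" "[Move (2 * v + 1) 2]"]
  obtain Z1 where Z1: "runs w P (acost a) (pc, Z, M) (pc + acost a, Z1, M)" "Z1 2 = aval a R A"
    "sim L w R A Z1 M"
    using compA_correct[of P pc a 1 L w R A Z M] c exec_Assign eq assms(2,3) by auto
  have "runs w P 1 (pc + acost a, Z1, M) (pc + acost a + 1, Z1(2 * v + 1 := aval a R A), M)"
    using c exec_Assign.prems(3) Z1(2) by (intro runs_1) (auto simp: length_compA)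
  from runs_trans[OF Z1(1) this] sim_assign[OF Z1(3), of "aval a R A" v] aval_less[OF _ exec_Assign.prems(4)]
  have "reaches P w L (acost a + 1 + 0) (pc, Z, M) (pc + acost a + 1) R' A'"
    using exec_Assign.hyps eq assms(3) by (intro reaches_runs[OF _ _ reaches_sim]) auto
  then show ?case using eq(6) by (simp add: length_compA)
next
  case (exec_Write j a R1 A1 b t1)
  then have eq: "R1 = R" "A1 = A" "t1 = t" "R' = R" "A' = A(j := (A j)(aval a R A := aval b R A))"
    "t' = t + acost a + acost b + 4" and hyps: "j < 32" "aok L (2 ^ w) a R A" "aok L (2 ^ w) b R A"
    "aval a R A < L" and sim: "sim L w R A Z M" by auto
  let ?is = "[Const 4 j, Arith Mul 4 4 0, Arith Add 2 2 4]"
  let ?a = "j * L + aval a R A"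
  note c = code_at_append[of P pc "compA a 1" "?is @ compA b 2 @ [Store 2 4]"]
  have c0: "code_at P pc (compA a 1)" and c1: "code_at P (pc + acost a) (?is @ compA b 2 @ [Store 2 4])"
    using c exec_Write.prems(3) by (auto simp: length_compA)
  have c2: "code_at P (pc + acost a) ?is" and c3: "code_at P (pc + acost a + 3) (compA b 2 @ [Store 2 4])"
    using code_at_append[OF c1] by (auto simp: numeral_3_eq_3)
  have c4: "code_at P (pc + acost a + 3) (compA b 2)"
    and c5: "code_at P (pc + acost a + 3 + acost b) [Store 2 4]"
    using code_at_append[OF c3] by (auto simp only: length_compA)
  obtain Z1 where Z1: "runs w P (acost a) (pc, Z, M) (pc + acost a, Z1, M)" "Z1 2 = aval a R A"
    "sim L w R A Z1 M"
    using compA_correct[OF c0 hyps(2) sim _ assms(2,3)] by auto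
  have bd: "?a < 2 ^ w" using addr_less hyps(1,4) assms(2) by simp
  then have bd2: "j * L < 2 ^ w" "j < 2 ^ w" using hyps(1) assms(3) by auto
  have Z0: "Z1 0 = L" using Z1(3) by (simp add: sim_def)
  have s: "\<And>k Z M. k < 3 \<Longrightarrow> step w P (pc + acost a + k, Z, M) =
      exec_instr w (?is ! k) (pc + acost a + k, Z, M)"
    using code_at_step[OF c2] by simp
  let ?Z1 = "Z1(4 := j)" and ?Z2 = "Z1(4 := j * L)" and ?Z3 = "Z1(4 := j * L, 2 := ?a)"
  have 1: "step w P (pc + acost a, Z1, M) = (pc + acost a + 1, ?Z1, M)"
    using s[of 0] bd2 by simp
  have 2: "step w P (pc + acost a + 1, ?Z1, M) = (pc + acost a + 2, ?Z2, M)"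
    using s[of 1 ?Z1] bd2 Z0 by simp
  have 3: "step w P (pc + acost a + 2, ?Z2, M) = (pc + acost a + 3, ?Z3, M)"
    using s[of 2 ?Z2] bd Z1(2) by (simp add: add.commute)
  have run2: "runs w P 3 (pc + acost a, Z1, M) (pc + acost a + 3, ?Z3, M)"
    using runs_trans[OF runs_trans[OF 1[folded runs_one] 2[folded runs_one]] 3[folded runs_one]]
    by (simp add: eval_nat_numeral)
  have sim3: "sim L w R A ?Z3 M"
    using sim_temp[OF sim_temp[OF Z1(3), of 2 "j * L"], of 1 ?a] bd bd2 by simp
  obtain Z4 where Z4: "runs w P (acost b) (pc + acost a + 3, ?Z3, M) (pc + acost a + 3 + acost b, Z4, M)"
    "Z4 4 = aval b R A" "Z4 2 = ?a" "sim L w R A Z4 M"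
    using compA_correct[OF c4 hyps(3) sim3 _ assms(2,3)] by (auto dest!: spec[of _ 1])
  let ?M = "M(?a := aval b R A)"
  have "runs w P 1 (pc + acost a + 3 + acost b, Z4, M) (pc + acost a + 3 + acost b + 1, Z4, ?M)"
    using Z4 by (intro runs_1[OF c5]) auto
  note run = runs_trans[OF runs_trans[OF runs_trans[OF Z1(1) run2] Z4(1)] this]
  have "sim L w R (A(j := (A j)(aval a R A := aval b R A))) Z4 ?M"
    using sim_write[OF Z4(4) aval_less[OF hyps(3) sim assms(3)] hyps(4,1)] .
  moreover have "\<forall>a\<ge>32 * L. ?M a = M a" using addr_less[OF hyps(1,4) order_refl] by auto
  ultimately have "reaches P w L (acost a + 3 + acost b + 1 + 0) (pc, Z, M)
      (pc + acost a + 3 + acost b + 1) R' A'"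
    using run eq by (intro reaches_runs[OF _ _ reaches_sim]) auto
  moreover have "length (compC (Write j a b) pc) = acost a + 3 + acost b + 1"
    by (simp add: length_compA)
  moreover have "t' = t + (acost a + 3 + acost b + 1 + 0)" using eq(6) by simp
  ultimately show ?case by (metis add.assoc)
next
  case (exec_Seq c s s1 c' s2)
  obtain R1 A1 t1 where s1: "s1 = (R1, A1, t1)" by (metis prod_cases3)
  have c: "code_at P pc (compC c pc)"
    "code_at P (pc + length (compC c pc)) (compC c' (pc + length (compC c pc)))"
    using code_at_append[of P pc "compC c pc"] exec_Seq.prems(3) by auto
  obtain n where n: "t1 = t + n" "reaches P w L n (pc, Z, M) (pc + length (compC c pc)) R1 A1"
    using exec_Seq.IH(1)[OF exec_Seq.prems(1) s1 c(1) exec_Seq.prems(4)] by auto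
  then obtain Z1 M1 where run: "runs w P n (pc, Z, M) (pc + length (compC c pc), Z1, M1)"
    "sim L w R1 A1 Z1 M1" "\<forall>a\<ge>32 * L. M1 a = M a"
    unfolding reaches_def by auto
  obtain n' where "t' = t1 + n'" "reaches P w L n' (pc + length (compC c pc), Z1, M1)
      (pc + length (compC c pc) + length (compC c' (pc + length (compC c pc)))) R' A'"
    using exec_Seq.IH(2)[OF s1 exec_Seq.prems(2) c(2) run(2)] by auto
  with reaches_runs[OF run(1,3)] n(1) show ?case by (intro exI[of _ "n + n'"]) (simp add: add.assoc)
next
  case (exec_CondT b R1 A1 c t1 s' c')
  then have eq: "R1 = R" "A1 = A" "t1 = t" by auto
  define C' where "C' = compC c' (pc + bcost b + 1)"
  define pc2 where "pc2 = pc + bcost b + 1 + length C' + 1"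
  define C where "C = compC c pc2"
  have code: "code_at P pc (compB b pc2 @ C' @ [Jump (pc2 + length C)] @ C)"
    and len: "length (compC (Cond b c c') pc) = bcost b + 1 + length C' + 1 + length C"
    using exec_CondT.prems(3) unfolding C'_def pc2_def C_def by (auto simp: Let_def length_compB)
  note c = code_at_append[OF code, unfolded length_compB]
  have cC: "code_at P pc2 C"
    using code_at_append[of P "pc + (bcost b + 1)" "C' @ [Jump (pc2 + length C)]" C] c
    by (auto simp: pc2_def add.assoc)
  have run: "reaches P w L (bcost b + 1) (pc, Z, M) pc2 R A"
    using compB_correct[of P pc b pc2 L w R A Z M] c exec_CondT.hyps exec_CondT.prems(4) assms(2,3) eq
    by auto
  then obtain Z1 M1 where run: "runs w P (bcost b + 1) (pc, Z, M) (pc2, Z1, M1)"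
    "sim L w R A Z1 M1" "\<forall>a\<ge>32 * L. M1 a = M a"
    unfolding reaches_def by auto
  obtain n where n: "t' = t + bcost b + 1 + n" "reaches P w L n (pc2, Z1, M1) (pc2 + length C) R' A'"
    using exec_CondT.IH[OF _ exec_CondT.prems(2) cC[unfolded C_def], of R A "t + bcost b + 1" Z1 M1] eq run(2)
    unfolding C_def[symmetric] by auto
  show ?case using reaches_runs[OF run(1,3) n(2)] n(1) unfolding len
    by (intro exI[of _ "bcost b + 1 + n"]) (simp add: pc2_def add.assoc)
next
  case (exec_CondF b R1 A1 c' t1 R2 A2 t2 c)
  then have eq: "R1 = R" "A1 = A" "t1 = t" "R2 = R'" "A2 = A'" "t' = t2 + 1" by auto
  define pc1 where "pc1 = pc + bcost b + 1"
  define C' where "C' = compC c' pc1"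
  define pc2 where "pc2 = pc1 + length C' + 1"
  define C where "C = compC c pc2"
  have code: "code_at P pc (compB b pc2 @ C' @ [Jump (pc2 + length C)] @ C)"
    and len: "length (compC (Cond b c c') pc) = bcost b + 1 + length C' + 1 + length C"
    using exec_CondF.prems(3) unfolding C'_def pc1_def pc2_def C_def
    by (auto simp: Let_def length_compB)
  note c = code_at_append[OF code, unfolded length_compB]
  have cC: "code_at P pc1 C'" "code_at P (pc1 + length C') [Jump (pc2 + length C)]"
    using code_at_append[of P pc1 C' "[Jump (pc2 + length C)] @ C"]
      code_at_append[of P "pc1 + length C'" "[Jump (pc2 + length C)]" C] c
    by (auto simp: pc1_def add.assoc)
  have run: "reaches P w L (bcost b + 1) (pc, Z, M) pc1 R A"
    using compB_correct[of P pc b pc2 L w R A Z M] c exec_CondF.hyps exec_CondF.prems(4) assms(2,3) eq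
    by (auto simp: pc1_def)
  then obtain Z1 M1 where run: "runs w P (bcost b + 1) (pc, Z, M) (pc1, Z1, M1)"
    "sim L w R A Z1 M1" "\<forall>a\<ge>32 * L. M1 a = M a"
    unfolding reaches_def by auto
  obtain n where n: "t2 = t + bcost b + 1 + n" "reaches P w L n (pc1, Z1, M1) (pc1 + length C') R' A'"
    using exec_CondF.IH[OF _ _ cC(1)[unfolded C'_def], of R A "t + bcost b + 1" R' A' t2 Z1 M1] eq run(2)
    unfolding C'_def[symmetric] by auto
  have "reaches P w L (n + Suc 0) (pc1, Z1, M1) (pc2 + length C) R' A'"
    using n(2) by (rule reaches_trans) (rule reaches_jump[OF cC(2) reaches_sim])
  from reaches_runs[OF run(1,3) this] show ?case using n(1) eq unfolding len
    by (intro exI[of _ "bcost b + 1 + (n + Suc 0)"]) (simp add: pc1_def pc2_def add.assoc)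
next
  case (exec_WhileT b R1 A1 c t1 R2 A2 t2 s2)
  then have eq: "R1 = R" "A1 = A" "t1 = t" by auto
  define pc1 where "pc1 = pc + bcost b + 2"
  define C where "C = compC c pc1"
  have code: "code_at P pc (compB b pc1 @ [Jump (pc1 + length C + 1)] @ C @ [Jump pc])"
    and len: "length (compC (While b c) pc) = bcost b + 1 + 1 + length C + 1"
    using exec_WhileT.prems(3) unfolding pc1_def C_def by (auto simp: Let_def length_compB)
  note c = code_at_append[OF code, unfolded length_compB]
  have cC: "code_at P pc1 C" "code_at P (pc1 + length C) [Jump pc]"
    using code_at_append[of P "pc + (bcost b + 1)" "[Jump (pc1 + length C + 1)]" "C @ [Jump pc]"]
      code_at_append[of P pc1 C "[Jump pc]"] c
    by (auto simp: pc1_def add.assoc)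
  have run: "reaches P w L (bcost b + 1) (pc, Z, M) pc1 R A"
    using compB_correct[of P pc b pc1 L w R A Z M] c exec_WhileT.hyps exec_WhileT.prems(4) assms(2,3) eq
    by auto
  then obtain Z1 M1 where run: "runs w P (bcost b + 1) (pc, Z, M) (pc1, Z1, M1)"
    "sim L w R A Z1 M1" "\<forall>a\<ge>32 * L. M1 a = M a"
    unfolding reaches_def by auto
  obtain n where n: "t2 = t + bcost b + 1 + n" "reaches P w L n (pc1, Z1, M1) (pc1 + length C) R2 A2"
    using exec_WhileT.IH(1)[OF _ _ cC(1)[unfolded C_def], of R A "t + bcost b + 1" R2 A2 t2 Z1 M1] eq run(2)
    unfolding C_def[symmetric] by auto
  have "reaches P w L (n + Suc 0) (pc1, Z1, M1) pc R2 A2"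
    using n(2) by (rule reaches_trans) (rule reaches_jump[OF cC(2) reaches_sim])
  from reaches_runs[OF run(1,3) this]
  have "reaches P w L (bcost b + 1 + (n + Suc 0)) (pc, Z, M) pc R2 A2" .
  then obtain Z2 M2 where run2: "runs w P (bcost b + 1 + (n + Suc 0)) (pc, Z, M) (pc, Z2, M2)"
    "sim L w R2 A2 Z2 M2" "\<forall>a\<ge>32 * L. M2 a = M a"
    unfolding reaches_def by auto
  obtain n' where n': "t' = t2 + 1 + n'" "reaches P w L n' (pc, Z2, M2)
      (pc + length (compC (While b c) pc)) R' A'"
    using exec_WhileT.IH(2)[OF refl exec_WhileT.prems(2,3) run2(2)] by auto
  show ?case using reaches_runs[OF run2(1,3) n'(2)] n(1) n'(1)
    by (intro exI[of _ "bcost b + 1 + (n + Suc 0) + n'"]) (simp only: add.assoc, simp)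
next
  case (exec_WhileF b R1 A1 c t1)
  then have eq: "R1 = R" "A1 = A" "t1 = t" "R' = R" "A' = A" "t' = t + bcost b + 2" by auto
  define pc1 where "pc1 = pc + bcost b + 2"
  define C where "C = compC c pc1"
  have code: "code_at P pc (compB b pc1 @ [Jump (pc1 + length C + 1)] @ C @ [Jump pc])"
    and len: "length (compC (While b c) pc) = bcost b + 1 + 1 + length C + 1"
    using exec_WhileF.prems(3) unfolding pc1_def C_def by (auto simp: Let_def length_compB)
  note c = code_at_append[OF code, unfolded length_compB]
  have cC: "code_at P (pc + (bcost b + 1)) [Jump (pc1 + length C + 1)]"
    using code_at_append[of P "pc + (bcost b + 1)" "[Jump (pc1 + length C + 1)]" "C @ [Jump pc]"] c
    by auto
  have "reaches P w L (bcost b + 1) (pc, Z, M) (pc + (bcost b + 1)) R A"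
    using compB_correct[of P pc b pc1 L w R A Z M] c exec_WhileF.hyps exec_WhileF.prems(4) assms(2,3) eq
    by auto
  then have "reaches P w L (bcost b + 1 + Suc 0) (pc, Z, M) (pc1 + length C + 1) R A"
    by (rule reaches_trans) (rule reaches_jump[OF cC reaches_sim])
  then show ?case using eq unfolding len
    by (intro exI[of _ "bcost b + 1 + Suc 0"]) (simp add: pc1_def add.assoc)
qed

section \<open>Loops and linked lists\<close>

definition for_loop :: "nat \<Rightarrow> nat \<Rightarrow> com \<Rightarrow> com" where
  "for_loop v hi c = While (Less (Var v) (Var hi)) (c ;; v ::= Plus (Var v) (Lit 1))"

text \<open>The numbers 3, 5 and 4 are the steps of a passed test, of the increment with the jump
  back, and of the failed test with the exit jump. \<open>n < W\<close> keeps the last increment,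
  which reaches \<open>n\<close>, inside a word.\<close>

lemma wp_for_loop:
  assumes "I lo (R, A, t)" "lo \<le> n" "n < W"
    and step: "\<And>i R A t. \<lbrakk>I i (R, A, t); lo \<le> i; i < n\<rbrakk> \<Longrightarrow> R v = i \<and> R hi = n \<and>
      wp L W c (\<lambda>(R', A', t'). R' v = i \<and> I (Suc i) (R'(v := Suc i), A', t' + 5)) (R, A, t + 3)"
    and final: "\<And>R A t. I n (R, A, t) \<Longrightarrow> R v = n \<and> R hi = n \<and> Q (R, A, t + 4)"
  shows "wp L W (for_loop v hi c) Q (R, A, t)"
  unfolding for_loop_def
proof (rule wp_While_count[where I = "\<lambda>i s. lo \<le> i \<and> I i s" and i = lo and n = n])
  fix i R A t
  assume "lo \<le> i \<and> I i (R, A, t)" and i: "i < n"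
  then have i: "lo \<le> i" "i < n" and I: "I i (R, A, t)" by auto
  note s = step[OF I i]
  have "wp L W (c ;; v ::= Plus (Var v) (Lit 1)) (\<lambda>(R', A', t'). lo \<le> Suc i \<and> I (Suc i) (R', A', t' + 1))
      (R, A, t + 3)"
    unfolding wp_Seq
    by (rule wp_mono[OF conjunct2[OF conjunct2[OF s]]]) (use i assms(3) in \<open>auto simp: eval_nat_numeral\<close>)
  then show "bok L W (Less (Var v) (Var hi)) R A \<and> bval (Less (Var v) (Var hi)) R A \<and>
      wp L W (c ;; v ::= Plus (Var v) (Lit 1)) (\<lambda>(R', A', t'). lo \<le> Suc i \<and> I (Suc i) (R', A', t' + 1))
      (R, A, t + bcost (Less (Var v) (Var hi)) + 1)"
    using s i by (simp add: eval_nat_numeral)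
next
  fix R A t
  assume "lo \<le> n \<and> I n (R, A, t)"
  then show "bok L W (Less (Var v) (Var hi)) R A \<and> \<not> bval (Less (Var v) (Var hi)) R A \<and>
      Q (R, A, t + bcost (Less (Var v) (Var hi)) + 2)"
    using final[of R A t] by (simp add: eval_nat_numeral)
qed (use assms in auto)

text \<open>Pointers are positions shifted by one, so that zero is the null pointer.\<close>

fun chain :: "(nat \<Rightarrow> nat) \<Rightarrow> nat \<Rightarrow> nat list \<Rightarrow> bool" where
  "chain nx h [] \<longleftrightarrow> h = 0"
| "chain nx h (p # ps) \<longleftrightarrow> h = Suc p \<and> chain nx (nx p) ps"

lemma chain_update: "p \<notin> set ps \<Longrightarrow> chain (nx(p := x)) h ps = chain nx h ps"
  by (induction nx h ps rule: chain.induct) auto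

text \<open>Prepending cell \<open>i\<close> to list \<open>f i\<close> disturbs no list, as all of
  them consist of smaller positions. Prepending also explains the \<open>rev\<close>.\<close>

lemma chain_insert:
  assumes "\<And>b. chain nx (head b) (rev (filter (\<lambda>p. f p = b) [0..<i]))"
  shows "chain (nx(i := head (f i))) ((head(f i := Suc i)) b) (rev (filter (\<lambda>p. f p = b) [0..<Suc i]))"
  using assms by (auto simp: chain_update)

definition walk :: "nat \<Rightarrow> nat \<Rightarrow> nat \<Rightarrow> com \<Rightarrow> com" where
  "walk h p nx c = While (Less (Lit 0) (Var h))
    (p ::= Minus (Var h) (Lit 1) ;; c ;; h ::= Ld nx (Var p))"

text \<open>\<open>ds\<close> are the cells already visited, so an invariant can speak about a
  prefix of the list. The links must survive the body, which may write every other array. The two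
  summands 7 are the steps before and after the body.\<close>

lemma wp_walk:
  assumes "I [] (R, A, t)" "chain nxt (R h) ps" "A nx = nxt" "nx < 32" "h \<noteq> p"
    and bound: "\<And>p. p \<in> set ps \<Longrightarrow> p < L"
    and step: "\<And>ds q xs R A t. \<lbrakk>ps = ds @ q # xs; I ds (R, A, t); A nx = nxt\<rbrakk> \<Longrightarrow>
      wp L W c (\<lambda>(R', A', t'). R' p = q \<and> A' nx = nxt \<and> I (ds @ [q]) (R'(h := nxt q), A', t' + 7))
        (R(p := q), A, t + 7)"
    and final: "\<And>R A t. I ps (R, A, t) \<Longrightarrow> A nx = nxt \<Longrightarrow> Q (R, A, t + 4)"
  shows "wp L W (walk h p nx c) Q (R, A, t)"
  unfolding walk_def
proof (rule wp_While_list[where xs = ps and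
      I = "\<lambda>xs (R, A, t). \<exists>ds. ps = ds @ xs \<and> I ds (R, A, t) \<and> A nx = nxt \<and> chain nxt (R h) xs"])
  fix q xs R A t
  assume "case (R, A, t) of (R, A, t) \<Rightarrow>
    \<exists>ds. ps = ds @ q # xs \<and> I ds (R, A, t) \<and> A nx = nxt \<and> chain nxt (R h) (q # xs)"
  then obtain ds where ds: "ps = ds @ q # xs" "I ds (R, A, t)" "A nx = nxt" "R h = Suc q"
    "chain nxt (nxt q) xs" by auto
  have q: "q < L" using bound ds(1) by simp
  have "wp L W (c ;; h ::= Ld nx (Var p)) (\<lambda>(R', A', t').
      \<exists>ds. ps = ds @ xs \<and> I ds (R', A', t' + 1) \<and> A' nx = nxt \<and> chain nxt (R' h) xs) (R(p := q), A, t + 7)"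
    unfolding wp_Seq
    by (rule wp_mono[OF step[OF ds(1-3)]])
      (use ds q assms(4) in \<open>auto intro!: exI[of _ "ds @ [q]"] simp: eval_nat_numeral\<close>)
  then show "bok L W (Less (Lit 0) (Var h)) R A \<and> bval (Less (Lit 0) (Var h)) R A \<and>
    wp L W (p ::= Minus (Var h) (Lit 1) ;; c ;; h ::= Ld nx (Var p)) (\<lambda>(R', A', t').
      case (R', A', t' + 1) of (R, A, t) \<Rightarrow>
      \<exists>ds. ps = ds @ xs \<and> I ds (R, A, t) \<and> A nx = nxt \<and> chain nxt (R h) xs)
      (R, A, t + bcost (Less (Lit 0) (Var h)) + 1)"
    using ds by (simp add: eval_nat_numeral)
qed (use assms in \<open>auto simp: eval_nat_numeral\<close>)

section \<open>The program\<close>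

abbreviation (input) unchanged :: "nat set \<Rightarrow> (nat \<Rightarrow> 'b) \<Rightarrow> (nat \<Rightarrow> 'b) \<Rightarrow> bool" where
  "unchanged V f g \<equiv> \<forall>v. v \<notin> V \<longrightarrow> g v = f v"

abbreviation (input) unchanged_except :: "nat \<Rightarrow> (nat \<Rightarrow> 'b) \<Rightarrow> (nat \<Rightarrow> 'b) \<Rightarrow> bool" where
  "unchanged_except a f g \<equiv> \<forall>j. j \<noteq> a \<longrightarrow> g j = f j"

text \<open>Variable \<open>v\<close> sits in register \<open>2 * v + 1\<close>: the prologue loads
  registers 5, 7, 9 and 11, register 13 receives \<open>L\<close>, and register 15 the address of
  the output.\<close>

abbreviation (input) "vD \<equiv> 2 :: nat"
abbreviation (input) "vK \<equiv> 3 :: nat"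
abbreviation (input) "vN \<equiv> 4 :: nat"
abbreviation (input) "vM \<equiv> 5 :: nat"
abbreviation (input) "vL \<equiv> 6 :: nat"
abbreviation (input) "vOut \<equiv> 7 :: nat"
abbreviation (input) "vIds \<equiv> 8 :: nat"
abbreviation (input) "vQ \<equiv> 9 :: nat"
abbreviation (input) "vU \<equiv> 10 :: nat"
abbreviation (input) "vH \<equiv> 11 :: nat"
abbreviation (input) "vP \<equiv> 12 :: nat"
abbreviation (input) "vX \<equiv> 13 :: nat"
abbreviation (input) "vI \<equiv> 14 :: nat"
abbreviation (input) "vE \<equiv> 15 :: nat"
abbreviation (input) "vS \<equiv> 16 :: nat"
abbreviation (input) "vJ \<equiv> 17 :: nat"
abbreviation (input) "vF \<equiv> 18 :: nat"
abbreviation (input) "vKK \<equiv> 19 :: nat"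
abbreviation (input) "vSz \<equiv> 20 :: nat"
abbreviation (input) "vR \<equiv> 21 :: nat"
abbreviation (input) "vNu \<equiv> 22 :: nat"
abbreviation (input) "vB \<equiv> 23 :: nat"
abbreviation (input) "vO \<equiv> 24 :: nat"
abbreviation (input) "vCnt \<equiv> 25 :: nat"
abbreviation (input) "vY \<equiv> 26 :: nat"
abbreviation (input) "vT \<equiv> 27 :: nat"

text \<open>Array 0 begins at address 0 and so contains the input words as they stand. Arrays 1 to
  19 lie behind the input and are zero at the start.\<close>

abbreviation (input) "aIn \<equiv> 0 :: nat"
abbreviation (input) "aHead \<equiv> 2 :: nat"
abbreviation (input) "aNext \<equiv> 3 :: nat"
abbreviation (input) "aCur \<equiv> 4 :: nat"
abbreviation (input) "aSub \<equiv> 5 :: nat"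
abbreviation (input) "aOwn \<equiv> 6 :: nat"
abbreviation (input) "aStart \<equiv> 7 :: nat"
abbreviation (input) "aSize \<equiv> 8 :: nat"
abbreviation (input) "aParent \<equiv> 9 :: nat"
abbreviation (input) "aElem \<equiv> 10 :: nat"
abbreviation (input) "aStamp \<equiv> 11 :: nat"
abbreviation (input) "aChild \<equiv> 12 :: nat"
abbreviation (input) "aHeadB \<equiv> 13 :: nat"
abbreviation (input) "aNextB \<equiv> 14 :: nat"
abbreviation (input) "aGood \<equiv> 15 :: nat"
abbreviation (input) "aDead \<equiv> 16 :: nat"
abbreviation (input) "aCnt \<equiv> 17 :: nat"
abbreviation (input) "aNonmin \<equiv> 18 :: nat"
abbreviation (input) "aMark \<equiv> 19 :: nat"
abbreviation (input) "aOut \<equiv> 20 :: nat"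

text \<open>A bucket sort of the input positions by element. The offset 4 skips the header
  \<open>d\<close>, \<open>k\<close>, \<open>n\<close>, \<open>m\<close>; the resulting lists of
  occurrences drive the loop over \<open>u\<close> in \<open>build_trie\<close>.\<close>

definition bucket_elements :: com where
  "bucket_elements =
    vE ::= Times (Var vD) (Var vN) ;; vP ::= Lit 0 ;;
    for_loop vP vE (
      vU ::= Ld aIn (Plus (Var vP) (Lit 4)) ;;
      Write aNext (Var vP) (Ld aHead (Var vU)) ;;
      Write aHead (Var vU) (Plus (Var vP) (Lit 1)))"

text \<open>
  Every set that occurs as a subset of an input set gets an identifier; \<open>aStart\<close> delimits the block
  of positions \<open>p\<close> with \<open>aOwn p = i\<close>, whose entries \<open>aSub p\<close> enumerate the subsets of set \<open>i\<close>.
  The block of \<open>S \<union> {u}\<close> interleaves that of \<open>S\<close> with the children of its entries. These children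
  exist already, because a block lists every set after all of its subsets.
  An entry of \<open>aChild\<close> is valid only if the corresponding stamp belongs to the current \<open>u\<close>,
  which replaces a dictionary.
\<close>

definition new_child :: com where
  "new_child =
    Write aStamp (Var vS) (Plus (Var vU) (Lit 1)) ;;
    Write aChild (Var vS) (Var vIds) ;;
    Write aSize (Var vIds) (Plus (Ld aSize (Var vS)) (Lit 1)) ;;
    Write aParent (Var vIds) (Var vS) ;;
    Write aElem (Var vIds) (Var vU) ;;
    vJ ::= Ld aStart (Var vS) ;; vF ::= Ld aStart (Plus (Var vS) (Lit 1)) ;;
    for_loop vJ vF (
      Write aSub (Var vQ) (Ld aSub (Var vJ)) ;;
      Write aOwn (Var vQ) (Var vIds) ;;
      Write aSub (Plus (Var vQ) (Lit 1)) (Ld aChild (Ld aSub (Var vJ))) ;;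
      Write aOwn (Plus (Var vQ) (Lit 1)) (Var vIds) ;;
      vQ ::= Plus (Var vQ) (Lit 2)) ;;
    vIds ::= Plus (Var vIds) (Lit 1) ;;
    Write aStart (Var vIds) (Var vQ)"

definition new_children :: com where
  "new_children = for_loop vI vE (
      vS ::= Ld aSub (Var vI) ;;
      Cond (Equal (Ld aStamp (Var vS)) (Plus (Var vU) (Lit 1))) Skip new_child)"

text \<open>All sets have size \<open>d\<close>, so position \<open>p\<close> belongs to input set
  \<open>p div d\<close>. \<open>aCur\<close> holds the identifier of the part of an input set
  inserted so far, and the block of that identifier lists exactly the sets to be extended by
  \<open>u\<close>.\<close>

definition extend_set :: com where
  "extend_set =
    vY ::= Divide (Var vP) (Var vD) ;; vX ::= Ld aCur (Var vY) ;;
    vI ::= Ld aStart (Var vX) ;; vE ::= Ld aStart (Plus (Var vX) (Lit 1)) ;;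
    new_children ;;
    Write aCur (Var vY) (Ld aChild (Var vX))"

text \<open>Identifier 0 is the empty set, whose block is the single pair (0, 0) at position 0. The
  initial zeros describe it completely, except for the end of its block in
  \<open>aStart 1\<close>.\<close>

definition build_trie :: com where
  "build_trie =
    vIds ::= Lit 1 ;; vQ ::= Lit 1 ;; Write aStart (Lit 1) (Lit 1) ;; vU ::= Lit 0 ;;
    for_loop vU vM (vH ::= Ld aHead (Var vU) ;; walk vH vP aNext extend_set)"

definition mark_input :: com where
  "mark_input = vY ::= Lit 0 ;; for_loop vY vN (Write aGood (Ld aCur (Var vY)) (Lit 1))"

definition bucket_pairs :: com where
  "bucket_pairs = vP ::= Lit 0 ;;
    for_loop vP vQ (
      vB ::= Plus (Times (Minus (Var vD) (Ld aSize (Ld aSub (Var vP)))) (Plus (Var vD) (Lit 1)))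
        (Minus (Ld aSize (Ld aOwn (Var vP))) (Ld aSize (Ld aSub (Var vP)))) ;;
      Write aNextB (Var vP) (Ld aHeadB (Var vB)) ;;
      Write aHeadB (Var vB) (Plus (Var vP) (Lit 1)))"

definition walk_bucket :: "com \<Rightarrow> com" where
  "walk_bucket c = vH ::= Ld aHeadB (Var vB) ;; walk vH vP aNextB c"

definition count_supersets :: com where
  "count_supersets = walk_bucket (
     vT ::= Ld aOwn (Var vP) ;;
     Cond (Less (Lit 0) (Ld aGood (Var vT)))
       (Cond (Equal (Ld aDead (Var vT)) (Lit 0))
         (vS ::= Ld aSub (Var vP) ;; Write aCnt (Var vS) (Plus (Ld aCnt (Var vS)) (Lit 1)))
         Skip)
       Skip)"

text \<open>A separate pass after all counting: marking T dead at once would hide it from the counts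
  of other subsets of T in the same round.\<close>

definition mark_good :: com where
  "mark_good = walk_bucket (
     vS ::= Ld aSub (Var vP) ;;
     Cond (Less (Ld aCnt (Var vS)) (Var vNu)) Skip
       (Write aGood (Var vS) (Lit 1) ;; Write aDead (Ld aOwn (Var vP)) (Lit 1)))"

text \<open>Walking the bucket again clears just the counters that the round may have raised, at a
  cost proportional to the bucket.\<close>

definition reset_counts :: com where
  "reset_counts = walk_bucket (Write aCnt (Ld aSub (Var vP)) (Lit 0))"

text \<open>
  The thresholds \<open>nu k r\<close> need not fit into a word. Since there are fewer than \<open>L\<close> sets to count,
  they may be capped at \<open>L\<close>.
\<close>

definition times_capped :: "nat \<Rightarrow> nat \<Rightarrow> com" where
  "times_capped x y = Cond (Less (Divide (Var vL) (Var y)) (Var x))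
    (x ::= Var vL) (x ::= Times (Var x) (Var y))"

text \<open>The two capped products realise the recurrence \<open>nu_Suc\<close>; \<open>vKK\<close>
  holds \<open>k + 1\<close>, itself capped.\<close>

definition good_round :: com where
  "good_round =
    vR ::= Plus (Var vR) (Lit 1) ;; times_capped vNu vR ;; times_capped vNu vKK ;;
    vB ::= Plus (Times (Minus (Var vD) (Var vSz)) (Plus (Var vD) (Lit 1))) (Var vR) ;;
    count_supersets ;; mark_good ;; reset_counts"

text \<open>
  The rounds follow the inductive definition. When round \<open>(l, r)\<close> begins, a set of size \<open>l + r\<close>
  is \<open>(l + r, r)\<close>-strong iff it is marked good and not marked dead.
\<close>

definition find_good :: com where
  "find_good =
    Cond (Less (Var vK) (Var vL)) (vKK ::= Plus (Var vK) (Lit 1)) (vKK ::= Var vL) ;;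
    vSz ::= Var vD ;;
    While (Less (Lit 1) (Var vSz)) (
      vSz ::= Minus (Var vSz) (Lit 1) ;; vNu ::= Lit 1 ;; vR ::= Lit 0 ;;
      vE ::= Minus (Var vD) (Var vSz) ;;
      While (Less (Var vR) (Var vE)) good_round)"

definition mark_nonminimal :: com where
  "mark_nonminimal = vP ::= Lit 0 ;;
    for_loop vP vQ (
      Cond (Less (Lit 0) (Ld aGood (Ld aSub (Var vP))))
        (Cond (Equal (Ld aSub (Var vP)) (Ld aOwn (Var vP))) Skip
          (Write aNonmin (Ld aOwn (Var vP)) (Lit 1)))
        Skip)"

text \<open>The chain of parents spells out the elements of a set and stops at identifier 0, the
  empty set; so no list of elements has to be stored.\<close>

definition climb :: "com \<Rightarrow> com" where
  "climb c = vY ::= Var vX ;; While (Less (Lit 0) (Var vY)) (c ;; vY ::= Ld aParent (Var vY))"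

definition if_kernel :: "com \<Rightarrow> com" where
  "if_kernel c = Cond (Less (Lit 0) (Ld aGood (Var vX)))
    (Cond (Equal (Ld aNonmin (Var vX)) (Lit 0)) c Skip) Skip"

definition mark_universe :: com where
  "mark_universe = vCnt ::= Lit 0 ;; vX ::= Lit 0 ;;
    for_loop vX vIds (if_kernel (
      vCnt ::= Plus (Var vCnt) (Lit 1) ;; climb (Write aMark (Ld aElem (Var vY)) (Lit 1))))"

definition emit :: "aexp \<Rightarrow> com" where
  "emit a = Write aOut (Var vO) a ;; vO ::= Plus (Var vO) (Lit 1)"

text \<open>Cell 0 of the output is left free for the number of elements, which is known only at the
  end.\<close>

definition output_universe :: com where
  "output_universe = vO ::= Lit 1 ;; vU ::= Lit 0 ;;
    for_loop vU vM (Cond (Less (Lit 0) (Ld aMark (Var vU))) (emit (Var vU)) Skip) ;;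
    Write aOut (Lit 0) (Minus (Var vO) (Lit 1))"

definition output_sets :: com where
  "output_sets = emit (Var vCnt) ;; vX ::= Lit 0 ;;
    for_loop vX vIds (if_kernel (emit (Ld aSize (Var vX)) ;; climb (emit (Ld aElem (Var vY)))))"

definition output_kernel :: com where
  "output_kernel = mark_input ;; bucket_pairs ;; find_good ;;
    mark_nonminimal ;; mark_universe ;; output_universe ;; output_sets ;;
    vOut ::= Times (Lit aOut) (Var vL)"

definition kernelize :: com where
  "kernelize = bucket_elements ;; build_trie ;; output_kernel"

text \<open>One length serves all arrays, so it must exceed every index: pairs and identifiers
  number at most \<open>3 ^ d * n\<close>; bucket keys stay below \<open>(d + 1) ^ 2\<close>, which
  is at most four times \<open>3 ^ d\<close>; elements stay below \<open>m\<close>; and 8 leaves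
  room for the headers of input and output.\<close>

definition set_length :: com where
  "set_length = vL ::= Var vN ;; vI ::= Lit 0 ;;
    for_loop vI vD (vL ::= Times (Lit 3) (Var vL)) ;;
    vL ::= Plus (Plus (Times (Lit 4) (Var vL)) (Var vM)) (Lit 8)"

section \<open>Counting subsets\<close>

text \<open>Both sides count pairs Y within X within E: a map from E to three values says of each
  element whether it lies in Y, in X but not in Y, or outside X.\<close>

lemma sum_Pow_card: "finite E \<Longrightarrow> (\<Sum>X\<in>Pow E. 2 ^ card X) = (3 :: nat) ^ card E"
proof (induction E rule: finite_induct)
  case (insert x E)
  have "(\<Sum>X\<in>insert x ` Pow E. 2 ^ card X) = (\<Sum>X\<in>Pow E. 2 ^ card (insert x X) :: nat)"
    using insert.hyps by (subst sum.reindex) (auto simp: inj_on_def)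
  also have "\<dots> = (\<Sum>X\<in>Pow E. 2 * 2 ^ card X)"
    using insert.hyps by (intro sum.cong refl) (auto simp: finite_subset subset_iff card_insert_if)
  finally have "(\<Sum>X\<in>insert x ` Pow E. 2 ^ card X) = 2 * (3 :: nat) ^ card E"
    using insert.IH by (simp add: sum_distrib_left[symmetric])
  moreover have "Pow E \<inter> insert x ` Pow E = {}" using insert.hyps by auto
  ultimately show ?case using insert by (simp add: Pow_insert sum.union_disjoint)
qed simp

lemma sum_UNION_le:
  fixes f :: "'b \<Rightarrow> nat"
  shows "finite I \<Longrightarrow> (\<And>i. i \<in> I \<Longrightarrow> finite (B i)) \<Longrightarrow> sum f (\<Union>i\<in>I. B i) \<le> (\<Sum>i\<in>I. sum f (B i))"
proof (induction I rule: finite_induct)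
  case (insert i I)
  then have "sum f (B i \<union> (\<Union>i\<in>I. B i)) \<le> sum f (B i) + sum f (\<Union>i\<in>I. B i)"
    by (subst sum_Un_nat) auto
  then show ?case using insert by simp
qed simp

lemma sum_subsets_le:
  assumes "finite I" "\<And>E. E \<in> I \<Longrightarrow> finite (ES E) \<and> card (ES E) = d"
    and "\<X> \<subseteq> (\<Union>E\<in>I. Pow (ES E))"
  shows "(\<Sum>X\<in>\<X>. 2 ^ card X) \<le> card I * (3 :: nat) ^ d"
proof -
  have "(\<Sum>X\<in>\<X>. 2 ^ card X) \<le> (\<Sum>X\<in>(\<Union>E\<in>I. Pow (ES E)). 2 ^ card X :: nat)"
    using assms by (intro sum_mono2) auto
  also have "\<dots> \<le> (\<Sum>E\<in>I. \<Sum>X\<in>Pow (ES E). 2 ^ card X)"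
    using assms by (intro sum_UNION_le) auto
  also have "\<dots> = card I * 3 ^ d"
    using assms(1,2) by (subst sum.cong[OF refl, of _ _ "\<lambda>_. 3 ^ d"]) (auto simp: sum_Pow_card)
  finally show ?thesis .
qed

text \<open>Pays for the costs that grow with the number of size pairs (l, r) instead of the number
  of set pairs. From \<open>d = 2\<close> on the right side triples while the left side grows by a
  smaller factor.\<close>

lemma Suc_square_le_pow3: "(d + 1) * (d + 1) \<le> 4 * (3 :: nat) ^ d"
proof (induction d)
  case (Suc d)
  show ?case
  proof (cases "d \<le> 1")
    case False
    then have "Suc (Suc d) * Suc (Suc d) \<le> 3 * (Suc d * Suc d)"
      using mult_le_mono1[of 2 d d] by (simp add: algebra_simps)
    then show ?thesis using Suc by simp
  qed (auto simp: le_Suc_eq)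
qed simp

section \<open>The trie of subsets\<close>

text \<open>\<open>st\<close> is a ghost map from identifiers to sets. In a block each subset of an
  entry stands at an earlier or equal position, and the last entry of the block of \<open>i\<close>
  is \<open>i\<close>. This forces the block to list all subsets of \<open>st i\<close>, and it
  guarantees that the children needed for copying a block exist in time.\<close>

definition trie :: "(nat \<Rightarrow> nat set) \<Rightarrow> nat \<Rightarrow> nat \<Rightarrow> (nat \<Rightarrow> nat \<Rightarrow> nat) \<Rightarrow> bool" where
  "trie st N q A \<longleftrightarrow> 0 < N \<and> st 0 = {} \<and> inj_on st {..<N} \<and> A aStart 0 = 0 \<and> A aStart N = q \<and>
    (\<forall>i<N. finite (st i) \<and> A aSize i = card (st i) \<and> A aStart (Suc i) = A aStart i + 2 ^ card (st i) \<and>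
      A aSub (A aStart (Suc i) - 1) = i) \<and>
    (\<forall>i<N. \<forall>p\<ge>A aStart i. p < A aStart (Suc i) \<longrightarrow> A aOwn p = i \<and> A aSub p < N \<and>
      (\<forall>X\<subseteq>st (A aSub p). \<exists>p'\<ge>A aStart i. p' \<le> p \<and> st (A aSub p') = X)) \<and>
    (\<forall>i<N. 0 < i \<longrightarrow> A aParent i < i \<and> A aElem i \<notin> st (A aParent i) \<and>
      st i = insert (A aElem i) (st (A aParent i)))"

lemma trie_cong: "(\<And>j. j \<in> {5..10} \<Longrightarrow> A' j = A j) \<Longrightarrow> trie st N q A' = trie st N q A"
  unfolding trie_def by simp

lemma trieD:
  assumes "trie st N q A"
  shows "0 < N" "st 0 = {}" "inj_on st {..<N}" "A aStart 0 = 0" "A aStart N = q"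
    and "i < N \<Longrightarrow> finite (st i)" "i < N \<Longrightarrow> A aSize i = card (st i)"
    and "i < N \<Longrightarrow> A aStart (Suc i) = A aStart i + 2 ^ card (st i)"
    and "i < N \<Longrightarrow> A aSub (A aStart (Suc i) - 1) = i"
    and "\<lbrakk>i < N; A aStart i \<le> p; p < A aStart (Suc i)\<rbrakk> \<Longrightarrow> A aOwn p = i"
    and "\<lbrakk>i < N; A aStart i \<le> p; p < A aStart (Suc i)\<rbrakk> \<Longrightarrow> A aSub p < N"
    and "\<lbrakk>i < N; A aStart i \<le> p; p < A aStart (Suc i); X \<subseteq> st (A aSub p)\<rbrakk> \<Longrightarrow>
      \<exists>p'\<ge>A aStart i. p' \<le> p \<and> st (A aSub p') = X"
    and "\<lbrakk>i < N; 0 < i\<rbrakk> \<Longrightarrow> A aParent i < i" "\<lbrakk>i < N; 0 < i\<rbrakk> \<Longrightarrow> A aElem i \<notin> st (A aParent i)"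
    and "\<lbrakk>i < N; 0 < i\<rbrakk> \<Longrightarrow> st i = insert (A aElem i) (st (A aParent i))"
  using assms unfolding trie_def by blast+

lemma trie_start_mono:
  assumes "trie st N q A" "i \<le> j" "j \<le> N"
  shows "A aStart i + (j - i) \<le> A aStart j"
  using assms(2,3)
proof (induction j rule: dec_induct)
  case (step j)
  then have "A aStart (Suc j) = A aStart j + 2 ^ card (st j)" using trieD(8)[OF assms(1)] by simp
  moreover have "(1::nat) \<le> 2 ^ card (st j)" by simp
  ultimately show ?case using step by linarith
qed simp

lemma trie_ids_le: "trie st N q A \<Longrightarrow> N \<le> q"
  using trie_start_mono[of st N q A 0 N] trieD(4,5)[of st N q A] by simp

lemma trie_block_le: "\<lbrakk>trie st N q A; i < N\<rbrakk> \<Longrightarrow> A aStart (Suc i) \<le> q"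
  using trie_start_mono[of st N q A "Suc i" N] trieD(5)[of st N q A] by simp

lemma trie_start_sum:
  assumes "trie st N q A" "j \<le> N"
  shows "A aStart j = (\<Sum>i<j. 2 ^ card (st i))"
  using assms(2)
proof (induction j)
  case 0
  then show ?case using trieD(4)[OF assms(1)] by simp
next
  case (Suc j)
  then show ?case using trieD(8)[OF assms(1), of j] by simp
qed

lemma trie_position:
  assumes "trie st N q A" "p < q"
  obtains i where "i < N" "A aStart i \<le> p" "p < A aStart (Suc i)"
proof -
  have "\<exists>i<j. A aStart i \<le> p \<and> p < A aStart (Suc i)" if "j \<le> N" "p < A aStart j" for j
    using that
  proof (induction j)
    case 0
    then show ?case using trieD(4)[OF assms(1)] by simp
  next
    case (Suc j)
    then show ?case by (cases "p < A aStart j") (auto intro: less_SucI)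
  qed
  then show ?thesis using assms(2) trieD(5)[OF assms(1)] that by blast
qed

text \<open>Subset closure applied to the last entry, which is \<open>i\<close> itself, gives
  surjectivity; the block has length \<open>2 ^ card (st i)\<close>, so injectivity follows by
  counting.\<close>

lemma trie_block:
  assumes "trie st N q A" "i < N"
  shows "bij_betw (\<lambda>p. st (A aSub p)) {A aStart i..<A aStart (Suc i)} (Pow (st i))"
proof -
  let ?B = "{A aStart i..<A aStart (Suc i)}"
  have step: "A aStart (Suc i) = A aStart i + 2 ^ card (st i)" by (rule trieD(8)[OF assms])
  have lt: "A aStart i < A aStart (Suc i)" using step by simp
  have "\<exists>p\<in>?B. st (A aSub p) = X" if "X \<subseteq> st i" for X
  proof -
    have "A aStart i \<le> A aStart (Suc i) - 1" "A aStart (Suc i) - 1 < A aStart (Suc i)"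
      using lt by linarith+
    from trieD(12)[OF assms this, of X] trieD(9)[OF assms] that
    obtain p' where "p' \<ge> A aStart i" "p' \<le> A aStart (Suc i) - 1" "st (A aSub p') = X" by auto
    then show ?thesis using lt by (intro bexI[of _ p']) auto
  qed
  then have "Pow (st i) \<subseteq> (\<lambda>p. st (A aSub p)) ` ?B" by auto
  moreover have "card ((\<lambda>p. st (A aSub p)) ` ?B) \<le> card (Pow (st i))"
    using card_image_le[of ?B "\<lambda>p. st (A aSub p)"] step trieD(6)[OF assms] by (simp add: card_Pow)
  ultimately have img: "(\<lambda>p. st (A aSub p)) ` ?B = Pow (st i)"
    by (metis card_seteq finite_atLeastLessThan finite_imageI)
  then have "inj_on (\<lambda>p. st (A aSub p)) ?B"
    using step trieD(6)[OF assms] by (intro eq_card_imp_inj_on) (auto simp: card_Pow)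
  then show ?thesis using img unfolding bij_betw_def by blast
qed

lemma trie_sub_subset:
  assumes "trie st N q A" "i < N" "A aStart i \<le> p" "p < A aStart (Suc i)"
  shows "st (A aSub p) \<subseteq> st i"
  using bij_betw_apply[OF trie_block[OF assms(1,2)], of p] assms(3,4) by simp

lemma trie_subset_id:
  assumes "trie st N q A" "i < N" "X \<subseteq> st i"
  obtains j where "j < N" "st j = X"
proof -
  from bij_betw_imp_surj_on[OF trie_block[OF assms(1,2)]] assms(3)
  have "X \<in> (\<lambda>p. st (A aSub p)) ` {A aStart i..<A aStart (Suc i)}" by simp
  then obtain p where "A aStart i \<le> p" "p < A aStart (Suc i)" "st (A aSub p) = X" by auto
  then show ?thesis using trieD(11)[OF assms(1,2)] that by blast
qed

text \<open>Entry \<open>i\<close> of the old block goes to offset \<open>2 * i\<close> and its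
  child by \<open>u\<close> to offset \<open>2 * i + 1\<close>. Interleaving keeps subsets in front:
  a subset without \<open>u\<close> is an old entry, a subset X with \<open>u\<close> is the child
  of X - {u}, and the old order places both no later than the set containing them.\<close>

lemma trie_extend:
  assumes tr: "trie st N q A" and s: "s < N" "u \<notin> st s" and new: "insert u (st s) \<notin> st ` {..<N}"
    and len: "len = 2 ^ card (st s)" and st': "st' = st(N := insert u (st s))"
    and start: "\<And>i. i \<le> N \<Longrightarrow> A' aStart i = A aStart i" "A' aStart (Suc N) = q + 2 * len"
    and old: "\<And>i. i < N \<Longrightarrow> A' aSize i = A aSize i" "\<And>i. i < N \<Longrightarrow> A' aParent i = A aParent i"
      "\<And>i. i < N \<Longrightarrow> A' aElem i = A aElem i"
    and N: "A' aSize N = A aSize s + 1" "A' aParent N = s" "A' aElem N = u"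
    and old_p: "\<And>p. p < q \<Longrightarrow> A' aSub p = A aSub p" "\<And>p. p < q \<Longrightarrow> A' aOwn p = A aOwn p"
    and own: "\<And>p. \<lbrakk>q \<le> p; p < q + 2 * len\<rbrakk> \<Longrightarrow> A' aOwn p = N"
    and sub: "\<And>i. i < len \<Longrightarrow> A' aSub (q + 2 * i) = A aSub (A aStart s + i)"
      "\<And>i. i < len \<Longrightarrow> A' aSub (q + 2 * i + 1) = ch (A aSub (A aStart s + i))"
    and ch: "\<And>i. i < len \<Longrightarrow> ch (A aSub (A aStart s + i)) \<le> N"
      "\<And>i. i < len \<Longrightarrow> st' (ch (A aSub (A aStart s + i))) = insert u (st (A aSub (A aStart s + i)))"
      "ch s = N"
  shows "trie st' (Suc N) (q + 2 * len) A'"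
proof -
  note D = trieD[OF tr]
  have st'i: "st' i = st i" if "i < N" for i using that st' by simp
  have blk: "A aStart (Suc s) = A aStart s + len" using D(8)[OF s(1)] len by simp
  have len0: "0 < len" using len by simp
  have last: "A aSub (A aStart s + (len - 1)) = s"
    using D(9)[OF s(1)] blk len0 by simp
  have startN: "A aStart i \<le> q" "A aStart (Suc i) \<le> q" "A' aStart i = A aStart i"
    "A' aStart (Suc i) = A aStart (Suc i)" if "i < N" for i
    using trie_start_mono[OF tr, of i N] trie_block_le[OF tr that] that start(1) D(5) by auto
  have subN: "A aSub (A aStart s + i) < N" if "i < len" for i
    using D(11)[OF s(1)] blk that by simp
  have sts: "finite (st s)" "st' N = insert u (st s)" using D(6) s st' by auto
  have A: "finite (st' i) \<and> A' aSize i = card (st' i) \<and> A' aStart (Suc i) = A' aStart i + 2 ^ card (st' i) \<and>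
      A' aSub (A' aStart (Suc i) - 1) = i" if "i < Suc N" for i
  proof (cases "i = N")
    case True
    \<comment> \<open>The last old entry is \<open>s\<close>, so the last new entry is its child
      \<open>N\<close>.\<close>
    have "q + 2 * len - 1 = q + 2 * (len - 1) + 1" using len0 by simp
    then have "A' aSub (q + 2 * len - 1) = N" using sub(2)[of "len - 1"] len0 last ch(3) by simp
    then show ?thesis using True sts s N D(5) D(7)[OF s(1)] start len by simp
  next
    case False
    then have i: "i < N" using that by simp
    have "A aStart (Suc i) - 1 < q" using startN[OF i] D(8)[OF i] one_le_power[of "2::nat" "card (st i)"] by linarith
    then show ?thesis using i startN[OF i] D(6-9)[OF i] st'i[OF i] old old_p by simp
  qed
  have B: "A' aOwn p = i \<and> A' aSub p < Suc N \<and>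
      (\<forall>X\<subseteq>st' (A' aSub p). \<exists>p'\<ge>A' aStart i. p' \<le> p \<and> st' (A' aSub p') = X)"
    if "i < Suc N" "A' aStart i \<le> p" "p < A' aStart (Suc i)" for i p
  proof (cases "i = N")
    case False
    then have i: "i < N" using that by simp
    have p: "A aStart i \<le> p" "p < A aStart (Suc i)" using that startN[OF i] by auto
    have pq: "p < q" using p(2) startN[OF i] by simp
    have "\<exists>p'\<ge>A' aStart i. p' \<le> p \<and> st' (A' aSub p') = X" if "X \<subseteq> st' (A' aSub p)" for X
    proof -
      have "X \<subseteq> st (A aSub p)" using that st'i[OF D(11)[OF i p]] old_p(1)[OF pq] by simp
      from D(12)[OF i p this] obtain p' where p': "p' \<ge> A aStart i" "p' \<le> p" "st (A aSub p') = X" by auto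
      have "A aSub p' < N" using D(11)[OF i p'(1)] p'(2) p(2) by simp
      then show ?thesis using p' pq st'i old_p(1) startN[OF i] by (intro exI[of _ p']) auto
    qed
    then show ?thesis using D(10,11)[OF i p] old_p pq by simp
  next
    case True
    then have p: "q \<le> p" "p < q + 2 * len" using that start D(5) by auto
    define j where "j = (p - q) div 2"
    have j: "j < len" and pj: "p = q + 2 * j \<or> p = q + 2 * j + 1"
      using p unfolding j_def by presburger+
    have stj: "st' (A' aSub (q + 2 * j)) = st (A aSub (A aStart s + j))" 
      "st' (A' aSub (q + 2 * j + 1)) = insert u (st (A aSub (A aStart s + j)))" if "j < len" for j
      using sub[OF that] st'i[OF subN[OF that]] ch(2)[OF that] by simp_all
    have ex: "\<exists>i\<le>j. st (A aSub (A aStart s + i)) = X" if X: "X \<subseteq> st (A aSub (A aStart s + j))" for X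
    proof -
      from D(12)[OF s(1) _ _ X] blk j obtain p' where
        "p' \<ge> A aStart s" "p' \<le> A aStart s + j" "st (A aSub p') = X" by auto
      then show ?thesis by (intro exI[of _ "p' - A aStart s"]) auto
    qed
    have "\<exists>p'\<ge>q. p' \<le> p \<and> st' (A' aSub p') = X" if X: "X \<subseteq> st' (A' aSub p)" for X
    proof (cases "u \<in> X")
      case False
      then have "X \<subseteq> st (A aSub (A aStart s + j))" using X pj stj[OF j] by auto
      from ex[OF this] obtain i where "i \<le> j" "st (A aSub (A aStart s + i)) = X" by auto
      then show ?thesis using stj(1)[of i] j pj by (intro exI[of _ "q + 2 * i"]) auto
    next
      case True
      have "st (A aSub (A aStart s + j)) \<subseteq> st s"
        using trie_sub_subset[OF tr s(1)] j blk by simp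
      \<comment> \<open>An even offset holds a subset of \<open>st s\<close>, which lacks
        \<open>u\<close>; hence the offset of \<open>p\<close> is odd.\<close>
      then have "p = q + 2 * j + 1" "X - {u} \<subseteq> st (A aSub (A aStart s + j))"
        using X pj stj[OF j] True s(2) by auto
      with ex obtain i where "i \<le> j" "st (A aSub (A aStart s + i)) = X - {u}" by blast
      then show ?thesis using stj(2)[of i] j \<open>p = _\<close> True
        by (intro exI[of _ "q + 2 * i + 1"]) auto
    qed
    moreover have "A' aSub p < Suc N" using pj sub[OF j] subN[OF j] ch(1)[OF j] by auto
    ultimately show ?thesis using True own[OF p] start(1) D(5) by auto
  qed
  have C: "A' aParent i < i \<and> A' aElem i \<notin> st' (A' aParent i) \<and>
      st' i = insert (A' aElem i) (st' (A' aParent i))" if "i < Suc N" "0 < i" for i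
  proof (cases "i = N")
    case True
    then show ?thesis using N s sts st'i by auto
  next
    case False
    then have i: "i < N" using that by simp
    have "A aParent i < N" using D(13)[OF i that(2)] i by simp
    then show ?thesis using D(13-15)[OF i that(2)] old(2,3)[OF i] st'i i by simp
  qed
  have "inj_on st' {..<Suc N}"
    using D(3) new sts(2) st' unfolding lessThan_Suc by (auto simp: inj_on_def)
  moreover have "st' 0 = {}" "A' aStart 0 = 0" using D(1,2,4) st'i start(1) by auto
  ultimately show ?thesis unfolding trie_def using A B C start(2) by blast
qed

lemma trie_size_bound:
  assumes "inj_on st {..<N}" "\<And>E. E < n \<Longrightarrow> finite (ES E) \<and> card (ES E) = d"
    and "\<And>i. i < N \<Longrightarrow> \<exists>E<n. st i \<subseteq> ES E"
  shows "(\<Sum>i<N. 2 ^ card (st i)) \<le> 3 ^ d * (n :: nat)"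
proof -
  have "(\<Sum>i<N. 2 ^ card (st i)) = (\<Sum>X\<in>st ` {..<N}. 2 ^ card X :: nat)"
    by (simp add: sum.reindex[OF assms(1)])
  also have "\<dots> \<le> card {..<n} * 3 ^ d"
    using assms(2,3) by (intro sum_subsets_le[of _ ES]) (auto, blast)
  finally show ?thesis by (simp add: mult.commute)
qed

section \<open>Good sets in rounds\<close>

lemma nu_pos: "0 < nu k r"
  by (simp add: nu_def)

lemma lr_good_d: "lr_good d k U F d r S \<longleftrightarrow> S \<in> F"
  by (subst lr_good.simps) simp

lemma lr_good_less: "l < d \<Longrightarrow> lr_good d k U F l r S \<longleftrightarrow> 1 \<le> l \<and> 1 \<le> r \<and> r \<le> d - l \<and> S \<subseteq> U \<and>
    card S = l \<and> nu k r \<le> card {T. T \<subseteq> U \<and> S \<subseteq> T \<and> lr_strong d k U F (l + r) r T}"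
  by (subst lr_good.simps) auto

lemma lr_good_le: "lr_good d k U F l r S \<Longrightarrow> l \<le> d \<and> (0 < d \<longrightarrow> 0 < l)"
  by (subst (asm) lr_good.simps) (auto split: if_splits)

lemma lr_good_card:
  assumes "hitting_set_instance d U F" "lr_good d k U F l r S"
  shows "S \<subseteq> U" "card S = l"
  using assms by (subst (asm) lr_good.simps, auto simp: hitting_set_instance_def split: if_splits)+

text \<open>Because \<open>nu\<close> is positive, a good set of size \<open>l < d\<close> lies in a
  strong, hence good, set of size \<open>l + r > l\<close>; iterating ends in \<open>F\<close>. So
  only subsets of input sets can be good, and these are the nodes of the trie.\<close>

lemma lr_good_closed: "lr_good d k U F l r S \<Longrightarrow> \<exists>E\<in>F. S \<subseteq> E"
proof (induction "d - l" arbitrary: l r S rule: less_induct)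
  case less
  show ?case
  proof (cases "l = d")
    case True
    then show ?thesis using less.prems by (auto simp: lr_good_d)
  next
    case False
    then have "l < d" using lr_good_le[OF less.prems] by simp
    note g = less.prems[unfolded lr_good_less[OF this]]
    have "{T. T \<subseteq> U \<and> S \<subseteq> T \<and> lr_strong d k U F (l + r) r T} \<noteq> {}"
      using g nu_pos[of k r] by (metis (no_types, lifting) card.empty not_less)
    then obtain T where T: "S \<subseteq> T" "lr_strong d k U F (l + r) r T" by auto
    then obtain r' where "lr_good d k U F (l + r) r' T"
      by (subst (asm) lr_strong.simps) (auto simp: l_good.simps)
    moreover have "d - (l + r) < d - l" using g \<open>l < d\<close> by linarith
    ultimately obtain E where "E \<in> F" "T \<subseteq> E" using less.hyps by blast
    then show ?thesis using T(1) by blast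
  qed
qed

definition good_from :: "nat \<Rightarrow> nat \<Rightarrow> 'a set \<Rightarrow> 'a set set \<Rightarrow> nat \<Rightarrow> 'a set set" where
  "good_from d k U F l = {S. \<exists>l'\<ge>l. \<exists>r. lr_good d k U F l' r S}"

text \<open>These sets are excluded from being strong in later rounds by a witness of size at least
  \<open>l\<close>. The bound \<open>l' < d\<close> is essential: a set of \<open>F\<close>
  satisfies \<open>lr_good\<close> at size \<open>d\<close> for every \<open>r\<close>, also for 0,
  and would otherwise be a witness against itself.\<close>

definition dead_from :: "nat \<Rightarrow> nat \<Rightarrow> 'a set \<Rightarrow> 'a set set \<Rightarrow> nat \<Rightarrow> 'a set set" where
  "dead_from d k U F l =
    {T. \<exists>l'\<ge>l. \<exists>r. l' < d \<and> l' + r = card T \<and> (\<exists>S\<subseteq>T. lr_good d k U F l' r S)}"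

text \<open>The state reached after round \<open>(l, r)\<close>: all \<open>(l', r')\<close> with \<open>l' > l\<close>, or \<open>l' = l\<close> and \<open>r' \<le> r\<close>.\<close>

definition good_upto :: "nat \<Rightarrow> nat \<Rightarrow> 'a set \<Rightarrow> 'a set set \<Rightarrow> nat \<Rightarrow> nat \<Rightarrow> 'a set set" where
  "good_upto d k U F l r = good_from d k U F (Suc l) \<union> {S. \<exists>r'\<le>r. lr_good d k U F l r' S}"

definition dead_upto :: "nat \<Rightarrow> nat \<Rightarrow> 'a set \<Rightarrow> 'a set set \<Rightarrow> nat \<Rightarrow> nat \<Rightarrow> 'a set set" where
  "dead_upto d k U F l r = dead_from d k U F (Suc l) \<union>
    {T. \<exists>r'\<le>r. l + r' = card T \<and> (\<exists>S\<subseteq>T. lr_good d k U F l r' S)}"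

lemma good_from_d: "good_from d k U F d = F"
proof -
  have "l' = d" if "l' \<ge> d" "lr_good d k U F l' r S" for l' r S
    using lr_good_le[OF that(2)] that(1) by simp
  then have "(\<exists>l'\<ge>d. \<exists>r. lr_good d k U F l' r S) \<longleftrightarrow> (\<exists>r. lr_good d k U F d r S)" for S
    by (metis order_refl)
  then show ?thesis unfolding good_from_def lr_good_d by simp
qed

lemma dead_from_d: "dead_from d k U F d = {}"
  unfolding dead_from_def by auto

lemma good_upto_0: "l < d \<Longrightarrow> good_upto d k U F l 0 = good_from d k U F (Suc l)"
  unfolding good_upto_def by (auto simp: lr_good_less)

lemma dead_upto_0: "l < d \<Longrightarrow> dead_upto d k U F l 0 = dead_from d k U F (Suc l)"
  unfolding dead_upto_def by (auto simp: lr_good_less)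

lemma ex_ge_Suc: "(\<exists>l'\<ge>l. P l') \<longleftrightarrow> P l \<or> (\<exists>l'\<ge>Suc l. P l')"
  by (metis Suc_leD Suc_leI le_neq_implies_less order_refl)

lemma good_upto_last:
  assumes "l < d"
  shows "good_upto d k U F l (d - l) = good_from d k U F l"
proof -
  have "(\<exists>r\<le>d - l. lr_good d k U F l r S) \<longleftrightarrow> (\<exists>r. lr_good d k U F l r S)" for S
    using assms by (auto simp: lr_good_less)
  then show ?thesis
    unfolding good_upto_def good_from_def ex_ge_Suc[of l] by blast
qed

lemma dead_upto_last:
  assumes "l < d"
  shows "dead_upto d k U F l (d - l) = dead_from d k U F l"
proof -
  have "(\<exists>r\<le>d - l. l + r = card T \<and> (\<exists>S\<subseteq>T. lr_good d k U F l r S)) \<longleftrightarrow>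
      (\<exists>r. l < d \<and> l + r = card T \<and> (\<exists>S\<subseteq>T. lr_good d k U F l r S))" for T
    using assms by (auto simp: lr_good_less)
  then show ?thesis
    unfolding dead_upto_def dead_from_def ex_ge_Suc[of l] Collect_disj_eq by (simp only: Un_commute)
qed

lemma ex_le_Suc: "(\<exists>r'\<le>Suc r. P r') \<longleftrightarrow> (\<exists>r'\<le>r. P r') \<or> P (Suc r)"
  by (auto simp: le_Suc_eq)

lemma good_upto_Suc: "good_upto d k U F l (Suc r) = good_upto d k U F l r \<union> {S. lr_good d k U F l (Suc r) S}"
  unfolding good_upto_def ex_le_Suc Collect_disj_eq by (simp only: Un_assoc)

lemma dead_upto_Suc: "dead_upto d k U F l (Suc r) = dead_upto d k U F l r \<union>
    {T. l + Suc r = card T \<and> (\<exists>S\<subseteq>T. lr_good d k U F l (Suc r) S)}"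
  unfolding dead_upto_def ex_le_Suc Collect_disj_eq by (simp only: Un_assoc)

text \<open>A witness against strength in round \<open>(l, Suc r)\<close> has the form
  \<open>(l + Suc r - j, j)\<close> with \<open>1 <= j <= r\<close>, so its size exceeds
  \<open>l\<close> and it was found at an earlier level. Conversely, a recorded witness of size
  \<open>l\<close> itself would need \<open>j = Suc r\<close>, which the first \<open>r\<close>
  rounds have not reached.\<close>

lemma lr_strong_iff:
  assumes inst: "hitting_set_instance d U F" and l: "l + Suc r \<le> d"
  shows "lr_strong d k U F (l + Suc r) (Suc r) T \<longleftrightarrow>
    card T = l + Suc r \<and> T \<in> good_upto d k U F l r \<and> T \<notin> dead_upto d k U F l r"
proof -
  have "l_good d k U F (l + Suc r) T \<longleftrightarrow> card T = l + Suc r \<and> T \<in> good_upto d k U F l r"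
    unfolding l_good.simps good_upto_def good_from_def
    using lr_good_card(2)[OF inst] by (auto simp: Suc_le_eq)
  moreover have "(\<exists>j\<in>{1..<Suc r}. \<exists>S\<subseteq>T. lr_good d k U F (l + Suc r - j) j S) \<longleftrightarrow> T \<in> dead_upto d k U F l r"
    if T: "card T = l + Suc r"
  proof
    assume "\<exists>j\<in>{1..<Suc r}. \<exists>S\<subseteq>T. lr_good d k U F (l + Suc r - j) j S"
    then obtain j S where j: "1 \<le> j" "j \<le> r" "S \<subseteq> T" "lr_good d k U F (l + Suc r - j) j S" by auto
    have "l + Suc r - j \<ge> Suc l" "l + Suc r - j < d" "l + Suc r - j + j = card T" using j l T by auto
    then show "T \<in> dead_upto d k U F l r" using j(3,4) unfolding dead_upto_def dead_from_def by blast
  next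
    assume "T \<in> dead_upto d k U F l r"
    then obtain l' j S where l': "l' > l \<or> l' = l \<and> j \<le> r" "l' < d" "l' + j = card T" "S \<subseteq> T"
      "lr_good d k U F l' j S"
    proof (unfold dead_upto_def dead_from_def, elim UnE CollectE exE conjE)
      fix r' S assume "r' \<le> r" "l + r' = card T" "S \<subseteq> T" "lr_good d k U F l r' S"
      then show thesis using that[of l r' S] l by simp
    next
      fix l' j S assume "Suc l \<le> l'" "l' < d" "l' + j = card T" "S \<subseteq> T" "lr_good d k U F l' j S"
      then show thesis using that[of l' j S] by simp
    qed
    have "1 \<le> j" using l'(5) l'(2) by (simp add: lr_good_less)
    moreover have "j < Suc r" "l' = l + Suc r - j" using l'(1,3) T by auto
    ultimately show "\<exists>j\<in>{1..<Suc r}. \<exists>S\<subseteq>T. lr_good d k U F (l + Suc r - j) j S"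
      using l'(4,5) by (intro bexI[of _ j] exI[of _ S]) auto
  qed
  ultimately show ?thesis by (subst lr_strong.simps) blast
qed

lemma lr_good_Suc_iff:
  assumes inst: "hitting_set_instance d U F" and l: "1 \<le> l" "l + Suc r \<le> d"
  shows "lr_good d k U F l (Suc r) S \<longleftrightarrow> S \<subseteq> U \<and> card S = l \<and> nu k (Suc r) \<le> card {T. T \<subseteq> U \<and> S \<subseteq> T \<and>
    card T = l + Suc r \<and> T \<in> good_upto d k U F l r \<and> T \<notin> dead_upto d k U F l r}"
proof -
  have "l < d" "Suc r \<le> d - l" using l by auto
  with l(1) show ?thesis unfolding lr_good_less[OF \<open>l < d\<close>] lr_strong_iff[OF inst l(2)] by simp
qed

text \<open>For \<open>d > 0\<close> no set of size 0 is good, so level 1 already includes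
  everything. The lemma is applied with \<open>l = d - (d - 1)\<close>, the level at which the main
  loop stops: 1 for \<open>d > 0\<close> and 0 for \<open>d = 0\<close>.\<close>

lemma good_iff:
  assumes inst: "hitting_set_instance d U F" and l: "l \<le> 1" "l \<le> d"
  shows "good d k U F S \<longleftrightarrow> S \<in> good_from d k U F l"
proof
  assume "S \<in> good_from d k U F l"
  then show "good d k U F S"
    using lr_good_card(2)[OF inst] unfolding good_from_def good_def l_good.simps by blast
next
  assume "good d k U F S"
  then obtain r where "lr_good d k U F (card S) r S" unfolding good_def l_good.simps by blast
  moreover from lr_good_le[OF this] have "l \<le> card S" using l by (cases d) auto
  ultimately show "S \<in> good_from d k U F l" unfolding good_from_def by blast
qed

section \<open>Building the trie\<close>

locale kernel_input =
  fixes d k n m L W :: nat and word :: "nat \<Rightarrow> nat"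
  assumes n_pos: "0 < n"
    and word_less: "p < d * n \<Longrightarrow> word p < m"
    and word_inj: "\<lbrakk>p < d * n; p' < d * n; p div d = p' div d; word p = word p'\<rbrakk> \<Longrightarrow> p = p'"
    and L_eq: "L = 4 * (3 ^ d * n) + m + 8"
    and L_W: "32 * L \<le> W"
begin

definition base :: "(nat \<Rightarrow> nat) \<Rightarrow> bool" where
  "base R \<longleftrightarrow> R vD = d \<and> R vK = k \<and> R vN = n \<and> R vM = m \<and> R vL = L"

definition ES :: "nat \<Rightarrow> nat set" where
  "ES E = word ` {p. p < d * n \<and> p div d = E}"

lemma pow3_ge: "d < 3 ^ d" "n \<le> 3 ^ d * n" "d * n \<le> 3 ^ d * n" "(d + 1) * (d + 1) \<le> 4 * (3 ^ d * n)"
    "2 ^ d * n \<le> 3 ^ d * n"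
proof -
  show *: "d < 3 ^ d" by (induction d) auto
  show "n \<le> 3 ^ d * n" "d * n \<le> 3 ^ d * n" using * by simp_all
  have "4 * (3 ^ d * 1) \<le> 4 * (3 ^ d * n)" using n_pos by (intro mult_le_mono2) simp
  then show "(d + 1) * (d + 1) \<le> 4 * (3 ^ d * n)" using Suc_square_le_pow3[of d] by linarith
  show "2 ^ d * n \<le> 3 ^ d * n" by (intro mult_le_mono1 power_mono) auto
qed

lemma bounds: "d < L" "n < L" "d * n + 4 < L" "m < L" "(d + 1) * (d + 1) \<le> L" "3 ^ d * n + 4 < L"
  "L < W" "2 * L + 32 < W" "8 \<le> L"
proof -
  have "n * 1 \<le> n * 3 ^ d" by (intro mult_le_mono2) simp
  then have "d < 3 ^ d * n" using pow3_ge(1) n_pos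
    by (metis less_le_trans mult.commute mult.right_neutral mult_le_mono2 Suc_leI One_nat_def)
  then show "d < L" "n < L" "d * n + 4 < L" "m < L" "(d + 1) * (d + 1) \<le> L" "3 ^ d * n + 4 < L"
    "L < W" "2 * L + 32 < W" "8 \<le> L"
    using pow3_ge L_eq L_W by linarith+
qed

lemma wp_bucket_elements:
  assumes "base R" "\<And>p. p < d * n \<Longrightarrow> A aIn (p + 4) = word p" "A aHead = (\<lambda>_. 0)"
  shows "wp L W bucket_elements (\<lambda>(R', A', t'). base R' \<and> unchanged {aHead, aNext} A A' \<and>
      (\<forall>u. chain (A' aNext) (A' aHead u) (rev (filter (\<lambda>p. word p = u) [0..<d * n]))) \<and>
      t' \<le> t + 20 + 50 * (d * n)) (R, A, t)"
proof -
  let ?I = "\<lambda>i (R', A', t'). base R' \<and> R' vE = d * n \<and> R' vP = i \<and>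
    unchanged {aHead, aNext} A A' \<and>
    (\<forall>u. chain (A' aNext) (A' aHead u) (rev (filter (\<lambda>p. word p = u) [0..<i]))) \<and>
    t' \<le> t + 10 + 50 * i"
  have dn: "d * n < W" using bounds by linarith
  have step: "R' vP = i \<and> R' vE = d * n \<and>
      wp L W (vU ::= Ld aIn (Plus (Var vP) (Lit 4)) ;;
        Write aNext (Var vP) (Ld aHead (Var vU)) ;;
        Write aHead (Var vU) (Plus (Var vP) (Lit 1)))
      (\<lambda>(R', A', t'). R' vP = i \<and> ?I (Suc i) (R'(vP := Suc i), A', t' + 5)) (R', A', t' + 3)"
    if I: "?I i (R', A', t')" and i: "i < d * n" for i R' A' t'
  proof -
    have "A' aIn (i + 4) = word i" using I i assms(2) by simp
    moreover have "word i < L" "i + 4 < L" "i + 4 < W" using word_less[OF i] i bounds by linarith+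
    moreover have "\<forall>u. chain ((A' aNext)(i := A' aHead (word i))) (((A' aHead)(word i := Suc i)) u)
        (rev (filter (\<lambda>p. word p = u) [0..<Suc i]))"
      using chain_insert[where f = word and head = "A' aHead" and nx = "A' aNext"] I by blast
    ultimately show ?thesis
      using I by (simp add: base_def del: upt_Suc)
  qed
  show ?thesis
    unfolding bucket_elements_def wp_Seq wp_Assign
    apply (intro conjI)
    subgoal using assms(1) dn by (simp add: base_def)
    subgoal by simp
    subgoal
      apply (rule wp_for_loop[where I = ?I and lo = 0 and n = "d * n"])
      subgoal using assms by (simp add: base_def)
      subgoal by simp
      subgoal by (rule dn)
      subgoal by (rule step)
      subgoal by simp
      done
    done
qed


text \<open>Valid while \<open>u\<close> is being processed. The last clause reads stamps in both
  directions: a current stamp gives the identifier of the child, and a missing one certifies that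
  the child does not exist, without which a set could receive two identifiers.\<close>

definition trie_state :: "(nat \<Rightarrow> nat set) \<Rightarrow> nat \<Rightarrow> nat \<Rightarrow> (nat \<Rightarrow> nat \<Rightarrow> nat) \<Rightarrow> nat \<Rightarrow> bool" where
  "trie_state st N q A u \<longleftrightarrow> trie st N q A \<and> (\<forall>i<N. \<exists>E<n. st i \<subseteq> ES E) \<and> (\<forall>i<N. st i \<subseteq> {..u}) \<and>
    (\<forall>y. A aStamp y \<le> Suc u) \<and>
    (\<forall>y<N. u \<notin> st y \<longrightarrow> (if A aStamp y = Suc u then A aChild y < N \<and> st (A aChild y) = insert u (st y)
      else insert u (st y) \<notin> st ` {..<N}))"

lemma ES_card:
  assumes "E < n"
  shows "finite (ES E)" "card (ES E) = d"
proof -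
  have "{p. p < d * n \<and> p div d = E} = {E * d..<E * d + d}"
  proof (cases "d = 0")
    case False
    have 1: "p div d = E \<longleftrightarrow> E * d \<le> p \<and> p < E * d + d" for p
      using False by (metis add.commute div_nat_eqI less_eq_div_iff_mult_less_eq mult.commute
          mult_Suc not_gr_zero times_div_less_eq_dividend dividend_less_times_div)
    have 2: "E * d + d \<le> d * n" using assms mult_le_mono2[of "Suc E" n d] by (simp add: ac_simps)
    show ?thesis unfolding 1 using 2 by (auto simp del: mult_Suc)
  qed auto
  moreover have "inj_on word {p. p < d * n \<and> p div d = E}"
    by (rule inj_onI) (use word_inj in auto)
  ultimately show "finite (ES E)" "card (ES E) = d"
    unfolding ES_def by (auto simp: card_image)
qed

lemma trie_bound:
  assumes "trie st N q A" "\<And>i. i < N \<Longrightarrow> \<exists>E<n. st i \<subseteq> ES E"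
  shows "q \<le> 3 ^ d * n"
  using trie_size_bound[of st N n ES d] trieD(3)[OF assms(1)] ES_card assms
    trie_start_sum[OF assms(1) order_refl] trieD(5)[OF assms(1)] by simp

text \<open>The source block ends at or before \<open>q\<close> and the copy is written from
  \<open>q\<close> on, so all reads see old entries.\<close>

lemma wp_copy_block:
  assumes "base R" "R vJ = lo" "R vF = lo + len" "R vQ = q" "R vIds = N" "lo + len \<le> q"
    and "q + 2 * len \<le> 3 ^ d * n" "N \<le> q" "\<And>i. i < len \<Longrightarrow> A aSub (lo + i) < L"
  shows "wp L W (for_loop vJ vF (
      Write aSub (Var vQ) (Ld aSub (Var vJ)) ;;
      Write aOwn (Var vQ) (Var vIds) ;;
      Write aSub (Plus (Var vQ) (Lit 1)) (Ld aChild (Ld aSub (Var vJ))) ;;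
      Write aOwn (Plus (Var vQ) (Lit 1)) (Var vIds) ;;
      vQ ::= Plus (Var vQ) (Lit 2)))
    (\<lambda>(R', A', t'). unchanged {vJ, vQ} R R' \<and> R' vQ = q + 2 * len \<and>
      unchanged {aSub, aOwn} A A' \<and>
      (\<forall>p<q. A' aSub p = A aSub p \<and> A' aOwn p = A aOwn p) \<and>
      (\<forall>i<len. A' aSub (q + 2 * i) = A aSub (lo + i) \<and>
        A' aSub (q + 2 * i + 1) = A aChild (A aSub (lo + i))) \<and>
      (\<forall>p. q \<le> p \<and> p < q + 2 * len \<longrightarrow> A' aOwn p = N) \<and> t' \<le> t + 10 + 70 * len) (R, A, t)"
    (is "wp L W (for_loop vJ vF ?body) ?Q (R, A, t)")
proof -
  let ?I = "\<lambda>i (R', A', t'). lo \<le> i \<and> unchanged {vJ, vQ} R R' \<and> R' vJ = i \<and>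
      R' vQ = q + 2 * (i - lo) \<and> unchanged {aSub, aOwn} A A' \<and>
      (\<forall>p<q. A' aSub p = A aSub p \<and> A' aOwn p = A aOwn p) \<and>
      (\<forall>i'<i - lo. A' aSub (q + 2 * i') = A aSub (lo + i') \<and>
        A' aSub (q + 2 * i' + 1) = A aChild (A aSub (lo + i'))) \<and>
      (\<forall>p. q \<le> p \<and> p < q + 2 * (i - lo) \<longrightarrow> A' aOwn p = N) \<and> t' \<le> t + 70 * (i - lo)"
  have step: "R' vJ = i \<and> R' vF = lo + len \<and>
      wp L W ?body (\<lambda>(R', A', t'). R' vJ = i \<and> ?I (Suc i) (R'(vJ := Suc i), A', t' + 5)) (R', A', t' + 3)"
    if I: "?I i (R', A', t')" and i: "i < lo + len" for i R' A' t'
  proof -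
    define e where "e = i - lo"
    have e: "i = lo + e" "e < len" using I i by (auto simp: e_def)
    have R': "R' vJ = lo + e" "R' vF = lo + len" "R' vQ = q + 2 * e" "R' vIds = N"
      using I e assms(3,5) by auto
    have lt: "lo + e < q" "q + 2 * e + 1 < L" "lo + e < L" "q + 2 * e + 2 < W"
      using e(2) assms(6,7) bounds by linarith+
    have sub: "A' aSub (lo + e) = A aSub (lo + e)" "A aSub (lo + e) < L" "A' aChild = A aChild"
      using I lt assms(9) e by auto
    have S: "i - lo = e" "Suc i - lo = Suc e" using e by auto
    have c: "x \<noteq> q + 2 * e" "x \<noteq> Suc (q + 2 * e)" if "x < q + 2 * e" for x
      using that by auto
    show ?thesis
      using I lt sub unfolding S e(1)
      by (auto simp: R' less_Suc_eq c)
  qed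
  have W: "lo + len < W" using assms(6,7) bounds by linarith
  show ?thesis
    apply (rule wp_for_loop[where I = ?I and lo = lo and n = "lo + len"])
    subgoal using assms by simp
    subgoal by simp
    subgoal by (rule W)
    subgoal by (rule step)
    subgoal using assms by simp
    done
qed

text \<open>Space is secured before the child is built: the enlarged family is still injective and
  consists of subsets of input sets, so the counting bound covers its last block in advance, and the
  copy stays inside the arrays.\<close>

lemma trie_state_extend:
  assumes ts: "trie_state st N q A u" and s: "s < N" "u \<notin> st s" "A aStamp s \<noteq> Suc u"
    and E: "E < n" "insert u (st s) \<subseteq> ES E"
  shows "insert u (st s) \<notin> st ` {..<N}" "q + 2 * 2 ^ card (st s) \<le> 3 ^ d * n"
proof -
  have tr: "trie st N q A" using ts by (simp add: trie_state_def)
  note D = trieD[OF tr]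
  show new: "insert u (st s) \<notin> st ` {..<N}" using ts s unfolding trie_state_def by meson
  let ?st = "st(N := insert u (st s))"
  have inj: "inj_on ?st {..<Suc N}"
    using D(3) new unfolding lessThan_Suc by (auto simp: inj_on_def)
  have "\<exists>E<n. ?st i \<subseteq> ES E" if "i < Suc N" for i
    using that E ts unfolding trie_state_def by (auto simp: less_Suc_eq)
  then have "(\<Sum>i<Suc N. 2 ^ card (?st i)) \<le> 3 ^ d * n"
    by (intro trie_size_bound[OF inj, of n ES d]) (use ES_card in blast)+
  moreover have "(\<Sum>i<N. 2 ^ card (?st i)) = (\<Sum>i<N. 2 ^ card (st i) :: nat)"
    by (intro sum.cong) auto
  ultimately show "q + 2 * 2 ^ card (st s) \<le> 3 ^ d * n"
    using trie_start_sum[OF tr order_refl] D(5) D(6)[OF s(1)] s(2) by simp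
qed

lemma wp_new_child:
  assumes "base R" and ts: "trie_state st N q A u" and R: "R vIds = N" "R vQ = q" "R vU = u" "R vS = s"
    and s: "s < N" "u \<notin> st s" "A aStamp s \<noteq> Suc u" and u: "u < m"
    and E: "E < n" "insert u (st s) \<subseteq> ES E"
    and ready: "\<And>y. \<lbrakk>y < N; st y \<subset> st s\<rbrakk> \<Longrightarrow> A aStamp y = Suc u"
  shows "wp L W new_child (\<lambda>(R', A', t').
    trie_state (st(N := insert u (st s))) (Suc N) (q + 2 * 2 ^ card (st s)) A' u \<and>
    unchanged {vJ, vF, vQ, vIds} R R' \<and> R' vIds = Suc N \<and> R' vQ = q + 2 * 2 ^ card (st s) \<and>
    unchanged {5..12} A A' \<and> A' aStamp = (A aStamp)(s := Suc u) \<and>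
    (\<forall>i\<le>N. A' aStart i = A aStart i) \<and> (\<forall>p<q. A' aSub p = A aSub p) \<and>
    t' \<le> t + 120 + 70 * 2 ^ card (st s)) (R, A, t)"
proof -
  have tr: "trie st N q A" using ts by (simp add: trie_state_def)
  note D = trieD[OF tr]
  note new = trie_state_extend(1)[OF ts s E] and qb = trie_state_extend(2)[OF ts s E]
  define len where "len = (2::nat) ^ card (st s)"
  define lo where "lo = A aStart s"
  have blk: "A aStart (Suc s) = lo + len" using D(8)[OF s(1)] by (simp add: len_def lo_def)
  have loq: "lo + len \<le> q" using trie_block_le[OF tr s(1)] blk by simp
  have Nq: "N \<le> q" using trie_ids_le[OF tr] .
  have len0: "0 < len" by (simp add: len_def)
  have qb: "q + 2 * len \<le> 3 ^ d * n" using qb by (simp add: len_def)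
  have lt: "N < L" "s < L" "Suc s < L" "Suc N < L" "u < L" "Suc u < W" "Suc s < W" "Suc N < W" "q < L"
    using bounds qb Nq s(1) u len0 by linarith+
  have size: "A aSize s + 1 < W"
  proof -
    have "A aSize s < 2 ^ card (st s)" using D(7)[OF s(1)] by simp
    then show ?thesis using bounds qb len_def by linarith
  qed
  have sub: "A aSub (lo + i) < N" "st (A aSub (lo + i)) \<subseteq> st s" if "i < len" for i
    using D(11)[OF s(1)] trie_sub_subset[OF tr s(1)] that blk by (simp_all add: lo_def)
  \<comment> \<open>The child table as the copying loop will see it. It already maps
    \<open>s\<close> to \<open>N\<close>, since the last entry of the block of \<open>s\<close> is
    \<open>s\<close> itself.\<close>
  define ch where "ch = (A aChild)(s := N)"
  let ?st = "st(N := insert u (st s))"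
  have ch: "ch (A aSub (lo + i)) \<le> N"
    "?st (ch (A aSub (lo + i))) = insert u (st (A aSub (lo + i)))" if "i < len" for i
  proof -
    define y where "y = A aSub (lo + i)"
    have y: "y < N" "st y \<subseteq> st s" using sub[OF that] by (auto simp: y_def)
    have "ch y \<le> N \<and> ?st (ch y) = insert u (st y)"
    proof (cases "y = s")
      case False
      then have "st y \<subset> st s" using y D(3) s(1) by (auto simp: inj_on_def)
      then have "A aStamp y = Suc u" "u \<notin> st y" using ready y s(2) by auto
      then have "A aChild y < N" "st (A aChild y) = insert u (st y)"
        using ts y(1) unfolding trie_state_def by auto
      then show ?thesis using False by (simp add: ch_def)
    qed (simp add: ch_def)
    then show "ch (A aSub (lo + i)) \<le> N"
      "?st (ch (A aSub (lo + i))) = insert u (st (A aSub (lo + i)))" by (simp_all add: y_def)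
  qed
  define A1 where "A1 = A(aStamp := (A aStamp)(s := Suc u), aChild := ch,
    aSize := (A aSize)(N := A aSize s + 1), aParent := (A aParent)(N := s), aElem := (A aElem)(N := u))"
  define R1 where "R1 = R(vJ := lo, vF := lo + len)"
  have subL: "A1 aSub (lo + i) < L" if "i < len" for i
    using sub(1)[OF that] lt(1) by (simp add: A1_def)
  have final: "wp L W (vIds ::= Plus (Var vIds) (Lit 1) ;; Write aStart (Var vIds) (Var vQ)) (\<lambda>(R', A', t').
    trie_state ?st (Suc N) (q + 2 * len) A' u \<and>
    unchanged {vJ, vF, vQ, vIds} R R' \<and> R' vIds = Suc N \<and> R' vQ = q + 2 * len \<and>
    unchanged {5..12} A A' \<and> A' aStamp = (A aStamp)(s := Suc u) \<and>
    (\<forall>i\<le>N. A' aStart i = A aStart i) \<and> (\<forall>p<q. A' aSub p = A aSub p) \<and>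
    t' \<le> t + 120 + 70 * len) (R', A', t')"
    if R': "unchanged {vJ, vQ} R1 R'" "R' vQ = q + 2 * len"
      and A': "unchanged {aSub, aOwn} A1 A'"
      and old: "\<forall>p<q. A' aSub p = A1 aSub p \<and> A' aOwn p = A1 aOwn p"
      and copy: "\<forall>i<len. A' aSub (q + 2 * i) = A1 aSub (lo + i) \<and>
        A' aSub (q + 2 * i + 1) = A1 aChild (A1 aSub (lo + i))"
      and own: "\<forall>p. q \<le> p \<and> p < q + 2 * len \<longrightarrow> A' aOwn p = N"
      and t': "t' \<le> t + 100 + 70 * len"
    for R' A' t'
  proof -
    define A2 where "A2 = A'(aStart := (A' aStart)(Suc N := q + 2 * len))"
    have A2: "A2 aStamp = (A aStamp)(s := Suc u)" "A2 aChild = ch"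
      "A2 aSize = (A aSize)(N := A aSize s + 1)" "A2 aParent = (A aParent)(N := s)"
      "A2 aElem = (A aElem)(N := u)" "A2 aStart = (A aStart)(Suc N := q + 2 * len)"
      "A2 aSub = A' aSub" "A2 aOwn = A' aOwn" "unchanged {5..12} A A2"
      using A' by (auto simp: A2_def A1_def)
    have sub2: "\<forall>p<q. A2 aSub p = A aSub p \<and> A2 aOwn p = A aOwn p"
      using old unfolding A2(7,8) by (simp add: A1_def)
    have "trie ?st (Suc N) (q + 2 * len) A2"
      by (rule trie_extend[OF tr s(1,2) new len_def refl, where ch = ch])
        (use A2 sub2 copy own ch in \<open>auto simp: A1_def lo_def ch_def\<close>)
    moreover have "(if A2 aStamp y = Suc u then A2 aChild y < Suc N \<and> ?st (A2 aChild y) = insert u (?st y)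
        else insert u (?st y) \<notin> ?st ` {..<Suc N})" if y: "y < Suc N" "u \<notin> ?st y" for y
    proof (cases "y = s")
      case True
      then show ?thesis using s(1) by (simp add: A2 ch_def)
    next
      case False
      have yN: "y < N" "u \<notin> st y" using y by (auto simp: less_Suc_eq)
      have *: "if A aStamp y = Suc u then A aChild y < N \<and> st (A aChild y) = insert u (st y)
        else insert u (st y) \<notin> st ` {..<N}" using ts yN unfolding trie_state_def by blast
      have "st y \<noteq> st s" using False yN s(1) D(3) by (auto simp: inj_on_def)
      then have "insert u (st y) \<noteq> insert u (st s)" using yN s(2) by (metis insert_ident)
      moreover have "?st ` {..<Suc N} = insert (insert u (st s)) (st ` {..<N})"
        unfolding lessThan_Suc by (auto simp: image_iff)
      moreover have "?st y = st y" "A2 aStamp y = A aStamp y" "A2 aChild y = A aChild y"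
        using yN(1) False by (simp_all add: A2 ch_def)
      ultimately show ?thesis using * by (cases "A aStamp y = Suc u") simp_all
    qed
    moreover have "\<forall>i<Suc N. \<exists>E<n. ?st i \<subseteq> ES E"
      using ts E unfolding trie_state_def by (auto simp: less_Suc_eq)
    moreover have "\<forall>i<Suc N. ?st i \<subseteq> {..u}"
      using ts s(1) unfolding trie_state_def by (auto simp: less_Suc_eq)
    moreover have "\<forall>y. A2 aStamp y \<le> Suc u"
      using ts unfolding trie_state_def A2 by simp
    ultimately have ts2: "trie_state ?st (Suc N) (q + 2 * len) A2 u"
      unfolding trie_state_def by blast
    have RN: "R' vIds = N" using R' R by (simp add: R1_def)
    have rf: "unchanged {vJ, vF, vQ, vIds} R (R'(vIds := Suc N))" using R' by (simp add: R1_def)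
    show ?thesis
      using ts2 A2 sub2 lt rf t' R'(2) by (simp add: RN A2_def[symmetric])
  qed
  have pre: "base R1" "R1 vJ = lo" "R1 vF = lo + len" "R1 vQ = q" "R1 vIds = N"
    using assms(1) R by (simp_all add: R1_def base_def)
  show ?thesis
    unfolding new_child_def len_def[symmetric]
    using lt size R
    apply (simp add: lo_def[symmetric] blk blk[unfolded Suc_eq_plus1] del: One_nat_def)
    apply (fold ch_def One_nat_def)
    apply (rule wp_mono)
     apply (rule wp_copy_block[where lo = lo and len = len and q = q and N = N])
    subgoal using pre(1) by (simp add: R1_def)
    subgoal by simp
    subgoal by simp
    subgoal by simp
    subgoal by simp
    subgoal using loq .
    subgoal using qb .
    subgoal using Nq .
    subgoal using subL by (simp add: A1_def)
    subgoal for R' A' t'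
      using final[of R' A' t'] by (simp add: A1_def R1_def)
    done
qed

text \<open>Entries in front of position \<open>i\<close> are stamped, and all proper subsets of an
  entry stand in front of it; so each call of \<open>new_child\<close> finds the children that it
  copies. Tests cost constant time per entry of the block, creations are charged to the
  \<open>q' - q\<close> new pairs.\<close>

lemma wp_new_children:
  assumes "base R" and ts: "trie_state st N q A u" and R: "R vIds = N" "R vQ = q" "R vU = u"
    and x: "x < N" "u \<notin> st x" "R vI = A aStart x" "R vE = A aStart (Suc x)" and u: "u < m"
    and E: "E < n" "insert u (st x) \<subseteq> ES E"
  shows "wp L W new_children (\<lambda>(R', A', t'). \<exists>st' N' q'. trie_state st' N' q' A' u \<and> N \<le> N' \<and> q \<le> q' \<and>
    (\<forall>i<N. st' i = st i) \<and> R' vIds = N' \<and> R' vQ = q' \<and>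
    unchanged {vI, vS, vJ, vF, vQ, vIds} R R' \<and> unchanged {5..12} A A' \<and>
    A' aChild x < N' \<and> st' (A' aChild x) = insert u (st x) \<and>
    t' \<le> t + 10 + 50 * 2 ^ card (st x) + 200 * (q' - q)) (R, A, t)"
    (is "wp L W _ ?Q _")
proof -
  have tr: "trie st N q A" using ts by (simp add: trie_state_def)
  note D = trieD[OF tr]
  define lo where "lo = A aStart x"
  define hi where "hi = A aStart (Suc x)"
  have hi: "hi = lo + 2 ^ card (st x)" using D(8)[OF x(1)] by (simp add: lo_def hi_def)
  have hiq: "hi \<le> q" using trie_block_le[OF tr x(1)] by (simp add: hi_def)
  have q: "q \<le> 3 ^ d * n" using trie_bound[OF tr] ts by (simp add: trie_state_def)
  let ?I = "\<lambda>i (R', A', t'). lo \<le> i \<and> (\<exists>st' N' q'. trie_state st' N' q' A' u \<and> N \<le> N' \<and> q \<le> q' \<and>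
    (\<forall>i<N. st' i = st i) \<and> R' vIds = N' \<and> R' vQ = q' \<and> R' vI = i \<and>
    unchanged {vI, vS, vJ, vF, vQ, vIds} R R' \<and> unchanged {5..12} A A' \<and>
    (\<forall>p<q. A' aSub p = A aSub p) \<and> (\<forall>p. lo \<le> p \<and> p < i \<longrightarrow> A' aStamp (A aSub p) = Suc u) \<and>
    t' \<le> t + 50 * (i - lo) + 200 * (q' - q))"
  have step: "R' vI = i \<and> R' vE = hi \<and>
      wp L W (vS ::= Ld aSub (Var vI) ;;
        Cond (Equal (Ld aStamp (Var vS)) (Plus (Var vU) (Lit 1))) Skip new_child)
       (\<lambda>(R', A', t'). R' vI = i \<and> ?I (Suc i) (R'(vI := Suc i), A', t' + 5)) (R', A', t' + 3)"
    if I: "?I i (R', A', t')" and i: "lo \<le> i" "i < hi" for i R' A' t'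
  proof -
    from I obtain st' N' q' where st': "trie_state st' N' q' A' u" "N \<le> N'" "q \<le> q'"
      "\<forall>i<N. st' i = st i" "R' vIds = N'" "R' vQ = q'" "R' vI = i"
      "unchanged {vI, vS, vJ, vF, vQ, vIds} R R'" "unchanged {5..12} A A'"
      "\<forall>p<q. A' aSub p = A aSub p" "\<forall>p. lo \<le> p \<and> p < i \<longrightarrow> A' aStamp (A aSub p) = Suc u"
      "t' \<le> t + 50 * (i - lo) + 200 * (q' - q)" by auto
    have tr': "trie st' N' q' A'" using st'(1) by (simp add: trie_state_def)
    define s where "s = A aSub i"
    have s: "s < N" "st s \<subseteq> st x" "A' aSub i = s" "u \<notin> st s"
      using D(11)[OF x(1)] trie_sub_subset[OF tr x(1)] i hiq st'(10) x(2) by (auto simp: s_def lo_def hi_def)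
    have lt: "i < L" "s < L" "Suc u < W"
      using i hiq q bounds s(1) trie_ids_le[OF tr] u by linarith+
    have R': "R' vE = hi" "R' vU = u" "base R'"
      using st'(8) R x(4) assms(1) by (auto simp: hi_def base_def)
    show ?thesis
    proof (cases "A' aStamp s = Suc u")
      case True
      then have "\<forall>p. lo \<le> p \<and> p < Suc i \<longrightarrow> A' aStamp (A aSub p) = Suc u"
        using st'(11) by (auto simp: less_Suc_eq s_def)
      then have "?I (Suc i) (R'(vS := s, vI := Suc i), A', t' + 23)"
        using st' i by (intro case_prodI conjI exI[of _ st'] exI[of _ N'] exI[of _ q']) auto
      then show ?thesis
        using st'(7) s lt R' True by (simp add: fun_upd_twist add.commute[of _ t'])
    next
      case False
      have st's: "st' s = st s" using st'(4) s(1) by simp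
      \<comment> \<open>\<open>y\<close> may be any identifier, also a recent one; injectivity of
        \<open>st'\<close> identifies it with an entry of the block of \<open>x\<close>.\<close>
      have ready: "A' aStamp y = Suc u" if y: "y < N'" "st' y \<subset> st' s" for y
      proof -
        have "lo \<le> i" "i < hi" "st' y \<subseteq> st (A aSub i)" using i y st's by (auto simp: s_def)
        from D(12)[OF x(1) this[unfolded lo_def hi_def]] obtain p' where
          p': "lo \<le> p'" "p' \<le> i" "st (A aSub p') = st' y" by (auto simp: lo_def)
        have "A aSub p' < N" using D(11)[OF x(1)] p' i by (auto simp: lo_def hi_def)
        then have "st' (A aSub p') = st' y" "A aSub p' < N'" using p'(3) st'(2,4) by auto
        then have "y = A aSub p'" using trieD(3)[OF tr'] y(1) by (auto simp: inj_on_def)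
        moreover have "p' \<noteq> i" using y st's p'(3) by (auto simp: s_def)
        ultimately show ?thesis using st'(11) p' by simp
      qed
      have *: "wp L W new_child (\<lambda>(R', A', t'). R' vI = i \<and> ?I (Suc i) (R'(vI := Suc i), A', t' + 6))
          (R'(vS := s), A', t' + 18)"
      proof (rule wp_mono[OF wp_new_child[OF _ st'(1), where s = s and E = E]])
        show "base (R'(vS := s))" using R'(3) by (simp add: base_def)
        show "A' aStamp y = Suc u" if "y < N'" "st' y \<subset> st' s" for y using ready[OF that] .
      next
        fix R2 A2 t2
        assume post: "case (R2, A2, t2) of (R'', A'', t'') \<Rightarrow>
          trie_state (st'(N' := insert u (st' s))) (Suc N') (q' + 2 * 2 ^ card (st' s)) A'' u \<and>
          unchanged {vJ, vF, vQ, vIds} (R'(vS := s)) R'' \<and> R'' vIds = Suc N' \<and>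
          R'' vQ = q' + 2 * 2 ^ card (st' s) \<and>
          unchanged {5..12} A' A'' \<and> A'' aStamp = (A' aStamp)(s := Suc u) \<and>
          (\<forall>i\<le>N'. A'' aStart i = A' aStart i) \<and> (\<forall>p<q'. A'' aSub p = A' aSub p) \<and>
          t'' \<le> t' + 18 + 120 + 70 * 2 ^ card (st' s)"
        have stamp: "\<forall>p. lo \<le> p \<and> p < Suc i \<longrightarrow> A2 aStamp (A aSub p) = Suc u"
          using st'(11) post by (auto simp: less_Suc_eq s_def)
        have time: "t2 + 6 \<le> t + 50 * (Suc i - lo) + 200 * (q' + 2 * 2 ^ card (st' s) - q)"
        proof -
          have "(1::nat) \<le> 2 ^ card (st' s)" by simp
          moreover have "q' + 2 * 2 ^ card (st' s) - q = (q' - q) + 2 * 2 ^ card (st' s)" "Suc i - lo = Suc (i - lo)"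
            using st'(3) i by auto
          moreover have "t2 \<le> t' + 140 + 70 * 2 ^ card (st' s)" using post by simp
          ultimately show ?thesis using st'(12) by linarith
        qed
        have "?I (Suc i) (R2(vI := Suc i), A2, t2 + 6)"
          by (intro case_prodI conjI exI[of _ "st'(N' := insert u (st' s))"] exI[of _ "Suc N'"]
            exI[of _ "q' + 2 * 2 ^ card (st' s)"])
            (use post st' i stamp time in \<open>simp_all\<close>)
        moreover have "R2 vI = i" using post st'(7) by simp
        ultimately show "case (R2, A2, t2) of (R', A', t') \<Rightarrow> R' vI = i \<and> ?I (Suc i) (R'(vI := Suc i), A', t' + 6)"
          by simp
      qed (use st' R' s st's False u E in auto)
      show ?thesis
        using st'(7) s lt R' False *
        by (simp add: add.commute[of _ t'] add.commute[of 6])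
    qed
  qed
  have W: "hi < W" using hiq q bounds by linarith
  show ?thesis
    unfolding new_children_def
  proof (rule wp_for_loop[where I = ?I and lo = lo and n = hi])
    show "?I lo (R, A, t)"
      by (intro case_prodI conjI exI[of _ st] exI[of _ N] exI[of _ q])
        (use ts R x in \<open>simp_all add: lo_def\<close>)
    show "lo \<le> hi" using hi by simp
  next
    fix R' A' t'
    assume I: "?I hi (R', A', t')"
    then obtain st' N' q' where st': "trie_state st' N' q' A' u" "N \<le> N'" "q \<le> q'"
      "\<forall>i<N. st' i = st i" "R' vIds = N'" "R' vQ = q'" "R' vI = hi"
      "unchanged {vI, vS, vJ, vF, vQ, vIds} R R'" "unchanged {5..12} A A'"
      "\<forall>p. lo \<le> p \<and> p < hi \<longrightarrow> A' aStamp (A aSub p) = Suc u"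
      "t' \<le> t + 50 * (hi - lo) + 200 * (q' - q)" by auto
    have "lo < hi" using hi by simp
    then have "lo \<le> hi - 1" "hi - 1 < hi" by linarith+
    \<comment> \<open>The last entry of the block of \<open>x\<close> is \<open>x\<close> itself, so
      its own child exists when the loop ends.\<close>
    then have "A' aStamp x = Suc u" using st'(10) D(9)[OF x(1)] by (auto simp: hi_def)
    moreover have "x < N'" "st' x = st x" using x st'(2,4) by auto
    ultimately have "A' aChild x < N'" "st' (A' aChild x) = insert u (st x)"
      using st'(1) x(2) unfolding trie_state_def by auto
    moreover have "R' vE = hi" using st'(8) x(4) by (simp add: hi_def)
    ultimately show "R' vI = hi \<and> R' vE = hi \<and> ?Q (R', A', t' + 4)"
      using st' hi by (intro case_prodI conjI exI[of _ st'] exI[of _ N'] exI[of _ q']) simp_all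
  qed (rule W, (rule step; assumption))
qed


text \<open>\<open>ds\<close> holds the occurrences of the current \<open>u\<close> handled so far;
  an input set whose occurrence is still to come lacks \<open>u\<close>.\<close>

definition cur_ok :: "(nat \<Rightarrow> nat set) \<Rightarrow> nat \<Rightarrow> (nat \<Rightarrow> nat \<Rightarrow> nat) \<Rightarrow> nat list \<Rightarrow> nat \<Rightarrow> bool" where
  "cur_ok st N A ds u \<longleftrightarrow> (\<forall>E<n. A aCur E < N \<and>
    st (A aCur E) = word ` {p. p < d * n \<and> p div d = E \<and> (word p < u \<or> p \<in> set ds)})"

text \<open>
  Extending a set of the instance by one element costs time proportional to the number of its
  current subsets, which is exactly the growth of this potential.
\<close>

definition potential :: "(nat \<Rightarrow> nat set) \<Rightarrow> (nat \<Rightarrow> nat \<Rightarrow> nat) \<Rightarrow> nat" where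
  "potential st A = (\<Sum>E<n. 2 ^ card (st (A aCur E)))"

text \<open>The 14 steps added on the left of the time bound are the overhead of one iteration of
  \<open>walk\<close>, so that the bound can be summed over an occurrence list directly.\<close>

lemma wp_extend_set:
  assumes "base R" and ts: "trie_state st N q A u" and cur: "cur_ok st N A ds u"
    and R: "R vIds = N" "R vQ = q" "R vU = u" "R vP = p"
    and p: "p < d * n" "word p = u" "p \<notin> set ds" and ds: "\<And>p'. p' \<in> set ds \<Longrightarrow> p' < d * n \<and> word p' = u"
  shows "wp L W extend_set (\<lambda>(R', A', t'). \<exists>st' N' q'. trie_state st' N' q' A' u \<and>
    cur_ok st' N' A' (ds @ [p]) u \<and> R' vIds = N' \<and> R' vQ = q' \<and>
    unchanged {vY, vX, vI, vE, vS, vJ, vF, vQ, vIds} R R' \<and>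
    unchanged {4..12} A A' \<and>
    t' + 14 + 200 * q + 150 * potential st A \<le> t + 200 * q' + 150 * potential st' A') (R, A, t)"
    (is "wp L W extend_set ?Q (R, A, t)")
proof -
  have tr: "trie st N q A" using ts by (simp add: trie_state_def)
  define E where "E = p div d"
  define x where "x = A aCur E"
  have E: "E < n" using p(1) by (simp add: E_def less_mult_imp_div_less mult.commute)
  have x: "x < N" "st x = word ` {p. p < d * n \<and> p div d = E \<and> (word p < u \<or> p \<in> set ds)}"
    using cur E unfolding cur_ok_def x_def by auto
  have u: "u < m" using word_less[OF p(1)] p(2) by simp
  \<comment> \<open>The element \<open>u\<close> occurs only once in input set \<open>E\<close>, at
    the position \<open>p\<close> that is not yet in \<open>ds\<close>.\<close>
  have "u \<notin> st x"
  proof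
    assume "u \<in> st x"
    then obtain p' where p': "p' < d * n" "p' div d = E" "word p' = u" "p' \<in> set ds" using x(2) by auto
    then have "p' = p" using word_inj[of p' p] p by (simp add: E_def)
    then show False using p' p(3) by simp
  qed
  note x = x this
  have "word p \<in> ES E" unfolding ES_def E_def using p(1) by blast
  then have sub: "insert u (st x) \<subseteq> ES E" using p(2) x(2) unfolding ES_def by auto
  have NL: "N \<le> 3 ^ d * n" using trie_ids_le[OF tr] trie_bound[OF tr] ts by (simp add: trie_state_def)
  have lt: "E < L" "x < L" "Suc x < L" "Suc x < W"
    using E NL x(1) bounds by linarith+
  define R1 where "R1 = R(vY := E, vX := x, vI := A aStart x, vE := A aStart (Suc x))"
  have R1: "base R1" "R1 vIds = N" "R1 vQ = q" "R1 vU = u" "R1 vI = A aStart x" "R1 vE = A aStart (Suc x)"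
    using assms(1) R by (simp_all add: R1_def base_def)
  have main: "wp L W new_children (wp L W (Write aCur (Var vY) (Ld aChild (Var vX))) ?Q) (R1, A, t + 24)"
  proof (rule wp_mono[OF wp_new_children[OF R1(1) ts R1(2-4) x(1,3) R1(5,6) u E sub]])
    fix R' A' t'
    assume "case (R', A', t') of (R', A', t') \<Rightarrow> \<exists>st' N' q'. trie_state st' N' q' A' u \<and> N \<le> N' \<and> q \<le> q' \<and>
      (\<forall>i<N. st' i = st i) \<and> R' vIds = N' \<and> R' vQ = q' \<and>
      unchanged {vI, vS, vJ, vF, vQ, vIds} R1 R' \<and> unchanged {5..12} A A' \<and>
      A' aChild x < N' \<and> st' (A' aChild x) = insert u (st x) \<and>
      t' \<le> t + 24 + 10 + 50 * 2 ^ card (st x) + 200 * (q' - q)"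
    then obtain st' N' q' where *: "trie_state st' N' q' A' u" "N \<le> N'" "q \<le> q'"
      "\<forall>i<N. st' i = st i" "R' vIds = N'" "R' vQ = q'"
      "unchanged {vI, vS, vJ, vF, vQ, vIds} R1 R'" "unchanged {5..12} A A'"
      "A' aChild x < N'" "st' (A' aChild x) = insert u (st x)"
      "t' \<le> t + 34 + 50 * 2 ^ card (st x) + 200 * (q' - q)" by auto
    define A2 where "A2 = A'(aCur := (A aCur)(E := A' aChild x))"
    have A2: "A2 aCur = (A aCur)(E := A' aChild x)" by (simp add: A2_def)
    have A2_eq: "A'(aCur := (A' aCur)(E := A' aChild x)) = A2" using *(8) by (simp add: A2_def)
    have "trie_state st' N' q' A2 u"
      using *(1) trie_cong[of A2 A'] unfolding trie_state_def by (simp add: A2_def)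
    moreover have "cur_ok st' N' A2 (ds @ [p]) u"
      unfolding cur_ok_def
    proof (intro allI impI)
      fix F assume F: "F < n"
      show "A2 aCur F < N' \<and> st' (A2 aCur F) =
        word ` {p'. p' < d * n \<and> p' div d = F \<and> (word p' < u \<or> p' \<in> set (ds @ [p]))}"
      proof (cases "F = E")
        case True
        have "{p'. p' < d * n \<and> p' div d = E \<and> (word p' < u \<or> p' \<in> set (ds @ [p]))} =
          insert p {p. p < d * n \<and> p div d = E \<and> (word p < u \<or> p \<in> set ds)}"
          using p(1) by (auto simp: E_def)
        then show ?thesis using True *(9,10) x(2) p(2) by (simp add: A2)
      next
        case False
        have "{p'. p' < d * n \<and> p' div d = F \<and> (word p' < u \<or> p' \<in> set (ds @ [p]))} =
          {p. p < d * n \<and> p div d = F \<and> (word p < u \<or> p \<in> set ds)}"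
          using False by (auto simp: E_def)
        moreover have "A aCur F < N" "A aCur F < N'" "A2 aCur F = A aCur F"
          using cur F *(2) False unfolding cur_ok_def by (auto simp: A2)
        ultimately show ?thesis using F cur *(4) unfolding cur_ok_def by simp
      qed
    qed
    moreover have "potential st' A2 = potential st A + 2 ^ card (st x)"
    proof -
      have "potential st' A2 = 2 ^ card (st' (A2 aCur E)) + (\<Sum>E\<in>{..<n} - {E}. 2 ^ card (st' (A2 aCur E)))"
        unfolding potential_def using E by (intro sum.remove) auto
      also have "(\<Sum>E\<in>{..<n} - {E}. 2 ^ card (st' (A2 aCur E))) = (\<Sum>E\<in>{..<n} - {E}. 2 ^ card (st (A aCur E)))"
        using *(4) cur by (intro sum.cong refl) (auto simp: A2 cur_ok_def)
      also have "2 ^ card (st' (A2 aCur E)) = 2 ^ card (st x) + (2 ^ card (st (A aCur E)) :: nat)"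
        using *(10) x(1,3) trieD(6)[OF tr] by (simp add: A2 x_def)
      also have "2 ^ card (st x) + 2 ^ card (st (A aCur E)) + (\<Sum>E\<in>{..<n} - {E}. 2 ^ card (st (A aCur E))) =
        2 ^ card (st x) + (potential st A :: nat)"
        unfolding potential_def using E by (subst sum.remove[of "{..<n}" E]) auto
      finally show ?thesis by simp
    qed
    \<comment> \<open>Absorbs the constant overhead: \<open>58 + 50 * z\<close> is at most
      \<open>150 * z\<close> for \<open>z >= 1\<close>.\<close>
    moreover have "(1::nat) \<le> 2 ^ card (st x)" by simp
    ultimately have time: "t' + 10 + 14 + 200 * q + 150 * potential st A \<le> t + 200 * q' + 150 * potential st' A2"
      and ok: "trie_state st' N' q' A2 u" "cur_ok st' N' A2 (ds @ [p]) u"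
      using *(3,11) by linarith+
    have R': "R' vY = E" "R' vX = x" using *(7) by (simp_all add: R1_def)
    have rf: "unchanged {vY, vX, vI, vE, vS, vJ, vF, vQ, vIds} R R'" using *(7) by (simp add: R1_def)
    have af: "unchanged {4..12} A A2" using *(8) by (auto simp: A2_def)
    have "\<exists>st' N' q'. trie_state st' N' q' A2 u \<and>
      cur_ok st' N' A2 (ds @ [p]) u \<and> R' vIds = N' \<and> R' vQ = q' \<and>
      unchanged {vY, vX, vI, vE, vS, vJ, vF, vQ, vIds} R R' \<and>
      unchanged {4..12} A A2 \<and>
      t' + 10 + 14 + 200 * q + 150 * potential st A \<le> t + 200 * q' + 150 * potential st' A2"
      using ok time rf af *(5,6) by blast
    then show "wp L W (Write aCur (Var vY) (Ld aChild (Var vX))) ?Q (R', A', t')"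
      using lt by (simp add: R' A2_eq)
  qed
  have Rv: "R vD = d" "R vP = p" using assms(1) R by (simp_all add: base_def)
  show ?thesis
    unfolding extend_set_def wp_Seq wp_Assign
    by (intro conjI wp_state_cong[OF main])
      (use lt in \<open>auto simp: Rv E_def[symmetric] x_def[symmetric] R1_def\<close>)
qed

lemma initial_trie:
  assumes "\<And>j. j \<in> {4..12} \<Longrightarrow> A j = (\<lambda>_. 0)"
  shows "trie (\<lambda>_. {}) 1 1 (A(aStart := (A aStart)(1 := 1)))"
  unfolding trie_def using assms by (auto simp: inj_on_def less_Suc_eq)

definition level_state :: "(nat \<Rightarrow> nat set) \<Rightarrow> nat \<Rightarrow> nat \<Rightarrow> (nat \<Rightarrow> nat \<Rightarrow> nat) \<Rightarrow> nat \<Rightarrow> bool" where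
  "level_state st N q A u \<longleftrightarrow> trie st N q A \<and> (\<forall>i<N. \<exists>E<n. st i \<subseteq> ES E) \<and> (\<forall>i<N. st i \<subseteq> {..<u}) \<and>
    (\<forall>y. A aStamp y \<le> u) \<and> cur_ok st N A [] u"

text \<open>Nothing has to be reset between elements: all stamps are at most \<open>u\<close>, hence
  outdated, and no set contains \<open>u\<close> yet, hence no child exists.\<close>

lemma level_state_begin:
  assumes "level_state st N q A u"
  shows "trie_state st N q A u"
proof -
  have "A aStamp y \<noteq> Suc u" for y using assms unfolding level_state_def by (metis not_less_eq_eq order_refl)
  moreover have "insert u (st y) \<notin> st ` {..<N}" for y
  proof
    assume "insert u (st y) \<in> st ` {..<N}"
    then obtain i where "i < N" "u \<in> st i" by auto
    then show False using assms unfolding level_state_def by auto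
  qed
  moreover have "st i \<subseteq> {..u}" if "i < N" for i
    using assms that unfolding level_state_def by (auto dest!: spec[of _ i])
  ultimately show ?thesis using assms unfolding level_state_def trie_state_def by (simp add: le_SucI)
qed

lemma level_state_end:
  assumes "trie_state st N q A u" "cur_ok st N A ds u" "set ds = {p. p < d * n \<and> word p = u}"
  shows "level_state st N q A (Suc u)"
proof -
  have "{p. p < d * n \<and> p div d = E \<and> (word p < u \<or> p \<in> set ds)} =
      {p. p < d * n \<and> p div d = E \<and> (word p < Suc u \<or> p \<in> set [])}" for E
    unfolding assms(3) by auto
  then show ?thesis
    using assms(1,2) unfolding level_state_def trie_state_def cur_ok_def by (simp add: lessThan_Suc_atMost)
qed

lemma wp_build_trie:
  assumes "base R" and zero: "\<And>j. j \<in> {4..12} \<Longrightarrow> A j = (\<lambda>_. 0)"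
    and chain: "\<And>u. chain (A aNext) (A aHead u) (rev (filter (\<lambda>p. word p = u) [0..<d * n]))"
  shows "wp L W build_trie (\<lambda>(R', A', t'). base R' \<and> unchanged {4..12} A A' \<and>
    (\<exists>st. trie st (R' vIds) (R' vQ) A' \<and> (\<forall>i<R' vIds. \<exists>E<n. st i \<subseteq> ES E) \<and>
      (\<forall>E<n. A' aCur E < R' vIds \<and> st (A' aCur E) = ES E)) \<and>
    t' \<le> t + 40 + 400 * (3 ^ d * n) + 40 * m) (R, A, t)"
    (is "wp L W build_trie ?Q _")
proof -
  let ?I = "\<lambda>u (R', A', t'). base R' \<and> R' vU = u \<and> unchanged {4..12} A A' \<and>
    (\<exists>st. level_state st (R' vIds) (R' vQ) A' u \<and>
      t' \<le> t + 20 + 200 * R' vQ + 150 * potential st A' + 40 * u)"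
  have step: "R' vU = u \<and> R' vM = m \<and>
      wp L W (vH ::= Ld aHead (Var vU) ;; walk vH vP aNext extend_set)
       (\<lambda>(R', A', t'). R' vU = u \<and> ?I (Suc u) (R'(vU := Suc u), A', t' + 5)) (R', A', t' + 3)"
    if I: "?I u (R', A', t')" and u: "u < m" for u R' A' t'
  proof -
    from I obtain st where st: "level_state st (R' vIds) (R' vQ) A' u"
      "t' \<le> t + 20 + 200 * R' vQ + 150 * potential st A' + 40 * u" by auto
    have R': "base R'" "R' vU = u" and A': "unchanged {4..12} A A'" using I by auto
    define ps where "ps = rev (filter (\<lambda>p. word p = u) [0..<d * n])"
    have ps: "distinct ps" "set ps = {p. p < d * n \<and> word p = u}" by (auto simp: ps_def)
    let ?J = "\<lambda>ds (R', A', t'). base R' \<and> R' vU = u \<and> unchanged {4..12} A A' \<and>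
      (\<exists>st. trie_state st (R' vIds) (R' vQ) A' u \<and> cur_ok st (R' vIds) A' ds u \<and>
        t' \<le> t + 40 + 200 * R' vQ + 150 * potential st A' + 40 * u)"
    have inner: "wp L W extend_set (\<lambda>(R', A', t'). R' vP = p \<and> A' aNext = A aNext \<and>
        ?J (ds @ [p]) (R'(vH := A aNext p), A', t' + 7)) (R'(vP := p), A', t' + 7)"
      if split: "ps = ds @ p # xs" and J: "?J ds (R', A', t')" for ds p xs R' A' t'
    proof -
      from J obtain st where st: "trie_state st (R' vIds) (R' vQ) A' u" "cur_ok st (R' vIds) A' ds u"
        "t' \<le> t + 40 + 200 * R' vQ + 150 * potential st A' + 40 * u" by auto
      have J: "base R'" "R' vU = u" "unchanged {4..12} A A'" using J by auto
      have p: "p < d * n" "word p = u" "p \<notin> set ds" "\<And>p'. p' \<in> set ds \<Longrightarrow> p' < d * n \<and> word p' = u"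
        using ps split by auto
      show ?thesis
      proof (rule wp_mono[OF wp_extend_set[OF _ st(1,2) _ _ _ _ p]])
        fix R2 A2 t2
        assume "case (R2, A2, t2) of (R'', A'', t'') \<Rightarrow> \<exists>st' N' q'. trie_state st' N' q' A'' u \<and>
          cur_ok st' N' A'' (ds @ [p]) u \<and> R'' vIds = N' \<and> R'' vQ = q' \<and>
          unchanged {vY, vX, vI, vE, vS, vJ, vF, vQ, vIds} (R'(vP := p)) R'' \<and>
          unchanged {4..12} A' A'' \<and>
          t'' + 14 + 200 * R' vQ + 150 * potential st A' \<le> t' + 7 + 200 * q' + 150 * potential st' A''"
        then obtain st' where *: "trie_state st' (R2 vIds) (R2 vQ) A2 u"
          "cur_ok st' (R2 vIds) A2 (ds @ [p]) u"
          "unchanged {vY, vX, vI, vE, vS, vJ, vF, vQ, vIds} (R'(vP := p)) R2"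
          "unchanged {4..12} A' A2"
          "t2 + 14 + 200 * R' vQ + 150 * potential st A' \<le> t' + 7 + 200 * R2 vQ + 150 * potential st' A2"
          by auto
        have "t2 + 7 \<le> t + 40 + 200 * R2 vQ + 150 * potential st' A2 + 40 * u" using *(5) st(3) by linarith
        then show "case (R2, A2, t2) of (R', A', t') \<Rightarrow> R' vP = p \<and> A' aNext = A aNext \<and>
            ?J (ds @ [p]) (R'(vH := A aNext p), A', t' + 7)"
          using * J by (auto simp: base_def)
      qed (use J in \<open>simp_all add: base_def\<close>)
    qed
    have walk: "wp L W (walk vH vP aNext extend_set)
       (\<lambda>(R', A', t'). R' vU = u \<and> ?I (Suc u) (R'(vU := Suc u), A', t' + 5)) (R'(vH := A aHead u), A', t' + 9)"
    proof (rule wp_walk[where I = ?J and ps = ps and nxt = "A aNext"])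
      show "?J [] (R'(vH := A aHead u), A', t' + 9)"
        using R' A' st level_state_begin[OF st(1)]
        by (auto simp: base_def level_state_def intro!: exI[of _ st])
      show "chain (A aNext) ((R'(vH := A aHead u)) vH) ps" using chain by (simp add: ps_def)
      show "A' aNext = A aNext" using A' by simp
      show "p < L" if "p \<in> set ps" for p using that ps(2) bounds by auto
    next
      fix R2 A2 t2
      assume "?J ps (R2, A2, t2)"
      then obtain st where "base R2" "R2 vU = u" "unchanged {4..12} A A2"
        "trie_state st (R2 vIds) (R2 vQ) A2 u" "cur_ok st (R2 vIds) A2 ps u"
        "t2 \<le> t + 40 + 200 * R2 vQ + 150 * potential st A2 + 40 * u" by auto
      then show "case (R2, A2, t2 + 4) of (R', A', t') \<Rightarrow> R' vU = u \<and> ?I (Suc u) (R'(vU := Suc u), A', t' + 5)"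
        using level_state_end[OF _ _ ps(2)] by (auto simp: base_def intro!: exI[of _ st])
    next
      show "wp L W extend_set (\<lambda>(R', A', t'). R' vP = p \<and> A' aNext = A aNext \<and>
        ?J (ds @ [p]) (R'(vH := A aNext p), A', t' + 7)) (R'(vP := p), A', t' + 7)"
        if "ps = ds @ p # xs" "?J ds (R', A', t')" "A' aNext = A aNext" for ds p xs R' A' t'
        by (rule inner[OF that(1,2)])
    qed simp_all
    have "u < L" using u bounds by simp
    moreover have "A' aHead u = A aHead u" "R' vM = m" using A' R'(1) by (simp_all add: base_def)
    ultimately show ?thesis
      unfolding wp_Seq wp_Assign using R'(2) by (intro conjI wp_state_cong[OF walk]) simp_all
  qed
  have mW: "m < W" "1 < L" using bounds by linarith+
  let ?R = "R(vIds := 1, vQ := 1, vU := 0)" and ?A = "A(aStart := (A aStart)(1 := 1))"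
  have init: "?I 0 (?R, ?A, t + 12)"
  proof -
    have "level_state (\<lambda>_. {}) 1 1 ?A 0"
      unfolding level_state_def cur_ok_def using initial_trie[OF zero] zero n_pos by auto
    then show ?thesis using assms(1) by (auto simp: base_def intro!: exI[of _ "\<lambda>_. {}"])
  qed
  have loop: "wp L W (for_loop vU vM (vH ::= Ld aHead (Var vU) ;; walk vH vP aNext extend_set)) ?Q
      (?R, ?A, t + 12)"
  proof (rule wp_for_loop[where I = ?I and lo = 0 and n = m])
    show "?I 0 (?R, ?A, t + 12)" by (rule init)
  next
    fix R' A' t'
    assume "?I m (R', A', t')"
    then obtain st where *: "base R'" "R' vU = m" "unchanged {4..12} A A'"
      "level_state st (R' vIds) (R' vQ) A' m"
      "t' \<le> t + 20 + 200 * R' vQ + 150 * potential st A' + 40 * m" by auto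
    have st: "trie st (R' vIds) (R' vQ) A'" "\<forall>i<R' vIds. \<exists>E<n. st i \<subseteq> ES E"
      using *(4) unfolding level_state_def by auto
    have "{p. p < d * n \<and> p div d = E \<and> (word p < m \<or> p \<in> set [])} = {p. p < d * n \<and> p div d = E}" for E
      using word_less by auto
    then have cur: "\<forall>E<n. A' aCur E < R' vIds \<and> st (A' aCur E) = ES E"
      using *(4) unfolding level_state_def cur_ok_def ES_def by simp
    \<comment> \<open>In the end the current sets are the input sets, all of size \<open>d\<close>;
      this bounds the total charge for scanning blocks.\<close>
    then have "potential st A' = 2 ^ d * n" unfolding potential_def by (simp add: ES_card)
    then have "potential st A' \<le> 3 ^ d * n" using pow3_ge(5) by simp
    moreover have "R' vQ \<le> 3 ^ d * n" using trie_bound[OF st(1)] st(2) by blast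
    ultimately have "t' + 4 \<le> t + 40 + 400 * (3 ^ d * n) + 40 * m" using *(5) by linarith
    then show "R' vU = m \<and> R' vM = m \<and> ?Q (R', A', t' + 4)" using * st cur by (auto simp: base_def)
  qed (use mW in simp, use mW in simp, rule step)
  show ?thesis
    unfolding build_trie_def wp_Seq wp_Assign wp_Write
    by (intro conjI wp_state_cong[OF loop]) (use mW in \<open>auto\<close>)
qed

end

section \<open>Finding the good sets\<close>

text \<open>\<open>T\<close> is a snapshot of the arrays after the construction of the trie.\<close>

locale kernel_trie = kernel_input +
  fixes st :: "nat \<Rightarrow> nat set" and N q :: nat and T :: "nat \<Rightarrow> nat \<Rightarrow> nat"
  assumes tr: "trie st N q T"
    and covered: "i < N \<Longrightarrow> \<exists>E<n. st i \<subseteq> ES E"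
    and cur: "E < n \<Longrightarrow> T aCur E < N \<and> st (T aCur E) = ES E"
begin

definition regs_ok :: "(nat \<Rightarrow> nat) \<Rightarrow> bool" where
  "regs_ok R \<longleftrightarrow> base R \<and> R vIds = N \<and> R vQ = q"

definition trie_arrays :: "(nat \<Rightarrow> nat \<Rightarrow> nat) \<Rightarrow> bool" where
  "trie_arrays A \<longleftrightarrow> (\<forall>j\<in>{4..10}. A j = T j)"

lemma trie_arraysD:
  assumes "trie_arrays A"
  shows "A aCur = T aCur" "A aSub = T aSub" "A aOwn = T aOwn" "A aStart = T aStart" "A aSize = T aSize"
    "A aParent = T aParent" "A aElem = T aElem"
  using assms unfolding trie_arrays_def by simp_all

lemma trie_arrays_frame:
  "\<lbrakk>trie_arrays A; \<And>j. j \<in> {4..10} \<Longrightarrow> A' j = A j\<rbrakk> \<Longrightarrow> trie_arrays A'"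
  unfolding trie_arrays_def by simp

lemma q_bound: "q \<le> 3 ^ d * n" "q < L" "q < W"
  using trie_bound[OF tr] covered bounds by fastforce+

lemma N_bound: "N \<le> q" "N < L" "N < W"
  using trie_ids_le[OF tr] q_bound by simp_all

lemma size_st: "i < N \<Longrightarrow> T aSize i = card (st i)"
  using trieD(7)[OF tr] .

lemma finite_st: "i < N \<Longrightarrow> finite (st i)"
  using trieD(6)[OF tr] .

lemma card_st_le: "i < N \<Longrightarrow> card (st i) \<le> d"
  using covered[of i] ES_card by (metis card_mono)

lemma pair_less:
  assumes "p < q"
  shows "T aOwn p < N" "T aSub p < N" "st (T aSub p) \<subseteq> st (T aOwn p)"
proof -
  obtain i where i: "i < N" "T aStart i \<le> p" "p < T aStart (Suc i)"
    using trie_position[OF tr assms] .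
  then have "T aOwn p = i" using trieD(10)[OF tr i] by simp
  then show "T aOwn p < N" "T aSub p < N" "st (T aSub p) \<subseteq> st (T aOwn p)"
    using i trieD(11)[OF tr i] trie_sub_subset[OF tr i] by simp_all
qed

text \<open>Together with \<open>pair_exists\<close> this makes positions below \<open>q\<close>
  correspond one to one to pairs of identifiers with S contained in T, so counting positions is
  counting supersets.\<close>

lemma pair_inj:
  assumes "p < q" "p' < q" "T aOwn p = T aOwn p'" "T aSub p = T aSub p'"
  shows "p = p'"
proof -
  obtain i where i: "i < N" "T aStart i \<le> p" "p < T aStart (Suc i)"
    using trie_position[OF tr assms(1)] .
  obtain i' where i': "i' < N" "T aStart i' \<le> p'" "p' < T aStart (Suc i')"
    using trie_position[OF tr assms(2)] .
  have "i = i'" using trieD(10)[OF tr i] trieD(10)[OF tr i'] assms(3) by simp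
  then show ?thesis
    using bij_betw_imp_inj_on[OF trie_block[OF tr i(1)]] i i' assms(4) by (auto simp: inj_on_def)
qed

lemma pair_exists:
  assumes "i < N" "j < N" "st i \<subseteq> st j"
  obtains p where "p < q" "T aOwn p = j" "T aSub p = i"
proof -
  from bij_betw_imp_surj_on[OF trie_block[OF tr assms(2)]] assms(3)
  have "st i \<in> (\<lambda>p. st (T aSub p)) ` {T aStart j..<T aStart (Suc j)}" by simp
  then obtain p where p: "T aStart j \<le> p" "p < T aStart (Suc j)" "st (T aSub p) = st i" by auto
  have "T aSub p = i"
    using p trieD(3,11)[OF tr] assms(1,2) by (auto simp: inj_on_def)
  moreover have "p < q" using p(2) trie_block_le[OF tr assms(2)] by simp
  ultimately show ?thesis using that trieD(10)[OF tr assms(2) p(1,2)] by blast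
qed

text \<open>Sizes are reversed so that keys increase in the order of the rounds; this lets bucket
  walks be charged through \<open>pairs_below\<close>. The base \<open>d + 1\<close> suffices since
  size differences are at most \<open>d\<close>.\<close>

definition key :: "nat \<Rightarrow> nat \<Rightarrow> nat" where
  "key l r = (d - l) * (d + 1) + r"

definition pair_key :: "nat \<Rightarrow> nat" where
  "pair_key p = key (T aSize (T aSub p)) (T aSize (T aOwn p) - T aSize (T aSub p))"

definition bucket :: "nat \<Rightarrow> nat list" where
  "bucket b = rev (filter (\<lambda>p. pair_key p = b) [0..<q])"

lemma pair_sizes:
  assumes "p < q"
  shows "T aSize (T aSub p) \<le> T aSize (T aOwn p)" "T aSize (T aOwn p) \<le> d"
  using pair_less[OF assms] size_st card_st_le finite_st by (simp_all add: card_mono)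

lemma key_less:
  assumes "l \<le> d" "r \<le> d"
  shows "key l r < L"
proof -
  have "(d - l) * (d + 1) + r < d * (d + 1) + (d + 1)"
    using assms mult_le_mono1[of "d - l" d "d + 1"] by linarith
  then show ?thesis using bounds(5) by (simp add: key_def)
qed

lemma key_inj:
  assumes "l \<le> d" "r \<le> d" "l' \<le> d" "r' \<le> d" "key l r = key l' r'"
  shows "l = l' \<and> r = r'"
proof -
  have "(d - l) * (d + 1) + r = (d - l') * (d + 1) + r'" using assms(5) by (simp add: key_def)
  then have "d - l = d - l' \<and> r = r'" using addr_inj[of r "d + 1" r' "d - l" "d - l'"] assms by simp
  then show ?thesis using assms(1,3) by (metis diff_diff_cancel)
qed

lemma bucket_distinct: "distinct (bucket b)"
  by (simp add: bucket_def)

lemma set_bucket: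
  assumes "l \<le> d" "r \<le> d"
  shows "set (bucket (key l r)) = {p. p < q \<and> T aSize (T aSub p) = l \<and> T aSize (T aOwn p) = l + r}"
proof -
  have "pair_key p = key l r \<longleftrightarrow> T aSize (T aSub p) = l \<and> T aSize (T aOwn p) = l + r" if "p < q" for p
    using key_inj[of "T aSize (T aSub p)" "T aSize (T aOwn p) - T aSize (T aSub p)" l r]
      pair_sizes[OF that] assms by (auto simp: pair_key_def)
  then show ?thesis by (auto simp: bucket_def)
qed

lemma bucket_less: "p \<in> set (bucket b) \<Longrightarrow> p < q"
  by (auto simp: bucket_def)

section \<open>Passes over the input sets, the pairs and single buckets\<close>

lemma wp_mark_input:
  assumes "regs_ok R" "trie_arrays A" "A aGood = (\<lambda>_. 0)"
  shows "wp L W mark_input (\<lambda>(R', A', t'). regs_ok R' \<and> unchanged_except aGood A A' \<and>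
    (\<forall>i. A' aGood i = (if \<exists>E<n. i = T aCur E then 1 else 0)) \<and> t' \<le> t + 10 + 20 * n) (R, A, t)"
proof -
  let ?I = "\<lambda>E (R', A', t'). regs_ok R' \<and> R' vY = E \<and> unchanged_except aGood A A' \<and>
    (\<forall>i. A' aGood i = (if \<exists>F<E. i = T aCur F then 1 else 0)) \<and> t' \<le> t + 5 + 20 * E"
  have loop: "wp L W (for_loop vY vN (Write aGood (Ld aCur (Var vY)) (Lit 1)))
     (\<lambda>(R', A', t'). regs_ok R' \<and> unchanged_except aGood A A' \<and>
      (\<forall>i. A' aGood i = (if \<exists>E<n. i = T aCur E then 1 else 0)) \<and> t' \<le> t + 10 + 20 * n) (R(vY := 0), A, t + 2)"
  proof (rule wp_for_loop[where I = ?I and lo = 0 and n = n])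
    show "?I 0 (R(vY := 0), A, t + 2)" using assms by (simp add: regs_ok_def base_def)
  next
    fix E R' A' t'
    assume I: "?I E (R', A', t')" and E: "E < n"
    have "A' aCur = T aCur" using I trie_arraysD[OF assms(2)] by simp
    moreover have "T aCur E < L" "E < L" using cur[OF E] N_bound E bounds by linarith+
    ultimately show "R' vY = E \<and> R' vN = n \<and> wp L W (Write aGood (Ld aCur (Var vY)) (Lit 1))
        (\<lambda>(R', A', t'). R' vY = E \<and> ?I (Suc E) (R'(vY := Suc E), A', t' + 5)) (R', A', t' + 3)"
      using I by (auto simp: regs_ok_def base_def less_Suc_eq)
  qed (use bounds in \<open>auto simp: regs_ok_def base_def\<close>)
  show ?thesis
    unfolding mark_input_def wp_Seq wp_Assign by (intro conjI wp_state_cong[OF loop]) simp_all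
qed

lemma wp_bucket_pairs:
  assumes "regs_ok R" "trie_arrays A" "A aHeadB = (\<lambda>_. 0)"
  shows "wp L W bucket_pairs (\<lambda>(R', A', t'). regs_ok R' \<and> unchanged {aHeadB, aNextB} A A' \<and>
    (\<forall>b. chain (A' aNextB) (A' aHeadB b) (bucket b)) \<and> t' \<le> t + 10 + 100 * q) (R, A, t)"
    (is "wp L W _ ?Q _")
proof -
  let ?body = "vB ::= Plus (Times (Minus (Var vD) (Ld aSize (Ld aSub (Var vP)))) (Plus (Var vD) (Lit 1)))
        (Minus (Ld aSize (Ld aOwn (Var vP))) (Ld aSize (Ld aSub (Var vP)))) ;;
      Write aNextB (Var vP) (Ld aHeadB (Var vB)) ;;
      Write aHeadB (Var vB) (Plus (Var vP) (Lit 1))"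
  let ?I = "\<lambda>i (R', A', t'). regs_ok R' \<and> R' vP = i \<and> unchanged {aHeadB, aNextB} A A' \<and>
    (\<forall>b. chain (A' aNextB) (A' aHeadB b) (rev (filter (\<lambda>p. pair_key p = b) [0..<i]))) \<and>
    t' \<le> t + 5 + 100 * i"
  have loop: "wp L W (for_loop vP vQ ?body) ?Q (R(vP := 0), A, t + 2)"
  proof (rule wp_for_loop[where I = ?I and lo = 0 and n = q])
    show "?I 0 (R(vP := 0), A, t + 2)" using assms by (simp add: regs_ok_def base_def)
  next
    fix i R' A' t'
    assume I: "?I i (R', A', t')" and i: "i < q"
    have A': "A' aSize = T aSize" "A' aSub = T aSub" "A' aOwn = T aOwn"
      using I trie_arraysD[OF assms(2)] by simp_all
    have R': "R' vD = d" "R' vP = i" "R' vQ = q" using I by (simp_all add: regs_ok_def base_def)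
    have ids: "T aSub i < L" "T aOwn i < L" "i < L"
      using pair_less[OF i] N_bound q_bound i by linarith+
    note s = pair_sizes[OF i]
    have key: "pair_key i < L" unfolding pair_key_def using s by (intro key_less) auto
    have key_eq: "(d - T aSize (T aSub i)) * (d + 1) + (T aSize (T aOwn i) - T aSize (T aSub i)) = pair_key i"
      by (simp add: pair_key_def key_def)
    have kW: "(d - T aSize (T aSub i)) * (d + 1) < W" "pair_key i < W" "d + 1 < W" "i + 1 < W"
      using key key_eq bounds ids by linarith+
    have ch: "\<forall>b. chain ((A' aNextB)(i := A' aHeadB (pair_key i))) (((A' aHeadB)(pair_key i := Suc i)) b)
        (rev (filter (\<lambda>p. pair_key p = b) [0..<Suc i]))"
      using chain_insert[where f = pair_key and head = "A' aHeadB" and nx = "A' aNextB"] I by blast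
    have ch1: "chain ((A' aNextB)(i := A' aHeadB (pair_key i))) (Suc i)
        (rev (filter (\<lambda>p. pair_key p = pair_key i) [0..<Suc i]))"
      using spec[OF ch, of "pair_key i"] unfolding fun_upd_same .
    have ch2: "chain ((A' aNextB)(i := A' aHeadB (pair_key i))) (A' aHeadB b)
        (rev (filter (\<lambda>p. pair_key p = b) [0..<Suc i]))" if "b \<noteq> pair_key i" for b
      using spec[OF ch, of b] unfolding fun_upd_other[OF that] .
    have "wp L W ?body (\<lambda>(R', A', t'). R' vP = i \<and> ?I (Suc i) (R'(vP := Suc i), A', t' + 5)) (R', A', t' + 3)"
      unfolding wp_Seq wp_Assign wp_Write
      using I s ids kW key ch1 ch2
      by (simp add: R' A' key_eq del: One_nat_def upt_Suc) (simp add: regs_ok_def base_def del: upt_Suc)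
    then show "R' vP = i \<and> R' vQ = q \<and>
        wp L W ?body (\<lambda>(R', A', t'). R' vP = i \<and> ?I (Suc i) (R'(vP := Suc i), A', t' + 5)) (R', A', t' + 3)"
      using R' by blast
  qed (use q_bound in \<open>auto simp: regs_ok_def base_def bucket_def\<close>)
  show ?thesis
    unfolding bucket_pairs_def wp_Seq wp_Assign by (intro conjI wp_state_cong[OF loop]) simp_all
qed

lemma wp_count_supersets:
  assumes "regs_ok R" "trie_arrays A" "R vB = b" "b < L" "chain (A aNextB) (A aHeadB b) (bucket b)"
    and zero: "A aCnt = (\<lambda>_. 0)"
  shows "wp L W count_supersets (\<lambda>(R', A', t'). unchanged {vH, vP, vT, vS} R R' \<and>
    unchanged_except aCnt A A' \<and>
    (\<forall>i. A' aCnt i = length (filter (\<lambda>p. T aSub p = i \<and> 0 < A aGood (T aOwn p) \<and> A aDead (T aOwn p) = 0) (bucket b))) \<and>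
    t' \<le> t + 20 + 70 * length (bucket b)) (R, A, t)"
    (is "wp L W _ ?Q _")
proof -
  let ?body = "vT ::= Ld aOwn (Var vP) ;;
     Cond (Less (Lit 0) (Ld aGood (Var vT)))
       (Cond (Equal (Ld aDead (Var vT)) (Lit 0))
         (vS ::= Ld aSub (Var vP) ;; Write aCnt (Var vS) (Plus (Ld aCnt (Var vS)) (Lit 1)))
         Skip)
       Skip"
  let ?f = "\<lambda>i ds. length (filter (\<lambda>p. T aSub p = i \<and> 0 < A aGood (T aOwn p) \<and> A aDead (T aOwn p) = 0) ds)"
  let ?I = "\<lambda>ds (R', A', t'). unchanged {vH, vP, vT, vS} R R' \<and>
    unchanged_except aCnt A A' \<and> (\<forall>i. A' aCnt i = ?f i ds) \<and> t' \<le> t + 10 + 70 * length ds"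
  have loop: "wp L W (walk vH vP aNextB ?body) ?Q (R(vH := A aHeadB b), A, t + 6)"
  proof (rule wp_walk[where I = ?I and ps = "bucket b" and nxt = "A aNextB"])
    show "?I [] (R(vH := A aHeadB b), A, t + 6)" using zero by simp
    show "p < L" if "p \<in> set (bucket b)" for p using bucket_less[OF that] q_bound by simp
  next
    fix ds p xs R' A' t'
    assume split: "bucket b = ds @ p # xs" and I: "?I ds (R', A', t')" and "A' aNextB = A aNextB"
    have p: "p < q" using bucket_less[of p b] split by simp
    have "length (bucket b) \<le> q" using length_filter_le[of _ "[0..<q]"] by (simp add: bucket_def)
    then have len: "?f i ds + 1 < W" for i
    proof -
      have "?f i ds \<le> length ds" by (rule length_filter_le)
      moreover have "length ds + 1 \<le> q" using \<open>length (bucket b) \<le> q\<close> split by simp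
      ultimately show ?thesis using q_bound by linarith
    qed
    have A': "A' aSub = T aSub" "A' aOwn = T aOwn" "A' aGood = A aGood" "A' aDead = A aDead" "A' aNextB = A aNextB"
      "\<forall>i. A' aCnt i = ?f i ds"
      using I trie_arraysD[OF assms(2)] by simp_all
    have ids: "T aSub p < L" "T aOwn p < L" "p < L"
      using pair_less[OF p] N_bound q_bound p by linarith+
    show "wp L W ?body (\<lambda>(R', A', t'). R' vP = p \<and> A' aNextB = A aNextB \<and>
        ?I (ds @ [p]) (R'(vH := A aNextB p), A', t' + 7)) (R'(vP := p), A', t' + 7)"
      using I ids len by (simp add: A')
  qed (use assms in \<open>auto\<close>)
  show ?thesis
    unfolding count_supersets_def walk_bucket_def wp_Seq wp_Assign
    by (intro conjI wp_state_cong[OF loop]) (use assms in simp_all)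
qed

lemma wp_mark_good:
  assumes "regs_ok R" "trie_arrays A" "R vB = b" "b < L" "chain (A aNextB) (A aHeadB b) (bucket b)"
    and "R vNu = v"
  shows "wp L W mark_good (\<lambda>(R', A', t'). unchanged {vH, vP, vT, vS} R R' \<and>
    unchanged {aGood, aDead} A A' \<and>
    (\<forall>i. 0 < A' aGood i \<longleftrightarrow> 0 < A aGood i \<or> (\<exists>p\<in>set (bucket b). T aSub p = i \<and> v \<le> A aCnt i)) \<and>
    (\<forall>i. 0 < A' aDead i \<longleftrightarrow> 0 < A aDead i \<or> (\<exists>p\<in>set (bucket b). T aOwn p = i \<and> v \<le> A aCnt (T aSub p))) \<and>
    t' \<le> t + 20 + 70 * length (bucket b)) (R, A, t)"
    (is "wp L W _ ?Q _")
proof -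
  let ?body = "vS ::= Ld aSub (Var vP) ;;
     Cond (Less (Ld aCnt (Var vS)) (Var vNu)) Skip
       (Write aGood (Var vS) (Lit 1) ;; Write aDead (Ld aOwn (Var vP)) (Lit 1))"
  let ?I = "\<lambda>ds (R', A', t'). unchanged {vH, vP, vT, vS} R R' \<and>
    unchanged {aGood, aDead} A A' \<and>
    (\<forall>i. 0 < A' aGood i \<longleftrightarrow> 0 < A aGood i \<or> (\<exists>p\<in>set ds. T aSub p = i \<and> v \<le> A aCnt i)) \<and>
    (\<forall>i. 0 < A' aDead i \<longleftrightarrow> 0 < A aDead i \<or> (\<exists>p\<in>set ds. T aOwn p = i \<and> v \<le> A aCnt (T aSub p))) \<and>
    t' \<le> t + 10 + 70 * length ds"
  have loop: "wp L W (walk vH vP aNextB ?body) ?Q (R(vH := A aHeadB b), A, t + 6)"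
  proof (rule wp_walk[where I = ?I and ps = "bucket b" and nxt = "A aNextB"])
    show "?I [] (R(vH := A aHeadB b), A, t + 6)" by simp
    show "p < L" if "p \<in> set (bucket b)" for p using bucket_less[OF that] q_bound by simp
  next
    fix ds p xs R' A' t'
    assume split: "bucket b = ds @ p # xs" and I: "?I ds (R', A', t')" and "A' aNextB = A aNextB"
    have p: "p < q" using bucket_less[of p b] split by simp
    have A': "A' aSub = T aSub" "A' aOwn = T aOwn" "A' aCnt = A aCnt" "A' aNextB = A aNextB" "R' vNu = v"
      using I assms(6) trie_arraysD[OF assms(2)] by simp_all
    have ids: "T aSub p < L" "T aOwn p < L" "p < L"
      using pair_less[OF p] N_bound q_bound p by linarith+
    show "wp L W ?body (\<lambda>(R', A', t'). R' vP = p \<and> A' aNextB = A aNextB \<and>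
        ?I (ds @ [p]) (R'(vH := A aNextB p), A', t' + 7)) (R'(vP := p), A', t' + 7)"
      using I ids by (simp add: A') (auto simp: not_less)
  qed (use assms in \<open>auto\<close>)
  show ?thesis
    unfolding mark_good_def walk_bucket_def wp_Seq wp_Assign
    by (intro conjI wp_state_cong[OF loop]) (use assms in simp_all)
qed

lemma wp_reset_counts:
  assumes "regs_ok R" "trie_arrays A" "R vB = b" "b < L" "chain (A aNextB) (A aHeadB b) (bucket b)"
    and cnt: "\<And>i. 0 < A aCnt i \<Longrightarrow> \<exists>p\<in>set (bucket b). T aSub p = i"
  shows "wp L W reset_counts (\<lambda>(R', A', t'). unchanged {vH, vP, vT, vS} R R' \<and>
    unchanged_except aCnt A A' \<and> A' aCnt = (\<lambda>_. 0) \<and>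
    t' \<le> t + 20 + 70 * length (bucket b)) (R, A, t)"
    (is "wp L W _ ?Q _")
proof -
  let ?body = "Write aCnt (Ld aSub (Var vP)) (Lit 0)"
  let ?I = "\<lambda>ds (R', A', t'). unchanged {vH, vP, vT, vS} R R' \<and>
    unchanged_except aCnt A A' \<and>
    (\<forall>i. A' aCnt i = (if \<exists>p\<in>set ds. T aSub p = i then 0 else A aCnt i)) \<and>
    t' \<le> t + 10 + 70 * length ds"
  have loop: "wp L W (walk vH vP aNextB ?body) ?Q (R(vH := A aHeadB b), A, t + 6)"
  proof (rule wp_walk[where I = ?I and ps = "bucket b" and nxt = "A aNextB"])
    show "?I [] (R(vH := A aHeadB b), A, t + 6)" by simp
    show "p < L" if "p \<in> set (bucket b)" for p using bucket_less[OF that] q_bound by simp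
  next
    fix ds p xs R' A' t'
    assume split: "bucket b = ds @ p # xs" and I: "?I ds (R', A', t')" and "A' aNextB = A aNextB"
    have p: "p < q" using bucket_less[of p b] split by simp
    have A': "A' aSub = T aSub" "A' aNextB = A aNextB"
      using I trie_arraysD[OF assms(2)] by simp_all
    have ids: "T aSub p < L" "p < L"
      using pair_less[OF p] N_bound q_bound p by linarith+
    show "wp L W ?body (\<lambda>(R', A', t'). R' vP = p \<and> A' aNextB = A aNextB \<and>
        ?I (ds @ [p]) (R'(vH := A aNextB p), A', t' + 7)) (R'(vP := p), A', t' + 7)"
      using I ids by (simp add: A')
  next
    fix R' A' t'
    assume I: "?I (bucket b) (R', A', t')"
    have "A' aCnt i = 0" for i using I cnt[of i] by auto
    then have "A' aCnt = (\<lambda>_. 0)" by auto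
    then show "?Q (R', A', t' + 4)" using I by simp
  qed (use assms in \<open>simp_all\<close>)
  show ?thesis
    unfolding reset_counts_def walk_bucket_def wp_Seq wp_Assign
    by (intro conjI wp_state_cong[OF loop]) (use assms in simp_all)
qed

end

text \<open>Once \<open>a\<close> exceeds the cap, so does its product with a positive factor. Hence
  capping every intermediate product in the computation of \<open>nu\<close> has the same effect as
  capping the result.\<close>

lemma min_mult_left: "0 < b \<Longrightarrow> min c (min c a * b) = min c (a * b :: nat)"
proof -
  assume "0 < b"
  then have "a \<le> a * b" "c \<le> c * b" by simp_all
  show ?thesis
  proof (cases "a \<le> c")
    case False
    then have "c \<le> a * b" using \<open>a \<le> a * b\<close> by linarith
    then show ?thesis using False \<open>c \<le> c * b\<close> by (simp only: min_absorb1 nat_le_linear min.absorb1 not_le less_imp_le)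
  qed (simp add: min_absorb2)
qed

lemma min_mult_right: "0 < a \<Longrightarrow> min c (a * min c b) = min c (a * b :: nat)"
  using min_mult_left[of a c b] by (simp add: mult.commute)

lemma nu_Suc: "nu k (Suc r) = nu k r * Suc r * (k + 1)"
  by (simp add: nu_def algebra_simps)

section \<open>Identifiers as names of subsets of \<open>U\<close>\<close>

locale kernel_family = kernel_trie +
  fixes e :: "nat \<Rightarrow> 'a" and U :: "'a set" and F :: "'a set set"
  assumes e_inj: "inj_on e {..<m}"
    and U: "U = e ` {..<m}"
    and F: "F = (\<lambda>E. e ` ES E) ` {..<n}"
begin

definition X :: "nat \<Rightarrow> 'a set" where
  "X i = e ` st i"

lemma ES_subset: "ES E \<subseteq> {..<m}"
  unfolding ES_def using word_less by auto

lemma st_subset: "i < N \<Longrightarrow> st i \<subseteq> {..<m}"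
  using covered ES_subset by (meson subset_trans)

lemma hitting_set: "hitting_set_instance d U F"
  unfolding hitting_set_instance_def U F using ES_subset ES_card inj_on_subset[OF e_inj ES_subset]
  by (auto simp: card_image)

lemma X_subset_U: "i < N \<Longrightarrow> X i \<subseteq> U"
  unfolding X_def U using st_subset by blast

lemma card_X: "i < N \<Longrightarrow> card (X i) = T aSize i"
  unfolding X_def using inj_on_subset[OF e_inj st_subset] by (simp add: card_image size_st)

lemma X_subset_iff: "\<lbrakk>i < N; j < N\<rbrakk> \<Longrightarrow> X i \<subseteq> X j \<longleftrightarrow> st i \<subseteq> st j"
proof
  assume ij: "i < N" "j < N" and sub: "X i \<subseteq> X j"
  show "st i \<subseteq> st j"
  proof
    fix x assume x: "x \<in> st i"
    then obtain y where "y \<in> st j" "e x = e y" using sub unfolding X_def by blast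
    moreover have "x \<in> {..<m}" "y \<in> {..<m}" using x \<open>y \<in> st j\<close> st_subset ij by blast+
    ultimately show "x \<in> st j" using e_inj by (metis inj_onD)
  qed
qed (auto simp: X_def)

lemma X_eq_iff: "\<lbrakk>i < N; j < N\<rbrakk> \<Longrightarrow> X i = X j \<longleftrightarrow> i = j"
  using X_subset_iff trieD(3)[OF tr] by (metis inj_on_contraD lessThan_iff set_eq_subset)

lemma X_in_F: "i < N \<Longrightarrow> X i \<in> F \<longleftrightarrow> (\<exists>E<n. i = T aCur E)"
proof -
  assume i: "i < N"
  have "X i = e ` ES E \<longleftrightarrow> i = T aCur E" if "E < n" for E
    using X_eq_iff[OF i, of "T aCur E"] cur[OF that] by (simp add: X_def)
  then show ?thesis unfolding F by auto
qed

lemma X_surj: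
  assumes "S \<subseteq> E" "E \<in> F"
  obtains i where "i < N" "X i = S"
proof -
  obtain E' where E': "E' < n" "S \<subseteq> e ` ES E'" using assms F by auto
  then obtain Y where Y: "Y \<subseteq> ES E'" "S = e ` Y" by (meson subset_imageE)
  then obtain i where "i < N" "st i = Y"
    using trie_subset_id[OF tr, of "T aCur E'" Y] cur[OF E'(1)] by auto
  then show ?thesis using that Y(2) by (auto simp: X_def)
qed

lemma lr_good_id:
  assumes "lr_good d k U F l r S"
  obtains i where "i < N" "X i = S"
  using lr_good_closed[OF assms] X_surj by blast

definition arrays_ok :: "'a set set \<Rightarrow> 'a set set \<Rightarrow> (nat \<Rightarrow> nat \<Rightarrow> nat) \<Rightarrow> bool" where
  "arrays_ok G D A \<longleftrightarrow> trie_arrays A \<and> (\<forall>b. chain (A aNextB) (A aHeadB b) (bucket b)) \<and> A aCnt = (\<lambda>_. 0) \<and>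
    A aNonmin = (\<lambda>_. 0) \<and> A aMark = (\<lambda>_. 0) \<and>
    (\<forall>i<N. 0 < A aGood i \<longleftrightarrow> X i \<in> G) \<and> (\<forall>i<N. 0 < A aDead i \<longleftrightarrow> X i \<in> D)"

abbreviation (input) "round_ok l r \<equiv> arrays_ok (good_upto d k U F l r) (dead_upto d k U F l r)"
abbreviation (input) "size_ok l \<equiv> arrays_ok (good_from d k U F l) (dead_from d k U F l)"

text \<open>Mapping a counted pair to its owner is a bijection onto the strong supersets: every good
  set has an identifier, and every inclusion between identified sets is recorded as exactly one
  pair.\<close>

lemma count_eq:
  assumes ok: "round_ok l r A"
    and l: "l + Suc r \<le> d" and i: "i < N" "T aSize i = l"
  shows "length (filter (\<lambda>p. T aSub p = i \<and> 0 < A aGood (T aOwn p) \<and> A aDead (T aOwn p) = 0)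
      (bucket (key l (Suc r)))) = card {T'. T' \<subseteq> U \<and> X i \<subseteq> T' \<and> card T' = l + Suc r \<and>
      T' \<in> good_upto d k U F l r \<and> T' \<notin> dead_upto d k U F l r}"
    (is "length (filter ?P ?ps) = card ?R")
proof -
  have set_ps: "set ?ps = {p. p < q \<and> T aSize (T aSub p) = l \<and> T aSize (T aOwn p) = l + Suc r}"
    using l by (intro set_bucket) auto
  have "length (filter ?P ?ps) = card {p \<in> set ?ps. ?P p}"
    unfolding set_filter[symmetric]
    by (rule distinct_card[symmetric, OF distinct_filter[OF bucket_distinct]])
  also have "bij_betw (\<lambda>p. X (T aOwn p)) {p \<in> set ?ps. ?P p} ?R"
    unfolding bij_betw_def
  proof
    show "inj_on (\<lambda>p. X (T aOwn p)) {p \<in> set ?ps. ?P p}"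
      using pair_inj X_eq_iff pair_less(1) unfolding set_ps by (auto intro!: inj_onI)
    show "(\<lambda>p. X (T aOwn p)) ` {p \<in> set ?ps. ?P p} = ?R"
    proof (intro equalityI subsetI)
      fix S assume "S \<in> (\<lambda>p. X (T aOwn p)) ` {p \<in> set ?ps. ?P p}"
      then obtain p where p: "p < q" "T aSize (T aOwn p) = l + Suc r" "T aSub p = i" "0 < A aGood (T aOwn p)"
        "A aDead (T aOwn p) = 0" "S = X (T aOwn p)" unfolding set_ps by auto
      note own = pair_less[OF p(1)]
      have "X i \<subseteq> S" using X_subset_iff[OF i(1) own(1)] own(3) p(3,6) by simp
      moreover have "S \<in> good_upto d k U F l r" "S \<notin> dead_upto d k U F l r"
        using ok own(1) p(4-6) unfolding arrays_ok_def by auto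
      ultimately show "S \<in> ?R" using X_subset_U[OF own(1)] card_X[OF own(1)] p(2,6) by simp
    next
      fix S assume S: "S \<in> ?R"
      then obtain l' r' where "lr_good d k U F l' r' S" unfolding good_upto_def good_from_def by blast
      then obtain j where j: "j < N" "X j = S" by (rule lr_good_id)
      have "st i \<subseteq> st j" using S j X_subset_iff[OF i(1) j(1)] by simp
      then obtain p where p: "p < q" "T aOwn p = j" "T aSub p = i" by (rule pair_exists[OF i(1) j(1)])
      have "T aSize j = l + Suc r" using card_X[OF j(1)] S j(2) by simp
      moreover have "0 < A aGood j" "A aDead j = 0" using ok S j unfolding arrays_ok_def by auto
      ultimately have "p \<in> {p \<in> set ?ps. ?P p}" using p i(2) unfolding set_ps by simp
      then show "S \<in> (\<lambda>p. X (T aOwn p)) ` {p \<in> set ?ps. ?P p}" using p(2) j(2) by blast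
    qed
  qed
  ultimately show ?thesis by (simp add: bij_betw_same_card)
qed

text \<open>The division decides whether \<open>R x * R y\<close> exceeds \<open>L\<close> without
  forming the product, which might leave the word range.\<close>

lemma wp_times_capped:
  assumes "R vL = L" "0 < R y" "x \<noteq> vL"
    and Q: "\<And>t'. t' \<le> t + 10 \<Longrightarrow> Q (R(x := min L (R x * R y)), A, t')"
  shows "wp L W (times_capped x y) Q (R, A, t)"
proof -
  have "L div R y < R x \<longleftrightarrow> L < R x * R y"
    using assms(2) by (rule div_less_iff_less_mult)
  moreover have "R x * R y < W" if "\<not> L < R x * R y" using that bounds by linarith
  moreover have "min L (R x * R y) = (if L < R x * R y then L else R x * R y)" by (simp add: min_def)
  ultimately show ?thesis
    using assms(1) Q[of "t + 7"] Q[of "t + 10"] unfolding times_capped_def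
    by (auto simp: eval_nat_numeral)
qed

lemma wp_good_round:
  assumes "regs_ok R" and ok: "round_ok l r A"
    and R: "R vSz = l" "R vR = r" "R vNu = min L (nu k r)" "R vKK = min L (k + 1)"
    and l: "1 \<le> l" "l + Suc r \<le> d"
  shows "wp L W good_round (\<lambda>(R', A', t'). unchanged {vH, vP, vT, vS, vB, vNu, vR} R R' \<and>
    R' vR = Suc r \<and> R' vNu = min L (nu k (Suc r)) \<and>
    round_ok l (Suc r) A' \<and>
    t' \<le> t + 200 + 210 * length (bucket (key l (Suc r)))) (R, A, t)"
    (is "wp L W _ ?Q _")
proof -
  define b where "b = key l (Suc r)"
  define v where "v = min L (nu k (Suc r))"
  have set_b: "set (bucket b) = {p. p < q \<and> T aSize (T aSub p) = l \<and> T aSize (T aOwn p) = l + Suc r}"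
    unfolding b_def using l by (intro set_bucket) auto
  have bL: "b < L" unfolding b_def using l by (intro key_less) auto
  define cnt where "cnt i = length (filter (\<lambda>p. T aSub p = i \<and> 0 < A aGood (T aOwn p) \<and> A aDead (T aOwn p) = 0)
      (bucket b))" for i
  \<comment> \<open>Positivity matters: a set without a pair in the bucket is never inspected, so a
    count of 0 must not reach the threshold.\<close>
  have v_pos: "0 < v" using bounds nu_pos[of k "Suc r"] by (simp add: v_def)
  have cnt_L: "cnt i < L" for i
  proof -
    have "cnt i \<le> length (bucket b)" unfolding cnt_def by (rule length_filter_le)
    also have "\<dots> \<le> q" using length_filter_le[of _ "[0..<q]"] by (simp add: bucket_def)
    finally show ?thesis using q_bound by linarith
  qed
  have cnt_pair: "\<exists>p\<in>set (bucket b). T aSub p = i" if "0 < cnt i" for i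
    using that unfolding cnt_def by (auto simp: filter_empty_conv)
  have good_i: "(\<exists>p\<in>set (bucket b). T aSub p = i \<and> v \<le> cnt i) \<longleftrightarrow> lr_good d k U F l (Suc r) (X i)"
    if i: "i < N" for i
  proof (cases "T aSize i = l")
    case True
    have "lr_good d k U F l (Suc r) (X i) \<longleftrightarrow> nu k (Suc r) \<le> cnt i"
      using X_subset_U[OF i] card_X[OF i] True count_eq[OF ok l(2) i True]
      unfolding lr_good_Suc_iff[OF hitting_set l] cnt_def b_def by simp
    \<comment> \<open>A count never reaches \<open>L\<close>, so comparing it with the capped
      threshold gives the same answer.\<close>
    also have "\<dots> \<longleftrightarrow> v \<le> cnt i" using cnt_L[of i] by (auto simp: v_def)
    finally show ?thesis using cnt_pair[of i] v_pos by auto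
  next
    case False
    then show ?thesis using lr_good_card(2)[OF hitting_set] card_X[OF i] unfolding set_b by auto
  qed
  have dead_j: "(\<exists>p\<in>set (bucket b). T aOwn p = j \<and> v \<le> cnt (T aSub p)) \<longleftrightarrow>
      l + Suc r = card (X j) \<and> (\<exists>S\<subseteq>X j. lr_good d k U F l (Suc r) S)"
    if j: "j < N" for j
  proof
    assume "\<exists>p\<in>set (bucket b). T aOwn p = j \<and> v \<le> cnt (T aSub p)"
    then obtain p where p: "p \<in> set (bucket b)" "T aOwn p = j" "v \<le> cnt (T aSub p)" by blast
    then have p': "p < q" "T aSize j = l + Suc r" unfolding set_b by auto
    note own = pair_less[OF p'(1)]
    have "lr_good d k U F l (Suc r) (X (T aSub p))" using good_i[OF own(2)] p by blast
    moreover have "X (T aSub p) \<subseteq> X j" using X_subset_iff[OF own(2,1)] own(3) p(2) by simp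
    ultimately show "l + Suc r = card (X j) \<and> (\<exists>S\<subseteq>X j. lr_good d k U F l (Suc r) S)"
      using card_X[OF j] p'(2) by auto
  next
    assume "l + Suc r = card (X j) \<and> (\<exists>S\<subseteq>X j. lr_good d k U F l (Suc r) S)"
    then obtain S where S: "l + Suc r = T aSize j" "S \<subseteq> X j" "lr_good d k U F l (Suc r) S"
      using card_X[OF j] by auto
    obtain i where i: "i < N" "X i = S" using S(3) by (rule lr_good_id)
    have "st i \<subseteq> st j" using S(2) i X_subset_iff[OF i(1) j] by simp
    then obtain p where p: "p < q" "T aOwn p = j" "T aSub p = i" by (rule pair_exists[OF i(1) j])
    have "T aSize i = l" using card_X[OF i(1)] i(2) lr_good_card(2)[OF hitting_set S(3)] by simp
    then have "p \<in> set (bucket b)" using p S(1) unfolding set_b by simp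
    moreover have "v \<le> cnt i" using good_i[OF i(1)] S(3) i(2) by auto
    ultimately show "\<exists>p\<in>set (bucket b). T aOwn p = j \<and> v \<le> cnt (T aSub p)" using p by blast
  qed
  have Rb: "R vD = d" "R vL = L" using assms(1) by (simp_all add: regs_ok_def base_def)
  have A: "trie_arrays A" "\<And>b. chain (A aNextB) (A aHeadB b) (bucket b)" "A aCnt = (\<lambda>_. 0)"
    using ok unfolding arrays_ok_def by auto
  have passes: "wp L W (count_supersets ;; mark_good ;; reset_counts) ?Q (R1, A, t1)"
    if R1: "unchanged {vB, vNu, vR} R R1" "R1 vB = b" "R1 vNu = v" "R1 vR = Suc r" and t1: "t1 \<le> t + 100"
    for R1 t1
  proof -
    have R1ok: "regs_ok R1" using assms(1) R1 by (simp add: regs_ok_def base_def)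
    show ?thesis unfolding wp_Seq
    proof (rule wp_mono[OF wp_count_supersets[OF R1ok A(1) R1(2) bL A(2,3)]])
      fix R2 A2 t2
      assume "case (R2, A2, t2) of (R', A', t') \<Rightarrow> unchanged {vH, vP, vT, vS} R1 R' \<and>
        unchanged_except aCnt A A' \<and>
        (\<forall>i. A' aCnt i = length (filter (\<lambda>p. T aSub p = i \<and> 0 < A aGood (T aOwn p) \<and> A aDead (T aOwn p) = 0) (bucket b))) \<and>
        t' \<le> t1 + 20 + 70 * length (bucket b)"
      then have s2: "unchanged {vH, vP, vT, vS} R1 R2" "unchanged_except aCnt A A2"
        "\<And>i. A2 aCnt i = cnt i" "t2 \<le> t1 + 20 + 70 * length (bucket b)"
        unfolding cnt_def by auto
      have R2: "regs_ok R2" "R2 vB = b" "R2 vNu = v" using s2(1) R1ok R1 by (simp_all add: regs_ok_def base_def)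
      have A2: "trie_arrays A2" "chain (A2 aNextB) (A2 aHeadB b) (bucket b)"
        using s2(2) A by (auto intro: trie_arrays_frame[OF A(1)])
      show "wp L W mark_good (wp L W reset_counts ?Q) (R2, A2, t2)"
      proof (rule wp_mono[OF wp_mark_good[OF R2(1) A2(1) R2(2) bL A2(2) R2(3)]])
        fix R3 A3 t3
        assume "case (R3, A3, t3) of (R', A', t') \<Rightarrow> unchanged {vH, vP, vT, vS} R2 R' \<and>
          unchanged {aGood, aDead} A2 A' \<and>
          (\<forall>i. 0 < A' aGood i \<longleftrightarrow> 0 < A2 aGood i \<or> (\<exists>p\<in>set (bucket b). T aSub p = i \<and> v \<le> A2 aCnt i)) \<and>
          (\<forall>i. 0 < A' aDead i \<longleftrightarrow> 0 < A2 aDead i \<or> (\<exists>p\<in>set (bucket b). T aOwn p = i \<and> v \<le> A2 aCnt (T aSub p))) \<and>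
          t' \<le> t2 + 20 + 70 * length (bucket b)"
        then have s3: "unchanged {vH, vP, vT, vS} R2 R3" "unchanged {aGood, aDead} A2 A3"
          "\<And>i. 0 < A3 aGood i \<longleftrightarrow> 0 < A aGood i \<or> (\<exists>p\<in>set (bucket b). T aSub p = i \<and> v \<le> cnt i)"
          "\<And>i. 0 < A3 aDead i \<longleftrightarrow> 0 < A aDead i \<or> (\<exists>p\<in>set (bucket b). T aOwn p = i \<and> v \<le> cnt (T aSub p))"
          "t3 \<le> t2 + 20 + 70 * length (bucket b)"
          using s2(2,3) by auto
        have R3: "regs_ok R3" "R3 vB = b" using s3(1) R2 by (simp_all add: regs_ok_def base_def)
        have A3: "trie_arrays A3" "chain (A3 aNextB) (A3 aHeadB b) (bucket b)"
          using s3(2) A2 by (auto intro: trie_arrays_frame[OF A2(1)])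
        have c3: "\<exists>p\<in>set (bucket b). T aSub p = i" if "0 < A3 aCnt i" for i
          using that cnt_pair s3(2) s2(3) by simp
        show "wp L W reset_counts ?Q (R3, A3, t3)"
        proof (rule wp_mono[OF wp_reset_counts[OF R3(1) A3(1) R3(2) bL A3(2) c3]])
          fix R4 A4 t4
          assume "case (R4, A4, t4) of (R', A', t') \<Rightarrow> unchanged {vH, vP, vT, vS} R3 R' \<and>
            unchanged_except aCnt A3 A' \<and> A' aCnt = (\<lambda>_. 0) \<and> t' \<le> t3 + 20 + 70 * length (bucket b)"
          then have s4: "unchanged {vH, vP, vT, vS} R3 R4" "unchanged_except aCnt A3 A4"
            "A4 aCnt = (\<lambda>_. 0)" "t4 \<le> t3 + 20 + 70 * length (bucket b)" by auto
          have "trie_arrays A4" using s4(2) by (auto intro: trie_arrays_frame[OF A3(1)])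
          moreover have fixed: "A4 aNonmin = (\<lambda>_. 0)" "A4 aMark = (\<lambda>_. 0)"
            using s4(2) s3(2) s2(2) ok unfolding arrays_ok_def by simp_all
          moreover have "chain (A4 aNextB) (A4 aHeadB b') (bucket b')" for b'
            using s4(2) s3(2) s2(2) A(2) by simp
          moreover have "0 < A4 aGood i \<longleftrightarrow> X i \<in> good_upto d k U F l (Suc r)" if i: "i < N" for i
            using s4(2) s3(3)[of i] good_i[OF i] ok i unfolding arrays_ok_def good_upto_Suc by simp
          moreover have "0 < A4 aDead i \<longleftrightarrow> X i \<in> dead_upto d k U F l (Suc r)" if i: "i < N" for i
            using s4(2) s3(4)[of i] dead_j[OF i] ok i unfolding arrays_ok_def dead_upto_Suc by simp
          ultimately have "round_ok l (Suc r) A4"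
            unfolding arrays_ok_def using s4(3) fixed by blast
          moreover have "unchanged {vH, vP, vT, vS, vB, vNu, vR} R R4" "R4 vR = Suc r" "R4 vNu = v"
            using s4(1) s3(1) s2(1) R1 by simp_all
          moreover have "t4 \<le> t + 200 + 210 * length (bucket b)" using t1 s2(4) s3(5) s4(4) by linarith
          ultimately show "?Q (R4, A4, t4)" unfolding b_def v_def by blast
        qed
      qed
    qed
  qed
  have key_eq: "(d - l) * (d + 1) + Suc r = b" by (simp add: b_def key_def)
  have small: "Suc r < W" "(d - l) * (d + 1) < W" "b < W" "d + 1 < W" "l \<le> d"
    using l bounds bL key_eq by linarith+
  have v_eq2: "min L (min L (min L (nu k r) * Suc r) * min L (k + 1)) = v"
  proof -
    have "min L (min L (nu k r) * Suc r) = min L (nu k r * Suc r)" by (rule min_mult_left) simp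
    then have "min L (min L (min L (nu k r) * Suc r) * min L (k + 1)) =
        min L (min L (nu k r * Suc r) * min L (k + 1))" by simp
    also have "\<dots> = min L (nu k r * Suc r * min L (k + 1))" using bounds by (intro min_mult_left) simp
    also have "\<dots> = v" unfolding v_def nu_Suc using nu_pos[of k r] by (intro min_mult_right) simp
    finally show ?thesis .
  qed
  define R1 where "R1 = R(vR := Suc r)"
  define R2 where "R2 = R1(vNu := min L (min L (nu k r) * Suc r))"
  define R3 where "R3 = R2(vNu := v)"
  have R1_vals: "R1 vNu = min L (nu k r)" "R1 vR = Suc r"
    using R by (simp_all add: R1_def)
  have R2_vals: "R2 vNu = min L (min L (nu k r) * Suc r)" "R2 vKK = min L (k + 1)"
    using R by (simp_all add: R2_def R1_def)
  have r3: "wp L W (vB ::= Plus (Times (Minus (Var vD) (Var vSz)) (Plus (Var vD) (Lit 1))) (Var vR) ;;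
      count_supersets ;; mark_good ;; reset_counts) ?Q (R3, A, t3)" if t3: "t3 \<le> t + 50" for t3
  proof -
    have eq: "R3 vD = d" "R3 vSz = l" "R3 vR = Suc r"
      using Rb R by (simp_all add: R3_def R2_def R1_def)
    have "wp L W (count_supersets ;; mark_good ;; reset_counts) ?Q (R3(vB := b), A, t3 + 10)"
      using t3 by (intro passes) (simp_all add: R3_def R2_def R1_def)
    note * = this[unfolded wp_Seq]
    show ?thesis
      unfolding wp_Seq wp_Assign
      by (intro conjI wp_state_cong[OF *])
        (use small key_eq in \<open>simp_all add: eq del: One_nat_def mult_Suc_right add_mult_distrib2\<close>)
  qed
  have r2: "wp L W (times_capped vNu vKK) (wp L W (vB ::= Plus (Times (Minus (Var vD) (Var vSz)) (Plus (Var vD) (Lit 1))) (Var vR) ;;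
      count_supersets ;; mark_good ;; reset_counts) ?Q) (R2, A, t2)" if t2: "t2 \<le> t + 40" for t2
  proof (rule wp_times_capped)
    show "R2 vL = L" using Rb by (simp add: R2_def R1_def)
    show "0 < R2 vKK" using R bounds by (simp add: R2_def R1_def)
    fix t' assume "t' \<le> t2 + 10"
    then have "t' \<le> t + 50" using t2 by simp
    from r3[OF this] have r: "wp L W (vB ::= Plus (Times (Minus (Var vD) (Var vSz)) (Plus (Var vD) (Lit 1))) (Var vR) ;;
      count_supersets ;; mark_good ;; reset_counts) ?Q (R3, A, t')" .
    show "wp L W (vB ::= Plus (Times (Minus (Var vD) (Var vSz)) (Plus (Var vD) (Lit 1))) (Var vR) ;;
      count_supersets ;; mark_good ;; reset_counts) ?Q (R2(vNu := min L (R2 vNu * R2 vKK)), A, t')"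
      unfolding R2_vals v_eq2 using r unfolding R3_def .
  qed simp
  have r1: "wp L W (times_capped vNu vR) (wp L W (times_capped vNu vKK) (wp L W (vB ::= Plus (Times (Minus (Var vD) (Var vSz)) (Plus (Var vD) (Lit 1))) (Var vR) ;;
      count_supersets ;; mark_good ;; reset_counts) ?Q)) (R1, A, t + 4)"
  proof (rule wp_times_capped)
    show "R1 vL = L" using Rb by (simp add: R1_def)
    show "0 < R1 vR" by (simp add: R1_def)
    fix t' assume "t' \<le> t + 4 + 10"
    then have "t' \<le> t + 40" by simp
    from r2[OF this] show "wp L W (times_capped vNu vKK) (wp L W (vB ::= Plus (Times (Minus (Var vD) (Var vSz)) (Plus (Var vD) (Lit 1))) (Var vR) ;;
      count_supersets ;; mark_good ;; reset_counts) ?Q) (R1(vNu := min L (R1 vNu * R1 vR)), A, t')"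
      unfolding R1_vals R2_def .
  qed simp
  show ?thesis
    unfolding good_round_def wp_Seq[of _ _ "vR ::= _"] wp_Seq[of _ _ "times_capped _ _"] wp_Assign[of _ _ vR]
    by (intro conjI wp_state_cong[OF r1]) (use R small in \<open>auto simp: R1_def\<close>)
qed

text \<open>The potential for the bucket walks: passing from key \<open>b\<close> to
  \<open>Suc b\<close> adds exactly the length of bucket \<open>b\<close>, and the total never
  exceeds \<open>q\<close>.\<close>

definition pairs_below :: "nat \<Rightarrow> nat" where
  "pairs_below b = card {p. p < q \<and> pair_key p < b}"

lemma pairs_below_le: "pairs_below b \<le> q"
proof -
  have "pairs_below b \<le> card {..<q}" unfolding pairs_below_def by (intro card_mono) auto
  then show ?thesis by simp
qed

lemma pairs_below_mono: "b \<le> b' \<Longrightarrow> pairs_below b \<le> pairs_below b'"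
  unfolding pairs_below_def by (intro card_mono) auto

lemma pairs_below_Suc: "pairs_below (Suc b) = pairs_below b + length (bucket b)"
proof -
  have "{p. p < q \<and> pair_key p < Suc b} = {p. p < q \<and> pair_key p < b} \<union> set (bucket b)"
    by (auto simp: bucket_def)
  moreover have "card (set (bucket b)) = length (bucket b)"
    by (rule distinct_card[OF bucket_distinct])
  moreover have "{p. p < q \<and> pair_key p < b} \<inter> set (bucket b) = {}" by (auto simp: bucket_def)
  ultimately show ?thesis unfolding pairs_below_def by (simp add: card_Un_disjoint)
qed

text \<open>Each key passed pays 300 steps for the fixed cost of a round, and each pair pays 210
  steps, 70 for each of the three passes over its bucket.\<close>

lemma wp_good_rounds:
  assumes "regs_ok R" and ok: "size_ok (Suc l) A"
    and R: "R vSz = l" "R vR = 0" "R vNu = 1" "R vKK = min L (k + 1)" "R vE = d - l"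
    and l: "1 \<le> l" "l < d"
    and t: "t \<le> t0 + 300 * key l 1 + 210 * pairs_below (key l 1)"
  shows "wp L W (While (Less (Var vR) (Var vE)) good_round) (\<lambda>(R', A', t').
    unchanged {vH, vP, vT, vS, vB, vNu, vR} R R' \<and>
    size_ok l A' \<and>
    t' \<le> t0 + 4 + 300 * key l (Suc (d - l)) + 210 * pairs_below (key l (Suc (d - l)))) (R, A, t)"
    (is "wp L W _ ?Q _")
proof -
  let ?I = "\<lambda>r (R', A', t'). unchanged {vH, vP, vT, vS, vB, vNu, vR} R R' \<and>
        R' vR = r \<and> R' vNu = min L (nu k r) \<and>
        round_ok l r A' \<and>
        t' \<le> t0 + 300 * key l (Suc r) + 210 * pairs_below (key l (Suc r))"
  show ?thesis
  proof (rule wp_While_count[where I = ?I and i = 0 and n = "d - l"])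
    show "?I 0 (R, A, t)"
      using ok R t l bounds by (simp add: good_upto_0 dead_upto_0 nu_def)
  next
    fix r R1 A1 t1
    assume I: "?I r (R1, A1, t1)"
      and r: "r < d - l"
    have I1: "unchanged {vH, vP, vT, vS, vB, vNu, vR} R R1" "R1 vR = r" "R1 vNu = min L (nu k r)"
      "round_ok l r A1"
      "t1 \<le> t0 + 300 * key l (Suc r) + 210 * pairs_below (key l (Suc r))" using I by auto
    have R1: "regs_ok R1" "R1 vSz = l" "R1 vKK = min L (k + 1)" "R1 vE = d - l"
      using I1(1) assms(1) R by (simp_all add: regs_ok_def base_def)
    have lr: "l + Suc r \<le> d" using r by simp
    have body: "wp L W good_round (\<lambda>(R', A', t'). ?I (Suc r) (R', A', t' + 1)) (R1, A1, t1 + 3)"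
    proof (rule wp_mono[OF wp_good_round[OF R1(1) I1(4) R1(2) I1(2,3) R1(3) l(1) lr]])
      fix R2 A2 t2
      assume "case (R2, A2, t2) of (R', A', t') \<Rightarrow> unchanged {vH, vP, vT, vS, vB, vNu, vR} R1 R' \<and>
        R' vR = Suc r \<and> R' vNu = min L (nu k (Suc r)) \<and>
        round_ok l (Suc r) A' \<and>
        t' \<le> t1 + 3 + 200 + 210 * length (bucket (key l (Suc r)))"
      then have s: "unchanged {vH, vP, vT, vS, vB, vNu, vR} R1 R2" "R2 vR = Suc r"
        "R2 vNu = min L (nu k (Suc r))" "round_ok l (Suc r) A2"
        "t2 \<le> t1 + 203 + 210 * length (bucket (key l (Suc r)))" by auto
      have "key l (Suc (Suc r)) = Suc (key l (Suc r))" by (simp add: key_def)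
      then have "t2 + 1 \<le> t0 + 300 * key l (Suc (Suc r)) + 210 * pairs_below (key l (Suc (Suc r)))"
        using s(5) I1(5) by (simp add: pairs_below_Suc)
      then show "case (R2, A2, t2) of (R', A', t') \<Rightarrow> ?I (Suc r) (R', A', t' + 1)"
        using s I1(1) by simp
    qed
    show "bok L W (Less (Var vR) (Var vE)) R1 A1 \<and> bval (Less (Var vR) (Var vE)) R1 A1 \<and>
      wp L W good_round (\<lambda>(R', A', t'). ?I (Suc r) (R', A', t' + 1))
        (R1, A1, t1 + bcost (Less (Var vR) (Var vE)) + 1)"
      by (intro conjI wp_state_cong[OF body]) (simp_all add: I1(2) R1(4) r)
  next
    fix R1 A1 t1
    assume "?I (d - l) (R1, A1, t1)"
    then show "bok L W (Less (Var vR) (Var vE)) R1 A1 \<and> \<not> bval (Less (Var vR) (Var vE)) R1 A1 \<and>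
      ?Q (R1, A1, t1 + bcost (Less (Var vR) (Var vE)) + 2)"
      using R(5) l(2) by (simp add: good_upto_last dead_upto_last)
  qed simp
qed

lemma wp_find_good:
  assumes "regs_ok R" and ok: "arrays_ok F {} A"
  shows "wp L W find_good (\<lambda>(R', A', t'). regs_ok R' \<and>
    (\<exists>D. arrays_ok {S. good d k U F S} D A') \<and> t' \<le> t + 50 + 1200 * (3 ^ d * n) + 210 * q) (R, A, t)"
    (is "wp L W _ ?Q _")
proof -
  let ?body = "vSz ::= Minus (Var vSz) (Lit 1) ;; vNu ::= Lit 1 ;; vR ::= Lit 0 ;;
      vE ::= Minus (Var vD) (Var vSz) ;; While (Less (Var vR) (Var vE)) good_round"
  define t0 where "t0 = t + 30"
  let ?I = "\<lambda>c (R', A', t'). regs_ok R' \<and> R' vKK = min L (k + 1) \<and> R' vSz = d - c \<and>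
      size_ok (d - c) A' \<and>
      t' \<le> t0 + 300 * ((c + 1) * (d + 1)) + 210 * pairs_below ((c + 1) * (d + 1))"
  have loop: "wp L W (While (Less (Lit 1) (Var vSz)) ?body) ?Q (R1, A, t1)"
    if R1: "regs_ok R1" "R1 vKK = min L (k + 1)" "R1 vSz = d" and t1: "t1 \<le> t0" for R1 t1
  proof (rule wp_While_count[where I = ?I and i = 0 and n = "d - 1"])
    show "?I 0 (R1, A, t1)" using R1 t1 ok by (simp add: good_from_d dead_from_d)
  next
    fix c R2 A2 t2
    assume I: "?I c (R2, A2, t2)" and c: "c < d - 1"
    define l where "l = d - Suc c"
    have l: "1 \<le> l" "l < d" "Suc l = d - c" "d - l = Suc c" "d - c - 1 = l"
      using c by (auto simp: l_def)
    have R2: "regs_ok R2" "R2 vKK = min L (k + 1)" "R2 vSz = Suc l" "R2 vD = d"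
      and A2: "size_ok (Suc l) A2"
      and t2: "t2 \<le> t0 + 300 * ((c + 1) * (d + 1)) + 210 * pairs_below ((c + 1) * (d + 1))"
      using I l(3) by (simp_all add: regs_ok_def base_def)
    define R3 where "R3 = R2(vSz := l, vNu := 1, vR := 0, vE := d - l)"
    have R3: "regs_ok R3" "R3 vSz = l" "R3 vR = 0" "R3 vNu = 1" "R3 vKK = min L (k + 1)" "R3 vE = d - l"
      using R2 by (simp_all add: R3_def regs_ok_def base_def)
    \<comment> \<open>\<open>z\<close> is \<open>key l 0\<close> and \<open>z'\<close> is the same
      boundary one level further down; the keys in between belong to level \<open>l\<close>.\<close>
    define z where "z = (c + 1) * (d + 1)"
    define z' where "z' = (Suc c + 1) * (d + 1)"
    have k1: "key l 1 = z + 1" using l by (simp add: key_def z_def)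
    have "pairs_below z \<le> pairs_below (key l 1)" unfolding k1 by (intro pairs_below_mono) simp
    moreover have "t2 \<le> t0 + 300 * z + 210 * pairs_below z" using t2 by (simp only: z_def)
    ultimately have t3: "t2 + 15 \<le> t0 + 300 * key l 1 + 210 * pairs_below (key l 1)"
      using k1 by linarith
    have k2: "key l (Suc (d - l)) + 1 \<le> z'"
    proof -
      have "key l (Suc (d - l)) = z + (c + 2)" using l by (simp add: key_def z_def)
      moreover have "z' = z + (d + 1)" by (simp add: z_def z'_def)
      ultimately show ?thesis using c by linarith
    qed
    have inner: "wp L W (While (Less (Var vR) (Var vE)) good_round) (\<lambda>(R', A', t'). ?I (Suc c) (R', A', t' + 1))
        (R3, A2, t2 + 15)"
    proof (rule wp_mono[OF wp_good_rounds[OF R3(1) A2 R3(2-6) l(1,2) t3]])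
      fix R4 A4 t4
      assume "case (R4, A4, t4) of (R', A', t') \<Rightarrow>
        unchanged {vH, vP, vT, vS, vB, vNu, vR} R3 R' \<and>
        size_ok l A' \<and>
        t' \<le> t0 + 4 + 300 * key l (Suc (d - l)) + 210 * pairs_below (key l (Suc (d - l)))"
      then have s: "unchanged {vH, vP, vT, vS, vB, vNu, vR} R3 R4"
        "size_ok l A4"
        "t4 \<le> t0 + 4 + 300 * key l (Suc (d - l)) + 210 * pairs_below (key l (Suc (d - l)))" by auto
      have "pairs_below (key l (Suc (d - l))) \<le> pairs_below z'"
        using k2 by (intro pairs_below_mono) simp
      then have "t4 + 1 \<le> t0 + 300 * z' + 210 * pairs_below z'"
        using s(3) k2 by linarith
      moreover have "regs_ok R4" "R4 vKK = min L (k + 1)" "R4 vSz = l"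
        using s(1) R3 by (simp_all add: regs_ok_def base_def)
      ultimately show "case (R4, A4, t4) of (R', A', t') \<Rightarrow> ?I (Suc c) (R', A', t' + 1)"
        using s(2) unfolding z'_def l_def by simp
    qed
    have body: "wp L W ?body (\<lambda>(R', A', t'). ?I (Suc c) (R', A', t' + 1)) (R2, A2, t2 + 3)"
      unfolding wp_Seq wp_Assign
      by (intro conjI wp_state_cong[OF inner]) (use R2 l in \<open>simp_all add: R3_def\<close>)
    show "bok L W (Less (Lit 1) (Var vSz)) R2 A2 \<and> bval (Less (Lit 1) (Var vSz)) R2 A2 \<and>
      wp L W ?body (\<lambda>(R', A', t'). ?I (Suc c) (R', A', t' + 1)) (R2, A2, t2 + bcost (Less (Lit 1) (Var vSz)) + 1)"
      by (intro conjI wp_state_cong[OF body]) (use l(1) in \<open>simp_all add: R2(3)\<close>)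
  next
    fix R2 A2 t2
    assume I: "?I (d - 1) (R2, A2, t2)"
    \<comment> \<open>The last key boundary is at most \<open>4 * (3 ^ d * n)\<close>; 300 steps per
      key give the constant 1200.\<close>
    have "(d - 1 + 1) * (d + 1) \<le> (d + 1) * (d + 1)" by (intro mult_le_mono1) simp
    then have "(d - 1 + 1) * (d + 1) \<le> 4 * (3 ^ d * n)" using pow3_ge(4) by linarith
    then have "t2 + 4 \<le> t + 50 + 1200 * (3 ^ d * n) + 210 * q"
      using I pairs_below_le[of "(d - 1 + 1) * (d + 1)"] unfolding t0_def by simp
    moreover have "good_from d k U F (d - (d - 1)) = {S. good d k U F S}"
      using good_iff[OF hitting_set, of "d - (d - 1)" k] by auto
    moreover have "R2 vSz \<le> 1" using I by simp
    ultimately show "bok L W (Less (Lit 1) (Var vSz)) R2 A2 \<and> \<not> bval (Less (Lit 1) (Var vSz)) R2 A2 \<and>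
      ?Q (R2, A2, t2 + bcost (Less (Lit 1) (Var vSz)) + 2)"
      using I by auto
  qed simp
  have Rk: "R vK = k" "R vL = L" "R vD = d" using assms(1) by (simp_all add: regs_ok_def base_def)
  have kk: "k < L \<Longrightarrow> k + 1 < W" "min L (k + 1) = (if k < L then k + 1 else L)"
    using bounds by (auto simp: min_def)
  define R1 where "R1 = R(vKK := min L (k + 1), vSz := d)"
  have R1: "regs_ok R1" "R1 vKK = min L (k + 1)" "R1 vSz = d"
    using assms(1) by (simp_all add: R1_def regs_ok_def base_def)
  have l1: "wp L W (While (Less (Lit 1) (Var vSz)) ?body) ?Q (R1, A, t + 9)"
    and l2: "wp L W (While (Less (Lit 1) (Var vSz)) ?body) ?Q (R1, A, t + 8)"
    by (rule loop[OF R1], simp add: t0_def)+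
  show ?thesis
    unfolding find_good_def wp_Seq[of _ _ "Cond _ _ _"] wp_Seq[of _ _ "vSz ::= Var _"]
  proof (rule wp_CondI)
    assume "bval (Less (Var vK) (Var vL)) R A"
    then have "k < L" using Rk by simp
    then show "wp L W (vKK ::= Plus (Var vK) (Lit 1)) (wp L W (vSz ::= Var vD)
        (wp L W (While (Less (Lit 1) (Var vSz)) ?body) ?Q)) (R, A, t + bcost (Less (Var vK) (Var vL)) + 1)"
      unfolding wp_Assign
      by (intro conjI wp_state_cong[OF l1]) (use kk in \<open>simp_all add: R1_def Rk\<close>)
  next
    assume "\<not> bval (Less (Var vK) (Var vL)) R A"
    then have "\<not> k < L" using Rk by simp
    then show "wp L W (vKK ::= Var vL) (\<lambda>(R', A', t'). wp L W (vSz ::= Var vD)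
        (wp L W (While (Less (Lit 1) (Var vSz)) ?body) ?Q) (R', A', t' + 1))
        (R, A, t + bcost (Less (Var vK) (Var vL)) + 1)"
      unfolding wp_Assign prod.case
      by (intro conjI wp_state_cong[OF l2]) (use kk in \<open>simp_all add: R1_def Rk\<close>)
  qed simp
qed

end

section \<open>Output of the kernel\<close>

fun path :: "(nat \<Rightarrow> nat) \<Rightarrow> nat \<Rightarrow> nat list \<Rightarrow> bool" where
  "path par x [] \<longleftrightarrow> x = 0"
| "path par x (y # ys) \<longleftrightarrow> x = y \<and> 0 < y \<and> path par (par y) ys"

lemma wp_climb:
  assumes path: "path par (R vX) ys" and par: "A aParent = par"
    and bound: "\<And>y. y \<in> set ys \<Longrightarrow> y < L"
    and init: "I [] (R(vY := R vX), A, t + 2)"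
    and step: "\<And>ds y xs R A t. \<lbrakk>ys = ds @ y # xs; I ds (R, A, t); R vY = y; A aParent = par\<rbrakk> \<Longrightarrow>
      wp L W c (\<lambda>(R', A', t'). R' vY = y \<and> A' aParent = par \<and> I (ds @ [y]) (R'(vY := par y), A', t' + 7))
        (R, A, t + 3)"
    and final: "\<And>R A t. I ys (R, A, t) \<Longrightarrow> Q (R, A, t + 4)"
  shows "wp L W (climb c) Q (R, A, t)"
proof -
  have loop: "wp L W (While (Less (Lit 0) (Var vY)) (c ;; vY ::= Ld aParent (Var vY))) Q (R(vY := R vX), A, t + 2)"
  proof (rule wp_While_list[where xs = ys and
        I = "\<lambda>xs (R, A, t). \<exists>ds. ys = ds @ xs \<and> I ds (R, A, t) \<and> A aParent = par \<and> path par (R vY) xs"])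
    show "case (R(vY := R vX), A, t + 2) of (R, A, t) \<Rightarrow>
        \<exists>ds. ys = ds @ ys \<and> I ds (R, A, t) \<and> A aParent = par \<and> path par (R vY) ys"
      using path par init by simp
  next
    fix y xs R A t
    assume "case (R, A, t) of (R, A, t) \<Rightarrow>
        \<exists>ds. ys = ds @ y # xs \<and> I ds (R, A, t) \<and> A aParent = par \<and> path par (R vY) (y # xs)"
    then obtain ds where ds: "ys = ds @ y # xs" "I ds (R, A, t)" "A aParent = par" "R vY = y" "0 < y"
      "path par (par y) xs" by auto
    have "y < L" using bound ds(1) by simp
    have body: "wp L W (c ;; vY ::= Ld aParent (Var vY)) (\<lambda>(R', A', t'). case (R', A', t' + 1) of (R, A, t) \<Rightarrow>
        \<exists>ds. ys = ds @ xs \<and> I ds (R, A, t) \<and> A aParent = par \<and> path par (R vY) xs) (R, A, t + 3)"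
      unfolding wp_Seq
    proof (rule wp_mono[OF step[OF ds(1,2,4,3)]])
      fix R' A' t'
      assume "case (R', A', t') of (R', A', t') \<Rightarrow>
        R' vY = y \<and> A' aParent = par \<and> I (ds @ [y]) (R'(vY := par y), A', t' + 7)"
      then show "wp L W (vY ::= Ld aParent (Var vY)) (\<lambda>(R', A', t'). case (R', A', t' + 1) of (R, A, t) \<Rightarrow>
        \<exists>ds. ys = ds @ xs \<and> I ds (R, A, t) \<and> A aParent = par \<and> path par (R vY) xs) (R', A', t')"
        using ds(1,6) \<open>y < L\<close> by (auto intro!: exI[of _ "ds @ [y]"] simp: eval_nat_numeral)
    qed
    show "bok L W (Less (Lit 0) (Var vY)) R A \<and> bval (Less (Lit 0) (Var vY)) R A \<and>
      wp L W (c ;; vY ::= Ld aParent (Var vY)) (\<lambda>(R', A', t'). case (R', A', t' + 1) of (R, A, t) \<Rightarrow>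
        \<exists>ds. ys = ds @ xs \<and> I ds (R, A, t) \<and> A aParent = par \<and> path par (R vY) xs)
       (R, A, t + bcost (Less (Lit 0) (Var vY)) + 1)"
      by (intro conjI wp_state_cong[OF body]) (simp_all add: ds(4,5))
  next
    fix R A t
    assume "case (R, A, t) of (R, A, t) \<Rightarrow>
        \<exists>ds. ys = ds @ [] \<and> I ds (R, A, t) \<and> A aParent = par \<and> path par (R vY) []"
    then show "bok L W (Less (Lit 0) (Var vY)) R A \<and> \<not> bval (Less (Lit 0) (Var vY)) R A \<and>
      Q (R, A, t + bcost (Less (Lit 0) (Var vY)) + 2)"
      using final[of R A t] by (auto simp: eval_nat_numeral)
  qed
  show ?thesis
    unfolding climb_def wp_Seq wp_Assign by (intro conjI wp_state_cong[OF loop]) simp_all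
qed

lemma wp_if_kernel:
  assumes x: "R vX = x" "x < L"
    and yes: "\<lbrakk>0 < A aGood x; A aNonmin x = 0\<rbrakk> \<Longrightarrow> wp L W c Q (R, A, t + 14)"
    and no: "\<And>t'. \<lbrakk>\<not> (0 < A aGood x \<and> A aNonmin x = 0); t' \<le> t + 20\<rbrakk> \<Longrightarrow> Q (R, A, t')"
  shows "wp L W (if_kernel c) Q (R, A, t)"
  unfolding if_kernel_def
proof (intro wp_CondI)
  show "wp L W c Q (R, A, t + bcost (Less (Lit 0) (Ld aGood (Var vX))) + 1 +
      bcost (Equal (Ld aNonmin (Var vX)) (Lit 0)) + 1)"
    if "bval (Less (Lit 0) (Ld aGood (Var vX))) R A" "bval (Equal (Ld aNonmin (Var vX)) (Lit 0)) R A"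
    by (rule wp_state_cong[OF yes]) (use that x in simp_all)
qed (use x in \<open>auto intro!: no\<close>)

definition written :: "(nat \<Rightarrow> nat \<Rightarrow> nat) \<Rightarrow> nat list \<Rightarrow> bool" where
  "written A ws \<longleftrightarrow> (\<forall>i<length ws. A aOut i = ws ! i)"

lemma written_snoc:
  "written A ws \<Longrightarrow> written (A(aOut := (A aOut)(length ws := x))) (ws @ [x])"
  unfolding written_def by (simp add: nth_append less_Suc_eq)

section \<open>Marking minimal good sets and writing them out\<close>

context kernel_trie
begin

lemma wp_mark_nonminimal:
  assumes "regs_ok R" "trie_arrays A" "A aNonmin = (\<lambda>_. 0)"
  shows "wp L W mark_nonminimal (\<lambda>(R', A', t'). regs_ok R' \<and> unchanged_except aNonmin A A' \<and>
    (\<forall>i. 0 < A' aNonmin i \<longleftrightarrow> (\<exists>p<q. T aOwn p = i \<and> T aSub p \<noteq> i \<and> 0 < A aGood (T aSub p))) \<and>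
    t' \<le> t + 10 + 60 * q) (R, A, t)"
    (is "wp L W _ ?Q _")
proof -
  let ?body = "Cond (Less (Lit 0) (Ld aGood (Ld aSub (Var vP))))
        (Cond (Equal (Ld aSub (Var vP)) (Ld aOwn (Var vP))) Skip
          (Write aNonmin (Ld aOwn (Var vP)) (Lit 1)))
        Skip"
  let ?I = "\<lambda>i (R', A', t'). regs_ok R' \<and> R' vP = i \<and> unchanged_except aNonmin A A' \<and>
    (\<forall>x. 0 < A' aNonmin x \<longleftrightarrow> (\<exists>p<i. T aOwn p = x \<and> T aSub p \<noteq> x \<and> 0 < A aGood (T aSub p))) \<and>
    t' \<le> t + 5 + 60 * i"
  have loop: "wp L W (for_loop vP vQ ?body) ?Q (R(vP := 0), A, t + 2)"
  proof (rule wp_for_loop[where I = ?I and lo = 0 and n = q])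
    show "?I 0 (R(vP := 0), A, t + 2)" using assms by (simp add: regs_ok_def base_def)
  next
    fix i R' A' t'
    assume I: "?I i (R', A', t')" and i: "i < q"
    have A': "A' aSub = T aSub" "A' aOwn = T aOwn" "A' aGood = A aGood"
      using I trie_arraysD[OF assms(2)] by simp_all
    have ids: "T aSub i < L" "T aOwn i < L" "i < L"
      using pair_less[OF i] N_bound q_bound i by linarith+
    have Rv: "R' vP = i" "R' vQ = q" using I by (simp_all add: regs_ok_def)
    have regs: "regs_ok (R'(vP := Suc i))" using I by (simp add: regs_ok_def base_def)
    show "R' vP = i \<and> R' vQ = q \<and>
        wp L W ?body (\<lambda>(R', A', t'). R' vP = i \<and> ?I (Suc i) (R'(vP := Suc i), A', t' + 5)) (R', A', t' + 3)"
      using I ids regs by (simp add: A' Rv less_Suc_eq) (auto simp: Rv)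
  qed (use q_bound in \<open>auto simp: regs_ok_def base_def\<close>)
  show ?thesis
    unfolding mark_nonminimal_def wp_Seq wp_Assign by (intro conjI wp_state_cong[OF loop]) simp_all
qed

lemma ancestors_exist:
  "i < N \<Longrightarrow> \<exists>ys. path (T aParent) i ys \<and> (\<forall>y\<in>set ys. y < N) \<and> distinct (map (T aElem) ys) \<and>
    set (map (T aElem) ys) = st i"
proof (induction i rule: less_induct)
  case (less i)
  show ?case
  proof (cases "i = 0")
    case True
    then show ?thesis using trieD(2)[OF tr] by (intro exI[of _ "[]"]) simp
  next
    case False
    then have i: "i < N" "0 < i" using less.prems by simp_all
    note par = trieD(13-15)[OF tr i]
    from less.IH[OF par(1)] par(1) i obtain ys where
      "path (T aParent) (T aParent i) ys" "\<forall>y\<in>set ys. y < N" "distinct (map (T aElem) ys)"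
      "set (map (T aElem) ys) = st (T aParent i)" by auto
    then show ?thesis using i par by (intro exI[of _ "i # ys"]) auto
  qed
qed

definition ancestors :: "nat \<Rightarrow> nat list" where
  "ancestors i = (SOME ys. path (T aParent) i ys \<and> (\<forall>y\<in>set ys. y < N) \<and> distinct (map (T aElem) ys) \<and>
    set (map (T aElem) ys) = st i)"

lemma ancestors:
  assumes "i < N"
  shows "path (T aParent) i (ancestors i)" "\<And>y. y \<in> set (ancestors i) \<Longrightarrow> y < N"
    "distinct (map (T aElem) (ancestors i))" "set (map (T aElem) (ancestors i)) = st i"
  using someI_ex[OF ancestors_exist[OF assms]] unfolding ancestors_def by blast+

lemma length_ancestors: "i < N \<Longrightarrow> length (ancestors i) = card (st i)"
  using ancestors(3,4) distinct_card by (metis length_map)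

lemma elem_less: "\<lbrakk>i < N; y \<in> set (ancestors i)\<rbrakk> \<Longrightarrow> T aElem y \<in> st i \<and> T aElem y < m"
proof -
  assume i: "i < N" and y: "y \<in> set (ancestors i)"
  then have *: "T aElem y \<in> st i" using ancestors(4)[OF i] by auto
  then obtain E where "T aElem y \<in> ES E" using covered[OF i] by blast
  then show ?thesis using * word_less by (auto simp: ES_def)
qed

lemma start_Suc: "i < N \<Longrightarrow> T aStart (Suc i) = T aStart i + 2 ^ card (st i)"
  using trieD(8)[OF tr] .

lemma start_bounds: "T aStart 0 = 0" "T aStart N = q" "i < N \<Longrightarrow> T aStart (Suc i) \<le> q"
  using trieD(4,5)[OF tr] trie_block_le[OF tr] by blast+

definition kernel_ids :: "(nat \<Rightarrow> nat \<Rightarrow> nat) \<Rightarrow> nat \<Rightarrow> nat list" where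
  "kernel_ids A x = filter (\<lambda>i. 0 < A aGood i \<and> A aNonmin i = 0) [0..<x]"

lemma kernel_ids_Suc:
  "kernel_ids A (Suc x) = kernel_ids A x @ (if 0 < A aGood x \<and> A aNonmin x = 0 then [x] else [])"
  by (simp add: kernel_ids_def)

lemma length_kernel_ids: "length (kernel_ids A x) \<le> x"
  using length_filter_le[of _ "[0..<x]"] by (simp add: kernel_ids_def)

text \<open>Climbing from \<open>x\<close> visits \<open>card (st x)\<close> nodes, fewer than the
  \<open>2 ^ card (st x)\<close> entries in the block of \<open>x\<close>. So the cost up to
  \<open>x\<close> is charged to \<open>T aStart x\<close>, and the total to
  \<open>q\<close>.\<close>

lemma wp_mark_universe:
  assumes "regs_ok R" "trie_arrays A" "A aMark = (\<lambda>_. 0)"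
  shows "wp L W mark_universe (\<lambda>(R', A', t'). regs_ok R' \<and> unchanged_except aMark A A' \<and>
    R' vCnt = length (kernel_ids A N) \<and>
    (\<forall>u. 0 < A' aMark u \<longleftrightarrow> (\<exists>i\<in>set (kernel_ids A N). u \<in> st i)) \<and> t' \<le> t + 20 + 100 * q) (R, A, t)"
    (is "wp L W _ ?Q _")
proof -
  let ?mark = "Write aMark (Ld aElem (Var vY)) (Lit 1)"
  let ?I = "\<lambda>x (R', A', t'). regs_ok R' \<and> R' vX = x \<and> R' vCnt = length (kernel_ids A x) \<and>
    unchanged_except aMark A A' \<and>
    (\<forall>u. 0 < A' aMark u \<longleftrightarrow> (\<exists>i\<in>set (kernel_ids A x). u \<in> st i)) \<and> t' \<le> t + 5 + 100 * T aStart x"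
  have loop: "wp L W (for_loop vX vIds (if_kernel (vCnt ::= Plus (Var vCnt) (Lit 1) ;; climb ?mark))) ?Q
      (R(vCnt := 0, vX := 0), A, t + 4)"
  proof (rule wp_for_loop[where I = ?I and lo = 0 and n = N])
    show "?I 0 (R(vCnt := 0, vX := 0), A, t + 4)"
      using assms by (simp add: regs_ok_def base_def kernel_ids_def)
  next
    fix x R' A' t'
    assume I: "?I x (R', A', t')" and x: "x < N"
    have regs: "regs_ok R'" "R' vX = x" "R' vIds = N" "R' vCnt = length (kernel_ids A x)"
      and frame: "unchanged_except aMark A A'"
      and marks: "\<forall>u. 0 < A' aMark u \<longleftrightarrow> (\<exists>i\<in>set (kernel_ids A x). u \<in> st i)"
      and t': "t' \<le> t + 5 + 100 * T aStart x" using I by (simp_all add: regs_ok_def)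
    have arr: "A' aGood = A aGood" "A' aNonmin = A aNonmin" "A' aParent = T aParent" "A' aElem = T aElem"
      using frame trie_arraysD[OF assms(2)] by simp_all
    obtain z where z: "z = (2::nat) ^ card (st x)" and pow: "card (st x) < z" by simp
    have xL: "x < L" using x N_bound by linarith
    let ?Q' = "\<lambda>(R', A', t'). R' vX = x \<and> ?I (Suc x) (R'(vX := Suc x), A', t' + 5)"
    have "wp L W (if_kernel (vCnt ::= Plus (Var vCnt) (Lit 1) ;; climb ?mark)) ?Q' (R', A', t' + 3)"
    proof (rule wp_if_kernel[where R = R' and x = x, OF regs(2) xL])
      assume ker: "0 < A' aGood x" "A' aNonmin x = 0"
      have ids: "kernel_ids A (Suc x) = kernel_ids A x @ [x]" using ker by (simp add: kernel_ids_Suc arr)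
      let ?J = "\<lambda>ds (R2, A2, t2). unchanged {vCnt, vY} R' R2 \<and> R2 vCnt = Suc (R' vCnt) \<and>
        unchanged_except aMark A A2 \<and>
        (\<forall>u. 0 < A2 aMark u \<longleftrightarrow> 0 < A' aMark u \<or> u \<in> T aElem ` set ds) \<and> t2 \<le> t' + 30 + 20 * length ds"
      have climb: "wp L W (climb ?mark) ?Q' (R'(vCnt := Suc (R' vCnt)), A', t' + 21)"
      proof (rule wp_climb[where I = ?J and ys = "ancestors x" and par = "T aParent"])
        show "path (T aParent) ((R'(vCnt := Suc (R' vCnt))) vX) (ancestors x)"
          using ancestors(1)[OF x] regs(2) by simp
        show "y < L" if "y \<in> set (ancestors x)" for y using ancestors(2)[OF x that] N_bound by linarith
      next
        fix ds y xs R2 A2 t2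
        assume split: "ancestors x = ds @ y # xs" and J: "?J ds (R2, A2, t2)" and y: "R2 vY = y"
          and par: "A2 aParent = T aParent"
        have "y \<in> set (ancestors x)" using split by simp
        then have "y < L" "T aElem y < L"
          using ancestors(2)[OF x] elem_less[OF x] N_bound bounds by (meson less_trans)+
        moreover have "A2 aElem = T aElem" using J trie_arraysD[OF assms(2)] by simp
        ultimately show "wp L W ?mark (\<lambda>(R', A', t'). R' vY = y \<and> A' aParent = T aParent \<and>
            ?J (ds @ [y]) (R'(vY := T aParent y), A', t' + 7)) (R2, A2, t2 + 3)"
          using J y par by auto
      next
        fix R2 A2 t2
        assume J: "?J (ancestors x) (R2, A2, t2)"
        have "0 < A2 aMark u \<longleftrightarrow> (\<exists>i\<in>set (kernel_ids A (Suc x)). u \<in> st i)" for u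
          using J marks ancestors(4)[OF x] unfolding ids by auto
        moreover have "t2 + 4 + 5 \<le> t + 5 + 100 * T aStart (Suc x)"
        proof -
          have "t2 \<le> t' + 30 + 20 * card (st x)" using J length_ancestors[OF x] by simp
          then show ?thesis using t' pow unfolding start_Suc[OF x] z[symmetric] distrib_left by linarith
        qed
        moreover have "regs_ok (R2(vX := Suc x))" "R2 vX = x" "R2 vCnt = length (kernel_ids A (Suc x))"
          using J regs ids by (simp_all add: regs_ok_def base_def)
        ultimately show "?Q' (R2, A2, t2 + 4)" using J by simp
      qed (use arr frame in simp_all)
      have "length (kernel_ids A x) + 1 < W" using length_kernel_ids[of A x] x N_bound by linarith
      then show "wp L W (vCnt ::= Plus (Var vCnt) (Lit 1) ;; climb ?mark) ?Q' (R', A', t' + 3 + 14)"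
        unfolding wp_Seq wp_Assign by (intro conjI wp_state_cong[OF climb]) (simp_all add: regs)
    next
      fix t2
      assume no: "\<not> (0 < A' aGood x \<and> A' aNonmin x = 0)" and t2: "t2 \<le> t' + 3 + 20"
      have ids: "kernel_ids A (Suc x) = kernel_ids A x" using no by (simp add: kernel_ids_Suc arr)
      have "t2 + 5 \<le> t + 5 + 100 * T aStart (Suc x)"
        using t2 t' pow unfolding start_Suc[OF x] z[symmetric] distrib_left by linarith
      then show "?Q' (R', A', t2)"
        using regs frame marks unfolding ids by (simp add: regs_ok_def base_def)
    qed
    then show "R' vX = x \<and> R' vIds = N \<and> wp L W (if_kernel (vCnt ::= Plus (Var vCnt) (Lit 1) ;; climb ?mark)) ?Q'
        (R', A', t' + 3)" using regs by simp
  qed (use N_bound start_bounds in \<open>auto simp: regs_ok_def base_def\<close>)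
  show ?thesis
    unfolding mark_universe_def wp_Seq wp_Assign by (intro conjI wp_state_cong[OF loop]) simp_all
qed

definition marked :: "(nat \<Rightarrow> nat \<Rightarrow> nat) \<Rightarrow> nat \<Rightarrow> nat list" where
  "marked A x = filter (\<lambda>u. 0 < A aMark u) [0..<x]"

lemma marked_Suc: "marked A (Suc x) = marked A x @ (if 0 < A aMark x then [x] else [])"
  by (simp add: marked_def)

lemma length_marked: "length (marked A x) \<le> x"
  using length_filter_le[of _ "[0..<x]"] by (simp add: marked_def)

lemma wp_output_universe:
  assumes "regs_ok R"
  shows "wp L W output_universe (\<lambda>(R', A', t'). regs_ok R' \<and> unchanged_except aOut A A' \<and>
    R' vCnt = R vCnt \<and> R' vO = Suc (length (marked A m)) \<and>
    written A' (length (marked A m) # marked A m) \<and> t' \<le> t + 30 + 40 * m) (R, A, t)"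
    (is "wp L W _ ?Q _")
proof -
  let ?body = "Cond (Less (Lit 0) (Ld aMark (Var vU))) (emit (Var vU)) Skip"
  let ?I = "\<lambda>u (R', A', t'). regs_ok R' \<and> R' vU = u \<and> R' vCnt = R vCnt \<and>
    unchanged_except aOut A A' \<and> R' vO = Suc (length (marked A u)) \<and>
    (\<forall>i<length (marked A u). A' aOut (Suc i) = marked A u ! i) \<and> t' \<le> t + 5 + 40 * u"
  have loop: "wp L W (for_loop vU vM ?body) (wp L W (Write aOut (Lit 0) (Minus (Var vO) (Lit 1))) ?Q)
      (R(vO := 1, vU := 0), A, t + 4)"
  proof (rule wp_for_loop[where I = ?I and lo = 0 and n = m])
    show "?I 0 (R(vO := 1, vU := 0), A, t + 4)"
      using assms by (simp add: regs_ok_def base_def marked_def)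
  next
    fix u R' A' t'
    assume I: "?I u (R', A', t')" and u: "u < m"
    have regs: "regs_ok R'" "R' vU = u" "R' vM = m" "R' vCnt = R vCnt" "R' vO = Suc (length (marked A u))"
      using I by (simp_all add: regs_ok_def base_def)
    have mark: "A' aMark = A aMark" using I by simp
    have lt: "u < L" "Suc (length (marked A u)) < L" "Suc (length (marked A u)) + 1 < W"
      using u length_marked[of A u] bounds by linarith+
    have regs': "regs_ok (R'(vU := Suc u))" "regs_ok (R'(vO := x, vU := Suc u))" for x
      using regs(1) by (simp_all add: regs_ok_def base_def)
    show "R' vU = u \<and> R' vM = m \<and>
        wp L W ?body (\<lambda>(R', A', t'). R' vU = u \<and> ?I (Suc u) (R'(vU := Suc u), A', t' + 5)) (R', A', t' + 3)"
      using I lt regs' unfolding emit_def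
      by (cases "0 < A aMark u") (auto simp: mark regs marked_Suc nth_append less_Suc_eq)
  next
    fix R' A' t'
    assume I: "?I m (R', A', t')"
    have "written (A'(aOut := (A' aOut)(0 := length (marked A m)))) (length (marked A m) # marked A m)"
      using I by (auto simp: written_def less_Suc_eq_0_disj)
    then show "R' vU = m \<and> R' vM = m \<and> wp L W (Write aOut (Lit 0) (Minus (Var vO) (Lit 1))) ?Q (R', A', t' + 4)"
      using I bounds by (simp add: regs_ok_def base_def)
  qed (use bounds in simp_all)
  show ?thesis
    unfolding output_universe_def wp_Seq wp_Assign by (intro conjI wp_state_cong[OF loop]) simp_all
qed

definition set_words :: "nat \<Rightarrow> nat list" where
  "set_words i = card (st i) # map (T aElem) (ancestors i)"

text \<open>The size and the elements of a set take \<open>card (st i) + 1\<close> words, no more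
  than its block has entries; this is why the whole output fits into one array.\<close>

lemma length_set_words: "i < N \<Longrightarrow> length (set_words i) \<le> 2 ^ card (st i)"
  by (simp add: set_words_def length_ancestors Suc_le_eq)

lemma length_kernel_words: "x \<le> N \<Longrightarrow> length (concat (map set_words (kernel_ids A x))) \<le> T aStart x"
proof (induction x)
  case (Suc x)
  then show ?case using length_set_words[of x] start_Suc[of x] by (simp add: kernel_ids_Suc)
qed (simp add: kernel_ids_def)

lemma wp_output_sets:
  assumes "regs_ok R" "trie_arrays A" "written A ws" "R vO = length ws" "length ws \<le> m + 1"
  shows "wp L W output_sets (\<lambda>(R', A', t'). regs_ok R' \<and> unchanged_except aOut A A' \<and>
    written A' (ws @ R vCnt # concat (map set_words (kernel_ids A N))) \<and> t' \<le> t + 30 + 100 * q) (R, A, t)"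
    (is "wp L W _ ?Q _")
proof -
  let ?emit = "emit (Ld aElem (Var vY))"
  let ?body = "if_kernel (emit (Ld aSize (Var vX)) ;; climb ?emit)"
  let ?ws = "\<lambda>x. ws @ R vCnt # concat (map set_words (kernel_ids A x))"
  let ?I = "\<lambda>x (R', A', t'). regs_ok R' \<and> R' vX = x \<and> unchanged_except aOut A A' \<and>
    R' vO = length (?ws x) \<and> written A' (?ws x) \<and> t' \<le> t + 15 + 100 * T aStart x"
  define A0 where "A0 = A(aOut := (A aOut)(length ws := R vCnt))"
  have loop: "wp L W (for_loop vX vIds ?body) ?Q (R(vO := Suc (length ws), vX := 0), A0, t + 12)"
  proof (rule wp_for_loop[where I = ?I and lo = 0 and n = N])
    show "?I 0 (R(vO := Suc (length ws), vX := 0), A0, t + 12)"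
      using assms(1) written_snoc[OF assms(3), of "R vCnt"]
      by (simp add: regs_ok_def base_def kernel_ids_def A0_def)
  next
    fix x R' A' t'
    assume I: "?I x (R', A', t')" and x: "x < N"
    have regs: "regs_ok R'" "R' vX = x" "R' vIds = N" "R' vO = length (?ws x)"
      and frame: "unchanged_except aOut A A'" and out: "written A' (?ws x)"
      and t': "t' \<le> t + 15 + 100 * T aStart x" using I by (simp_all add: regs_ok_def)
    have arr: "A' aGood = A aGood" "A' aNonmin = A aNonmin" "A' aParent = T aParent" "A' aElem = T aElem"
      "A' aSize = T aSize"
      using frame trie_arraysD[OF assms(2)] by simp_all
    obtain z where z: "z = (2::nat) ^ card (st x)" and pow: "card (st x) < z" by simp
    have xL: "x < L" using x N_bound by linarith
    have "T aStart (Suc x) \<le> q" using start_bounds(3)[OF x] .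
    then have len: "length (?ws x) + z \<le> m + 2 + q"
      using length_kernel_words[of x A] x assms(5) start_Suc[OF x] z by simp
    let ?Q' = "\<lambda>(R', A', t'). R' vX = x \<and> ?I (Suc x) (R'(vX := Suc x), A', t' + 5)"
    have "wp L W ?body ?Q' (R', A', t' + 3)"
    proof (rule wp_if_kernel[where R = R' and x = x, OF regs(2) xL])
      assume ker: "0 < A' aGood x" "A' aNonmin x = 0"
      have ids: "kernel_ids A (Suc x) = kernel_ids A x @ [x]" using ker by (simp add: kernel_ids_Suc arr)
      let ?ws' = "\<lambda>ds. ?ws x @ card (st x) # map (T aElem) ds"
      let ?J = "\<lambda>ds (R2, A2, t2). unchanged {vO, vY} R' R2 \<and> R2 vO = length (?ws' ds) \<and>
        unchanged_except aOut A A2 \<and> written A2 (?ws' ds) \<and> t2 \<le> t' + 40 + 30 * length ds"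
      define A1 where "A1 = A'(aOut := (A' aOut)(length (?ws x) := card (st x)))"
      have climb: "wp L W (climb ?emit) ?Q' (R'(vO := Suc (length (?ws x))), A1, t' + 31)"
      proof (rule wp_climb[where I = ?J and ys = "ancestors x" and par = "T aParent"])
        show "path (T aParent) ((R'(vO := Suc (length (?ws x)))) vX) (ancestors x)"
          using ancestors(1)[OF x] regs(2) by simp
        show "y < L" if "y \<in> set (ancestors x)" for y using ancestors(2)[OF x that] N_bound by linarith
        show "?J [] ((R'(vO := Suc (length (?ws x))))(vY := (R'(vO := Suc (length (?ws x)))) vX), A1, t' + 31 + 2)"
          using frame written_snoc[OF out, of "card (st x)"] by (simp add: A1_def)
      next
        fix ds y xs R2 A2 t2
        assume split: "ancestors x = ds @ y # xs" and J: "?J ds (R2, A2, t2)" and y: "R2 vY = y"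
          and par: "A2 aParent = T aParent"
        have "y \<in> set (ancestors x)" using split by simp
        then have "y < L" using ancestors(2)[OF x] N_bound by (meson less_trans)
        moreover have "A2 aElem = T aElem" using J trie_arraysD[OF assms(2)] by simp
        moreover have "length (?ws' ds) < L" "length (?ws' ds) + 1 < W"
        proof -
          have "length ds + 1 \<le> card (st x)" using length_ancestors[OF x] unfolding split by simp
          then have "length (?ws' ds) \<le> m + 2 + q" using len pow by simp
          then show "length (?ws' ds) < L" "length (?ws' ds) + 1 < W" using L_eq q_bound bounds by linarith+
        qed
        moreover have "written (A2(aOut := (A2 aOut)(length (?ws' ds) := T aElem y))) (?ws' (ds @ [y]))"
          using J written_snoc[of A2 "?ws' ds" "T aElem y"] by simp
        ultimately show "wp L W ?emit (\<lambda>(R', A', t'). R' vY = y \<and> A' aParent = T aParent \<and>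
            ?J (ds @ [y]) (R'(vY := T aParent y), A', t' + 7)) (R2, A2, t2 + 3)"
          using J y par unfolding emit_def by simp
      next
        fix R2 A2 t2
        assume J: "?J (ancestors x) (R2, A2, t2)"
        have ws: "?ws' (ancestors x) = ?ws (Suc x)" unfolding ids by (simp add: set_words_def)
        have "t2 \<le> t' + 40 + 30 * card (st x)" using J length_ancestors[OF x] by simp
        then have "t2 + 4 + 5 \<le> t + 15 + 100 * T aStart (Suc x)"
          using t' pow unfolding start_Suc[OF x] z[symmetric] distrib_left by linarith
        moreover have "regs_ok (R2(vX := Suc x))" "R2 vX = x"
          using J regs by (simp_all add: regs_ok_def base_def)
        ultimately show "?Q' (R2, A2, t2 + 4)" using J unfolding ws by simp
      qed (use arr frame in \<open>simp_all add: A1_def\<close>)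
      have lt: "length (?ws x) < L" "length (?ws x) + 1 < W" using len L_eq q_bound bounds by linarith+
      show "wp L W (emit (Ld aSize (Var vX)) ;; climb ?emit) ?Q' (R', A', t' + 3 + 14)"
        unfolding emit_def[of "Ld aSize (Var vX)"] wp_Seq wp_Assign wp_Write
        by (intro conjI wp_state_cong[OF climb])
          (use lt xL size_st[OF x] in \<open>simp_all add: regs(2,4) arr(5) A1_def\<close>)
    next
      fix t2
      assume no: "\<not> (0 < A' aGood x \<and> A' aNonmin x = 0)" and t2: "t2 \<le> t' + 3 + 20"
      have ids: "kernel_ids A (Suc x) = kernel_ids A x" using no by (simp add: kernel_ids_Suc arr)
      have "t2 + 5 \<le> t + 15 + 100 * T aStart (Suc x)"
        using t2 t' pow unfolding start_Suc[OF x] z[symmetric] distrib_left by linarith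
      then show "?Q' (R', A', t2)"
        using regs frame out unfolding ids by (simp add: regs_ok_def base_def)
    qed
    then show "R' vX = x \<and> R' vIds = N \<and> wp L W ?body ?Q' (R', A', t' + 3)" using regs by simp
  next
    fix R' A' t'
    assume "?I N (R', A', t')"
    then show "R' vX = N \<and> R' vIds = N \<and> ?Q (R', A', t' + 4)"
      using start_bounds(2) by (simp add: regs_ok_def)
  qed (use N_bound in simp_all)
  have lt: "length ws < L" "length ws + 1 < W" using assms(5) L_eq bounds by linarith+
  show ?thesis
    unfolding output_sets_def emit_def[of "Var vCnt"] wp_Seq wp_Assign wp_Write
    by (intro conjI wp_state_cong[OF loop]) (use lt in \<open>simp_all add: assms(4) A0_def\<close>)
qed

end

section \<open>The written words encode the kernel\<close>

context kernel_family
begin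

text \<open>Every good proper subset has an identifier by \<open>lr_good_closed\<close>, so the
  recorded pairs miss no obstacle to minimality.\<close>

lemma kernel_ids_iff:
  assumes good: "\<And>i. i < N \<Longrightarrow> 0 < A aGood i \<longleftrightarrow> good d k U F (X i)"
    and nonmin: "\<And>i. i < N \<Longrightarrow> 0 < A aNonmin i \<longleftrightarrow> (\<exists>p<q. T aOwn p = i \<and> T aSub p \<noteq> i \<and> 0 < A aGood (T aSub p))"
  shows "set (kernel_ids A N) = {i. i < N \<and> X i \<in> kernel_sets d k U F}"
proof -
  have "(\<exists>p<q. T aOwn p = i \<and> T aSub p \<noteq> i \<and> 0 < A aGood (T aSub p)) \<longleftrightarrow> (\<exists>S. S \<subset> X i \<and> good d k U F S)"
    if i: "i < N" for i
  proof
    assume "\<exists>p<q. T aOwn p = i \<and> T aSub p \<noteq> i \<and> 0 < A aGood (T aSub p)"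
    then obtain p where p: "p < q" "T aOwn p = i" "T aSub p \<noteq> i" "0 < A aGood (T aSub p)" by blast
    note own = pair_less[OF p(1)]
    have "X (T aSub p) \<subseteq> X i" using X_subset_iff[OF own(2) i] own(3) p(2) by simp
    moreover have "X (T aSub p) \<noteq> X i" using X_eq_iff[OF own(2) i] p(3) by simp
    ultimately show "\<exists>S. S \<subset> X i \<and> good d k U F S" using good[OF own(2)] p(4) by blast
  next
    assume "\<exists>S. S \<subset> X i \<and> good d k U F S"
    then obtain S where S: "S \<subset> X i" "good d k U F S" by blast
    then obtain r where "lr_good d k U F (card S) r S" unfolding good_def l_good.simps by blast
    then obtain j where j: "j < N" "X j = S" by (rule lr_good_id)
    have "st j \<subseteq> st i" using S(1) j X_subset_iff[OF j(1) i] by blast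
    then obtain p where p: "p < q" "T aOwn p = i" "T aSub p = j" by (rule pair_exists[OF j(1) i])
    have "j \<noteq> i" using S(1) j(2) by blast
    moreover have "0 < A aGood j" using good[OF j(1)] S(2) j(2) by simp
    ultimately show "\<exists>p<q. T aOwn p = i \<and> T aSub p \<noteq> i \<and> 0 < A aGood (T aSub p)" using p by blast
  qed
  then have "A aNonmin i = 0 \<longleftrightarrow> \<not> (\<exists>S. S \<subset> X i \<and> good d k U F S)" if "i < N" for i
    using nonmin[OF that] that by (metis gr0I less_irrefl_nat)
  then show ?thesis
    unfolding kernel_ids_def kernel_sets_def using good by (auto dest: subsetD[OF X_subset_U])
qed

lemma kernel_sets_ids: "S \<in> kernel_sets d k U F \<Longrightarrow> \<exists>i<N. X i = S"
proof -
  assume "S \<in> kernel_sets d k U F"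
  then obtain r where "lr_good d k U F (card S) r S"
    unfolding kernel_sets_def good_def l_good.simps by blast
  then show ?thesis by (rule lr_good_id) blast
qed

lemma kernel_words_eq:
  assumes num: "\<And>u. u < m \<Longrightarrow> num (e u) = u"
    and ids: "set ks = {i. i < N \<and> X i \<in> kernel_sets d k U F}" "distinct ks"
    and us: "set ul = {u. \<exists>i\<in>set ks. u \<in> st i}" "distinct ul"
  defines "us \<equiv> map e ul" and "yss \<equiv> map (\<lambda>i. map (e \<circ> T aElem) (ancestors i)) ks"
  shows "lists_set us (kernel_universe d k U F)" "lists_family yss (kernel_sets d k U F)"
    "kernel_words num us yss = (length ul # ul) @ length ks # concat (map set_words ks)"
proof -
  have ul: "set ul \<subseteq> {..<m}" using us(1) ids(1) st_subset by auto
  have kernel: "kernel_sets d k U F = X ` set ks" using ids(1) kernel_sets_ids by auto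
  have "distinct us" unfolding us_def using us(2) inj_on_subset[OF e_inj ul] by (simp add: distinct_map)
  moreover have "set us = kernel_universe d k U F"
  proof -
    have "set us = (\<Union>i\<in>set ks. X i)" unfolding us_def X_def using us(1) by auto
    also have "\<dots> = kernel_universe d k U F"
      unfolding kernel_universe_def kernel using ids(1) by (auto dest: subsetD[OF X_subset_U])
    finally show ?thesis .
  qed
  ultimately show "lists_set us (kernel_universe d k U F)" by (simp add: lists_set_def)
  have "distinct (map (e \<circ> T aElem) (ancestors i)) \<and> set (map (e \<circ> T aElem) (ancestors i)) = X i"
    if i: "i < N" for i
  proof -
    have "inj_on e (set (map (T aElem) (ancestors i)))"
      using inj_on_subset[OF e_inj st_subset[OF i]] ancestors(4)[OF i] by simp
    then have "distinct (map e (map (T aElem) (ancestors i)))"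
      using ancestors(3)[OF i] distinct_map by blast
    moreover have "set (map e (map (T aElem) (ancestors i))) = X i"
      unfolding X_def ancestors(4)[OF i, symmetric] by (rule list.set_map)
    ultimately show ?thesis by simp
  qed
  then have yss: "\<forall>ys\<in>set yss. distinct ys" "map set yss = map X ks"
    unfolding yss_def using ids(1) by auto
  have "distinct (map X ks)" using ids X_eq_iff by (auto simp: distinct_map inj_on_def)
  then show "lists_family yss (kernel_sets d k U F)"
    unfolding lists_family_def lists_set_def yss(2) kernel using yss(1) by simp
  have "map num us = ul" unfolding us_def using ul num by (auto intro!: map_idI)
  moreover have "map (\<lambda>ys. length ys # map num ys) yss = map set_words ks"
    unfolding yss_def using ids(1) elem_less num length_ancestors
    by (auto simp: set_words_def)
  moreover have "length us = length ul" "length yss = length ks" by (simp_all add: us_def yss_def)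
  ultimately show "kernel_words num us yss = (length ul # ul) @ length ks # concat (map set_words ks)"
    unfolding kernel_words_def by simp
qed

lemma wp_output_kernel:
  assumes R: "regs_ok R" and A: "trie_arrays A" and zero: "\<And>j. j \<in> {13..19} \<Longrightarrow> A j = (\<lambda>_. 0)"
    and num: "\<And>u. u < m \<Longrightarrow> num (e u) = u"
  shows "wp L W output_kernel (\<lambda>(R', A', t'). R' vOut = aOut * L \<and> (\<exists>us yss.
    lists_set us (kernel_universe d k U F) \<and> lists_family yss (kernel_sets d k U F) \<and>
    written A' (kernel_words num us yss) \<and> length (kernel_words num us yss) \<le> L) \<and>
    t' \<le> t + 200 + 2000 * (3 ^ d * n) + 40 * m) (R, A, t)"
    (is "wp L W _ ?Q _")
  unfolding output_kernel_def wp_Seq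
proof (rule wp_mono[OF wp_mark_input[OF R A]], simp add: zero, unfold prod.case, elim conjE)
  fix R1 A1 t1
  assume 1: "regs_ok R1" "unchanged_except aGood A A1"
    "\<forall>i. A1 aGood i = (if \<exists>E<n. i = T aCur E then 1 else 0)" "t1 \<le> t + 10 + 20 * n"
  have A1: "trie_arrays A1" by (rule trie_arrays_frame[OF A]) (use 1(2) in simp)
  have "A1 aHeadB = (\<lambda>_. 0)" using 1(2) zero by simp
  then show "wp L W bucket_pairs (wp L W find_good (wp L W mark_nonminimal (wp L W mark_universe
      (wp L W output_universe (wp L W output_sets (wp L W (vOut ::= Times (Lit aOut) (Var vL)) ?Q)))))) (R1, A1, t1)"
  proof (rule wp_mono[OF wp_bucket_pairs[OF 1(1) A1]], unfold prod.case, elim conjE)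
    fix R2 A2 t2
    assume 2: "regs_ok R2" "unchanged {aHeadB, aNextB} A1 A2"
      "\<forall>b. chain (A2 aNextB) (A2 aHeadB b) (bucket b)" "t2 \<le> t1 + 10 + 100 * q"
    have A2: "trie_arrays A2" by (rule trie_arrays_frame[OF A1]) (use 2(2) in simp)
    have "arrays_ok F {} A2"
      unfolding arrays_ok_def using A2 2(2,3) 1(2,3) zero X_in_F by simp
    then show "wp L W find_good (wp L W mark_nonminimal (wp L W mark_universe
      (wp L W output_universe (wp L W output_sets (wp L W (vOut ::= Times (Lit aOut) (Var vL)) ?Q))))) (R2, A2, t2)"
    proof (rule wp_mono[OF wp_find_good[OF 2(1)]], unfold prod.case, elim conjE exE)
      fix R3 A3 t3 D
      assume 3: "regs_ok R3" "arrays_ok {S. good d k U F S} D A3"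
        "t3 \<le> t2 + 50 + 1200 * (3 ^ d * n) + 210 * q"
      have A3: "trie_arrays A3" "A3 aNonmin = (\<lambda>_. 0)" "A3 aMark = (\<lambda>_. 0)"
        "\<And>i. i < N \<Longrightarrow> 0 < A3 aGood i \<longleftrightarrow> good d k U F (X i)"
        using 3(2) unfolding arrays_ok_def by auto
      show "wp L W mark_nonminimal (wp L W mark_universe
        (wp L W output_universe (wp L W output_sets (wp L W (vOut ::= Times (Lit aOut) (Var vL)) ?Q)))) (R3, A3, t3)"
      proof (rule wp_mono[OF wp_mark_nonminimal[OF 3(1) A3(1,2)]], unfold prod.case, elim conjE)
        fix R4 A4 t4
        assume 4: "regs_ok R4" "unchanged_except aNonmin A3 A4"
          "\<forall>i. 0 < A4 aNonmin i \<longleftrightarrow> (\<exists>p<q. T aOwn p = i \<and> T aSub p \<noteq> i \<and> 0 < A3 aGood (T aSub p))"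
          "t4 \<le> t3 + 10 + 60 * q"
        have A4: "trie_arrays A4" by (rule trie_arrays_frame[OF A3(1)]) (use 4(2) in simp)
        have A4': "A4 aMark = (\<lambda>_. 0)" "A4 aGood = A3 aGood" using 4(2) A3(3) by simp_all
        define ks where "ks = kernel_ids A4 N"
        have ids: "set ks = {i. i < N \<and> X i \<in> kernel_sets d k U F}" "distinct ks"
          unfolding ks_def using kernel_ids_iff[of A4] A3(4) 4(3) by (auto simp: A4' kernel_ids_def)
        show "wp L W mark_universe
          (wp L W output_universe (wp L W output_sets (wp L W (vOut ::= Times (Lit aOut) (Var vL)) ?Q))) (R4, A4, t4)"
        proof (rule wp_mono[OF wp_mark_universe[OF 4(1) A4 A4'(1)]], unfold prod.case, elim conjE)
          fix R5 A5 t5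
          assume 5: "regs_ok R5" "unchanged_except aMark A4 A5" "R5 vCnt = length (kernel_ids A4 N)"
            "\<forall>u. 0 < A5 aMark u \<longleftrightarrow> (\<exists>i\<in>set (kernel_ids A4 N). u \<in> st i)" "t5 \<le> t4 + 20 + 100 * q"
          define ul where "ul = marked A5 m"
          have ul: "set ul = {u. \<exists>i\<in>set ks. u \<in> st i}" "distinct ul"
            using 5(4) st_subset ids(1) unfolding ul_def marked_def ks_def[symmetric] by auto
          show "wp L W output_universe (wp L W output_sets (wp L W (vOut ::= Times (Lit aOut) (Var vL)) ?Q)) (R5, A5, t5)"
          proof (rule wp_mono[OF wp_output_universe[OF 5(1)]], unfold prod.case, elim conjE)
            fix R6 A6 t6
            assume 6: "regs_ok R6" "unchanged_except aOut A5 A6" "R6 vCnt = R5 vCnt"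
              "R6 vO = Suc (length (marked A5 m))" "written A6 (length (marked A5 m) # marked A5 m)"
              "t6 \<le> t5 + 30 + 40 * m"
            have A6: "trie_arrays A6" by (rule trie_arrays_frame[OF A4]) (use 5(2) 6(2) in simp)
            have ids6: "kernel_ids A6 N = ks"
              using 5(2) 6(2) unfolding ks_def kernel_ids_def by simp
            have len: "length (length ul # ul) \<le> m + 1" using length_marked[of A5 m] by (simp add: ul_def)
            show "wp L W output_sets (wp L W (vOut ::= Times (Lit aOut) (Var vL)) ?Q) (R6, A6, t6)"
            proof (rule wp_mono[OF wp_output_sets[OF 6(1) A6 6(5)[folded ul_def] _ len]],
                simp add: 6(4) ul_def, unfold prod.case, elim conjE)
              fix R7 A7 t7
              assume 7: "regs_ok R7" "written A7 ((length ul # ul) @ R6 vCnt # concat (map set_words (kernel_ids A6 N)))"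
                "t7 \<le> t6 + 30 + 100 * q"
              let ?us = "map e ul" and ?yss = "map (\<lambda>i. map (e \<circ> T aElem) (ancestors i)) ks"
              note kw = kernel_words_eq[OF num ids ul]
              have "R6 vCnt = length ks" using 6(3) 5(3) by (simp add: ks_def)
              then have w: "written A7 (kernel_words num ?us ?yss)" using 7(2) ids6 kw(3) by simp
              have "length (concat (map set_words ks)) \<le> q"
                using length_kernel_words[of N A4] start_bounds(2) unfolding ks_def by simp
              then have l: "length (kernel_words num ?us ?yss) \<le> L"
                using kw(3) len L_eq q_bound by simp
              have time: "t7 + 4 \<le> t + 200 + 2000 * (3 ^ d * n) + 40 * m"
                using 1(4) 2(4) 3(3) 4(4) 5(5) 6(6) 7(3) q_bound(1) pow3_ge(2) by linarith
              have "R7 vL = L" "20 * L < W" using 7(1) L_W bounds by (simp_all add: regs_ok_def base_def)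
              then show "wp L W (vOut ::= Times (Lit aOut) (Var vL)) ?Q (R7, A7, t7)"
                using kw(1,2) w l time by auto
            qed
          qed
        qed
      qed
    qed
  qed
qed

end

section \<open>From the input words to the kernel words\<close>

context kernel_input
begin

lemma wp_kernelize:
  fixes e :: "nat \<Rightarrow> 'a"
  assumes R: "base R" and input: "\<And>p. p < d * n \<Longrightarrow> A aIn (p + 4) = word p"
    and zero: "\<And>j. j \<in> {1..19} \<Longrightarrow> A j = (\<lambda>_. 0)"
    and e: "inj_on e {..<m}" "U = e ` {..<m}" "F = (\<lambda>E. e ` ES E) ` {..<n}" "\<And>u. u < m \<Longrightarrow> num (e u) = u"
  shows "wp L W kernelize (\<lambda>(R', A', t'). R' vOut = aOut * L \<and> (\<exists>us yss.
    lists_set us (kernel_universe d k U F) \<and> lists_family yss (kernel_sets d k U F) \<and>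
    written A' (kernel_words num us yss) \<and> length (kernel_words num us yss) \<le> L) \<and>
    t' \<le> t + 300 + 2500 * (3 ^ d * n) + 80 * m) (R, A, t)"
    (is "wp L W _ ?Q _")
proof -
  have "wp L W bucket_elements (wp L W build_trie (wp L W output_kernel ?Q)) (R, A, t)"
  proof (rule wp_mono[OF wp_bucket_elements[where A = A, OF R input]], simp, simp add: zero, unfold prod.case, elim conjE)
    fix R1 A1 t1
    assume 1: "base R1" "unchanged {aHead, aNext} A A1"
      "\<forall>u. chain (A1 aNext) (A1 aHead u) (rev (filter (\<lambda>p. word p = u) [0..<d * n]))"
      "t1 \<le> t + 20 + 50 * (d * n)"
    show "wp L W build_trie (wp L W output_kernel ?Q) (R1, A1, t1)"
    proof (rule wp_mono[OF wp_build_trie[OF 1(1)]])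
      show "A1 j = (\<lambda>_. 0)" if "j \<in> {4..12}" for j using that 1(2) zero by auto
      show "chain (A1 aNext) (A1 aHead u) (rev (filter (\<lambda>p. word p = u) [0..<d * n]))" for u using 1(3) by blast
    next
      fix R2 A2 t2
      assume "case (R2, A2, t2) of (R', A', t') \<Rightarrow> base R' \<and> unchanged {4..12} A1 A' \<and>
        (\<exists>st. trie st (R' vIds) (R' vQ) A' \<and> (\<forall>i<R' vIds. \<exists>E<n. st i \<subseteq> ES E) \<and>
          (\<forall>E<n. A' aCur E < R' vIds \<and> st (A' aCur E) = ES E)) \<and>
        t' \<le> t1 + 40 + 400 * (3 ^ d * n) + 40 * m"
      then obtain st where 2: "base R2" "unchanged {4..12} A1 A2"
        "trie st (R2 vIds) (R2 vQ) A2" "\<And>i. i < R2 vIds \<Longrightarrow> \<exists>E<n. st i \<subseteq> ES E"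
        "\<And>E. E < n \<Longrightarrow> A2 aCur E < R2 vIds \<and> st (A2 aCur E) = ES E"
        "t2 \<le> t1 + 40 + 400 * (3 ^ d * n) + 40 * m" by auto
      \<comment> \<open>The trie exists only at this point of the run, so the locale is instantiated
        with the arrays and counters left by \<open>build_trie\<close>.\<close>
      interpret kernel_family d k n m L W word st "R2 vIds" "R2 vQ" A2 e U F
        by unfold_locales (use 2 e in auto)
      have "regs_ok R2" using 2(1) by (simp add: regs_ok_def)
      moreover have "trie_arrays A2" by (simp add: trie_arrays_def)
      moreover have "A2 j = (\<lambda>_. 0)" if "j \<in> {13..19}" for j using that 2(2) 1(2) zero by auto
      ultimately show "wp L W output_kernel ?Q (R2, A2, t2)"
      proof (rule wp_mono[OF wp_output_kernel[OF _ _ _ e(4)]])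
        fix R3 A3 t3
        assume 3: "case (R3, A3, t3) of (R', A', t') \<Rightarrow> R' vOut = aOut * L \<and> (\<exists>us yss.
          lists_set us (kernel_universe d k U F) \<and> lists_family yss (kernel_sets d k U F) \<and>
          written A' (kernel_words num us yss) \<and> length (kernel_words num us yss) \<le> L) \<and>
          t' \<le> t2 + 200 + 2000 * (3 ^ d * n) + 40 * m"
        then have "t3 \<le> t2 + 200 + 2000 * (3 ^ d * n) + 40 * m" by simp
        then have "t3 \<le> t + 300 + 2500 * (3 ^ d * n) + 80 * m"
          using 2(6) 1(4) pow3_ge(3) by linarith
        then show "?Q (R3, A3, t3)" using 3 by simp
      qed
    qed
  qed
  then show ?thesis unfolding kernelize_def wp_Seq .
qed

end

section \<open>The complete program\<close>

text \<open>With array length 0 every array access is unsafe, so a derivation shows that this stage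
  works on variables alone; it has to, as arrays cannot be addressed before \<open>L\<close> is
  known.\<close>

lemma wp_set_length:
  assumes R: "R vD = d" "R vN = n" "R vM = m" and n: "0 < n" and W: "4 * (3 ^ d * n) + m + 8 < W"
  shows "wp 0 W set_length (\<lambda>(R', A', t'). unchanged {vL, vI} R R' \<and>
    R' vL = 4 * (3 ^ d * n) + m + 8 \<and> t' \<le> t + 40 + 20 * d) (R, A, t)"
    (is "wp 0 W _ ?Q _")
proof -
  let ?I = "\<lambda>i (R', A' :: nat \<Rightarrow> nat \<Rightarrow> nat, t'). unchanged {vL, vI} R R' \<and> R' vI = i \<and> R' vL = 3 ^ i * n \<and>
    t' \<le> t + 10 + 20 * i"
  have d: "d < W"
  proof -
    have "d < 3 ^ d" by (induction d) auto
    moreover have "3 ^ d * 1 \<le> 3 ^ d * n" using n by (intro mult_le_mono2) simp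
    ultimately show ?thesis using W by linarith
  qed
  have loop: "wp 0 W (for_loop vI vD (vL ::= Times (Lit 3) (Var vL)))
      (wp 0 W (vL ::= Plus (Plus (Times (Lit 4) (Var vL)) (Var vM)) (Lit 8)) ?Q)
      (R(vL := n, vI := 0), A, t + 4)"
  proof (rule wp_for_loop[where I = ?I and lo = 0 and n = d])
    show "?I 0 (R(vL := n, vI := 0), A, t + 4)" by simp
  next
    fix i R' A' t'
    assume I: "?I i (R', A', t')" and i: "i < d"
    have "3 ^ Suc i * n \<le> 3 ^ d * n" using i by (intro mult_le_mono1 power_increasing) auto
    moreover have "3 * (3 ^ i * n) = 3 ^ Suc i * n" by simp
    ultimately have "3 * (3 ^ i * n) < W" using W by linarith
    then show "R' vI = i \<and> R' vD = d \<and> wp 0 W (vL ::= Times (Lit 3) (Var vL))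
        (\<lambda>(R', A', t'). R' vI = i \<and> ?I (Suc i) (R'(vI := Suc i), A', t' + 5)) (R', A', t' + 3)"
      using I R by (auto simp: algebra_simps)
  next
    fix R' A' t'
    assume I: "?I d (R', A', t')"
    then show "R' vI = d \<and> R' vD = d \<and>
        wp 0 W (vL ::= Plus (Plus (Times (Lit 4) (Var vL)) (Var vM)) (Lit 8)) ?Q (R', A', t' + 4)"
      using R W by auto
  qed (use d in simp_all)
  show ?thesis
    unfolding set_length_def wp_Seq[of _ _ "_ ::= _"] wp_Seq[of _ _ "for_loop _ _ _"] wp_Assign[of _ _ _ "Var vN"]
      wp_Assign[of _ _ _ "Lit 0"]
    by (intro conjI wp_state_cong[OF loop]) (simp_all add: R)
qed

lemma nth_concat_uniform:
  "\<lbrakk>\<forall>xs\<in>set xss. length xs = d; p < d * length xss\<rbrakk> \<Longrightarrow> concat xss ! p = xss ! (p div d) ! (p mod d)"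
proof (induction xss arbitrary: p)
  case (Cons xs xss)
  show ?case
  proof (cases "p < d")
    case False
    then have "d \<le> p" "0 < d" using Cons.prems(2) by (auto intro: gr0I)
    then have "p div d = Suc ((p - d) div d)" "p mod d = (p - d) mod d"
      by (simp_all add: le_div_geq le_mod_geq)
    moreover have "p - d < d * length xss" using Cons.prems(2) \<open>d \<le> p\<close> by simp
    ultimately show ?thesis using Cons False by (simp add: nth_append)
  qed (use Cons.prems in \<open>simp add: nth_append\<close>)
qed simp

lemma length_concat_uniform:
  "\<forall>xs\<in>set xss. length xs = d \<Longrightarrow> length (concat xss) = d * length xss"
  by (induction xss) auto

text \<open>
  The prologue loads \<open>d\<close>, \<open>k\<close>, \<open>n\<close> and \<open>m\<close> into their variables. For \<open>n = 0\<close> the output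
  \<open>[0, 0]\<close> is found at address 4, behind the input.
\<close>

definition prologue :: "nat \<Rightarrow> instr list" where
  "prologue l = [Const 2 0, Load 5 2, Const 2 1, Load 7 2, Const 2 2, Load 9 2, Const 2 3, Load 11 2,
    Const 2 0, Const 0 4, JumpEq 9 2 l, Const 0 0]"

definition kernel_program :: "instr list" where
  "kernel_program =
    (let C = compC set_length 12; pc = 12 + length C + 1; C' = compC kernelize pc
     in prologue (pc + length C' + 1) @ C @ [Move 0 13] @ C' @ [Move 0 15])"

lemma kernel_program_code:
  defines "pc \<equiv> 12 + length (compC set_length 12)"
  defines "pc' \<equiv> pc + 1 + length (compC kernelize (pc + 1))"
  shows "length kernel_program = pc' + 1"
    and "code_at kernel_program 0 (prologue (pc' + 1))"
    and "code_at kernel_program 12 (compC set_length 12)"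
    and "code_at kernel_program pc [Move 0 13]"
    and "code_at kernel_program (pc + 1) (compC kernelize (pc + 1))"
    and "code_at kernel_program pc' [Move 0 15]"
proof -
  let ?C = "compC set_length 12" and ?C' = "compC kernelize (pc + 1)"
  have P: "kernel_program = prologue (pc' + 1) @ ?C @ [Move 0 13] @ ?C' @ [Move 0 15]"
    unfolding kernel_program_def pc_def pc'_def by (simp add: Let_def)
  have len: "length (prologue l) = 12" for l by (simp add: prologue_def)
  show "length kernel_program = pc' + 1"
    unfolding P pc'_def pc_def by (simp add: len)
  show "code_at kernel_program 0 (prologue (pc' + 1))"
    unfolding code_at_def P by (intro exI[of _ "[]"] exI conjI) auto
  have c: "code_at kernel_program 12 (?C @ [Move 0 13] @ ?C' @ [Move 0 15])"
    unfolding code_at_def P by (intro exI[of _ "prologue (pc' + 1)"] exI[of _ "[]"]) (simp add: len)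
  note c1 = code_at_append[OF c]
  note c2 = code_at_append[OF conjunct2[OF c1]]
  note c3 = code_at_append[OF conjunct2[OF c2]]
  show "code_at kernel_program 12 ?C" "code_at kernel_program pc [Move 0 13]"
    "code_at kernel_program (pc + 1) ?C'" "code_at kernel_program pc' [Move 0 15]"
    using c1 c2 c3 unfolding pc'_def pc_def by simp_all
qed

lemma runs_halted:
  assumes "runs w P a cf cf'" "halted P cf'" "a \<le> b"
  shows "(step w P ^^ b) cf = cf'"
proof -
  have "(step w P ^^ c) cf' = cf'" for c
    by (induction c) (use assms(2) in \<open>simp_all add: step_def\<close>)
  moreover have "(step w P ^^ b) cf = (step w P ^^ (b - a)) ((step w P ^^ a) cf)"
    using assms(3) by (metis comp_apply funpow_add le_add_diff_inverse2)
  ultimately show ?thesis using assms(1) by (simp add: runs_def)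
qed

text \<open>Register 0 points to address 4 before the test, ready for the exit with
  \<open>n = 0\<close>. Otherwise it is cleared, which encodes array length 0 for the stage that
  computes \<open>L\<close>.\<close>

lemma prologue_runs:
  assumes code: "code_at P 0 (prologue l)" and M: "\<And>a. M a < 2 ^ w" and w: "(8::nat) \<le> 2 ^ w"
  shows "runs w P 11 (0, \<lambda>_. 0, M) (if M 2 = 0 then l else 11,
      (\<lambda>_. 0)(2 := 0, 5 := M 0, 7 := M 1, 9 := M 2, 11 := M 3, 0 := 4), M)"
    and "M 2 \<noteq> 0 \<Longrightarrow> runs w P 12 (0, \<lambda>_. 0, M) (12,
      (\<lambda>_. 0)(2 := 0, 5 := M 0, 7 := M 1, 9 := M 2, 11 := M 3, 0 := 0), M)"
proof -
  have len: "length (prologue l) = 12" by (simp add: prologue_def)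
  have s: "step w P (i, Z, M) = exec_instr w (prologue l ! i) (i, Z, M)" if "i < 12" for i Z
    using code_at_step[OF code, of i w Z M] that len by simp
  have w': "1 mod 2 ^ w = (1::nat)" "2 mod 2 ^ w = (2::nat)" "3 mod 2 ^ w = (3::nat)" "4 mod 2 ^ w = (4::nat)"
    using w by (simp_all only: mod_less)
  have steps: "step w P (0, Z, M) = (1, Z(2 := 0), M)" "step w P (1, Z, M) = (2, Z(5 := M (Z 2)), M)"
    "step w P (2, Z, M) = (3, Z(2 := 1), M)" "step w P (3, Z, M) = (4, Z(7 := M (Z 2)), M)"
    "step w P (4, Z, M) = (5, Z(2 := 2), M)" "step w P (5, Z, M) = (6, Z(9 := M (Z 2)), M)"
    "step w P (6, Z, M) = (7, Z(2 := 3), M)" "step w P (7, Z, M) = (8, Z(11 := M (Z 2)), M)"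
    "step w P (8, Z, M) = (9, Z(2 := 0), M)" "step w P (9, Z, M) = (10, Z(0 := 4), M)"
    "step w P (10, Z, M) = (if Z 9 = Z 2 then l else 11, Z, M)" "step w P (11, Z, M) = (12, Z(0 := 0), M)" for Z
    using w' by (simp_all add: s prologue_def)
  define Z where "Z = (\<lambda>_ :: nat. 0 :: nat)(2 := 0, 5 := M 0, 7 := M 1, 9 := M 2, 11 := M 3, 0 := 4)"
  have Z: "(\<lambda>_ :: nat. 0 :: nat)(2 := 0, 5 := M 0, 2 := 1, 7 := M 1, 2 := 2, 9 := M 2, 2 := 3, 11 := M 3, 2 := 0, 0 := 4) = Z"
    by (auto simp: Z_def fun_eq_iff)
  have Z9: "Z 9 = M 2" "Z 2 = 0" by (simp_all add: Z_def)
  note r = steps[unfolded runs_one[symmetric]]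
  note run = runs_trans[OF runs_trans[OF runs_trans[OF runs_trans[OF runs_trans[OF runs_trans[OF
    runs_trans[OF runs_trans[OF runs_trans[OF r(1) r(2)] r(3)] r(4)] r(5)] r(6)] r(7)] r(8)] r(9)] r(10),
    of "\<lambda>_. 0", unfolded fun_upd_same Z]
  have "1 + 1 + 1 + 1 + 1 + 1 + 1 + 1 + 1 + 1 = (10::nat)" by simp
  note run = run[unfolded this]
  have "runs w P 1 (10, Z, M) (if M 2 = 0 then l else 11, Z, M)"
    unfolding runs_one steps Z9 by simp
  from runs_trans[OF run this] show r: "runs w P 11 (0, \<lambda>_. 0, M) (if M 2 = 0 then l else 11,
      (\<lambda>_. 0)(2 := 0, 5 := M 0, 7 := M 1, 9 := M 2, 11 := M 3, 0 := 4), M)"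
    unfolding Z_def by simp
  show "runs w P 12 (0, \<lambda>_. 0, M) (12,
      (\<lambda>_. 0)(2 := 0, 5 := M 0, 7 := M 1, 9 := M 2, 11 := M 3, 0 := 0), M)" if "M 2 \<noteq> 0"
  proof -
    have "runs w P 1 (11, Z, M) (12, Z(0 := 0), M)" unfolding runs_one steps ..
    moreover have "runs w P 11 (0, \<lambda>_. 0, M) (11, Z, M)" using r that unfolding Z_def by simp
    ultimately have "runs w P (11 + 1) (0, \<lambda>_. 0, M) (12, Z(0 := 0), M)" by (rule runs_trans[rotated])
    then show ?thesis unfolding Z_def by simp
  qed
qed

text \<open>Uniformity: one program and two constants serve all instances and word lengths.
  \<open>max 1\<close> keeps the budget positive for instances with neither sets nor elements.
  Addressable memory proportional to the time bound is the usual word RAM assumption, while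
  \<open>k\<close> only has to fit into a word, hence the capped thresholds.\<close>

theorem lemma3:
  "\<exists>P c C. \<forall>d k w (U :: 'a set) (F :: 'a set set) num xss.
     hitting_set_instance d U F \<and>
     bij_betw num U {..<card U} \<and>
     lists_family xss F \<and>
     d < 2 ^ w \<and> k < 2 ^ w \<and>
     c * max 1 (3 ^ d * card F + card U) \<le> 2 ^ w \<longrightarrow>
     (\<exists>us yss.
        lists_set us (kernel_universe d k U F) \<and>
        lists_family yss (kernel_sets d k U F) \<and>
        outputs_within w P (instance_words num d k (card U) xss)
          (C * max 1 (3 ^ d * card F + card U))
          (kernel_words num us yss))"
proof (rule exI[of _ kernel_program], rule exI[of _ 1000], rule exI[of _ 10000], intro allI impI, elim conjE)
  fix d k w :: nat and U :: "'a set" and F :: "'a set set" and num :: "'a \<Rightarrow> nat" and xss :: "'a list list"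
  assume inst: "hitting_set_instance d U F" and num: "bij_betw num U {..<card U}"
    and xss: "lists_family xss F" and dk: "d < 2 ^ w" "k < 2 ^ w"
    and w: "1000 * max 1 (3 ^ d * card F + card U) \<le> 2 ^ w"
  define n m where "n = card F" and "m = card U"
  define S where "S = max 1 (3 ^ d * n + m)"
  \<comment> \<open>The factor 1000 leaves room for the \<open>32 * L\<close> cells of the arrays,
    which number at most \<open>384 * S\<close>.\<close>
  have S: "1000 * S \<le> 2 ^ w" "1 \<le> S" "3 ^ d * n + m \<le> S" using w by (auto simp: S_def n_def m_def)
  define xs where "xs = instance_words num d k m xss"
  define M where "M = (\<lambda>a. if a < length xs then xs ! a else 0)"
  have init: "initial_config xs = (0, \<lambda>_. 0, M)" by (simp add: initial_config_def M_def)
  have fam: "\<And>ys. ys \<in> set xss \<Longrightarrow> distinct ys" "distinct (map set xss)" "set ` set xss = F"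
    using xss unfolding lists_family_def lists_set_def by auto
  have len_xss: "length xss = n"
    using distinct_card[OF fam(2)] fam(3) by (simp add: n_def)
  have F: "S' \<subseteq> U" "card S' = d" if "S' \<in> F" for S' using inst that by (auto simp: hitting_set_instance_def)
  have len: "\<forall>ys\<in>set xss. length ys = d" using fam F(2) distinct_card by (metis imageI)
  have sub: "set ys \<subseteq> U" if "ys \<in> set xss" for ys using fam(3) F(1) that by blast
  have num_less: "num x < m" if "x \<in> U" for x using bij_betw_apply[OF num that] by (simp add: m_def)
  have xs: "xs = [d, k, n, m] @ map num (concat xss)" by (simp add: xs_def instance_words_def len_xss)
  have len_xs: "length xs = d * n + 4" using length_concat_uniform[OF len] by (simp add: xs len_xss)
  have M0: "M 0 = d" "M 1 = k" "M 2 = n" "M 3 = m"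
    by (simp_all add: M_def len_xs) (simp_all add: xs)
  have n3: "n \<le> 3 ^ d * n" by simp
  have M_less: "M a < 2 ^ w" for a
  proof (cases "a < length xs")
    case True
    have "x < 2 ^ w" if "x \<in> set xs" for x
    proof -
      have "n < 2 ^ w" "m < 2 ^ w" using S n3 by linarith+
      moreover have "num y < 2 ^ w" if "y \<in> set ys" "ys \<in> set xss" for y ys
        using num_less sub that \<open>m < 2 ^ w\<close> by (meson less_trans subsetD)
      ultimately show ?thesis using that dk unfolding xs by auto
    qed
    then show ?thesis using True by (simp add: M_def)
  qed (use S in \<open>simp add: M_def\<close>)
  have w8: "(8::nat) \<le> 2 ^ w" "(32::nat) \<le> 2 ^ w" using S by linarith+
  define pc where "pc = 12 + length (compC set_length 12)"
  define pc' where "pc' = pc + 1 + length (compC kernelize (pc + 1))"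
  note code = kernel_program_code[folded pc_def, folded pc'_def]
  note pro = prologue_runs[where M = M, OF code(2) M_less w8(1), unfolded M0]
  show "\<exists>us yss. lists_set us (kernel_universe d k U F) \<and> lists_family yss (kernel_sets d k U F) \<and>
    outputs_within w kernel_program (instance_words num d k (card U) xss)
      (10000 * max 1 (3 ^ d * card F + card U)) (kernel_words num us yss)"
    unfolding n_def[symmetric] m_def[symmetric] S_def[symmetric] xs_def[symmetric]
  proof (cases "n = 0")
    \<comment> \<open>Without sets the budget is \<open>max 1 m\<close> while \<open>d\<close> may
      be any word, so not even a loop of \<open>d\<close> steps is affordable; the prologue answers
      directly.\<close>
    case True
    have "finite U" using inst by (simp add: hitting_set_instance_def)
    then have "finite F" using F(1) by (meson finite_Pow_iff finite_subset PowI subsetI)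
    then have "F = {}" using True by (simp add: n_def)
    then have no: "\<not> lr_good d k U F l r S" for l r S using lr_good_closed by blast
    have ks: "kernel_sets d k U F = {}"
      unfolding kernel_sets_def good_def l_good.simps by (simp add: no)
    have ku: "kernel_universe d k U F = {}" unfolding kernel_universe_def by (simp add: ks)
    let ?Z = "(\<lambda>_ :: nat. 0 :: nat)(2 := 0, 5 := d, 7 := k, 9 := n, 11 := m, 0 := 4)"
    have "runs w kernel_program 11 (initial_config xs) (pc' + 1, ?Z, M)" using pro(1) True by (simp add: init)
    moreover have h: "halted kernel_program (pc' + 1, ?Z, M)" by (simp add: halted_def code(1))
    ultimately have run: "(step w kernel_program ^^ (10000 * S)) (initial_config xs) = (pc' + 1, ?Z, M)"
      using S(2) by (intro runs_halted) auto
    have "M 4 = 0" "M 5 = 0" using True by (simp_all add: M_def len_xs)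
    then have "\<forall>i<length [0, 0::nat]. M (?Z 0 + i) = [0, 0] ! i" by (auto simp: less_Suc_eq)
    then have "outputs_within w kernel_program xs (10000 * S) [0, 0]"
      unfolding outputs_within_def using run h w8 by (intro exI[of _ "pc' + 1"] exI[of _ ?Z] exI[of _ M]) auto
    then show "\<exists>us yss. lists_set us (kernel_universe d k U F) \<and> lists_family yss (kernel_sets d k U F) \<and>
      outputs_within w kernel_program xs (10000 * S) (kernel_words num us yss)"
      by (intro exI[of _ "[]"]) (simp add: ks ku lists_set_def lists_family_def kernel_words_def)
  next
    case False
    then have n: "0 < n" by simp
    define L where "L = 4 * (3 ^ d * n) + m + 8"
    have LW: "32 * L \<le> 2 ^ w" "L < 2 ^ w" 
      using S unfolding L_def distrib_left by linarith+
    define word where "word p = num (concat xss ! p)" for p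
    have nth: "concat xss ! p = xss ! (p div d) ! (p mod d)" "p div d < n" "p mod d < d" if "p < d * n" for p
    proof -
      show "concat xss ! p = xss ! (p div d) ! (p mod d)" using nth_concat_uniform[OF len] that len_xss by simp
      show "p div d < n" using that by (simp add: less_mult_imp_div_less mult.commute)
      have "0 < d" using that by (cases d) auto
      then show "p mod d < d" by simp
    qed
    have in_xss: "xss ! E \<in> set xss" if "E < n" for E using that len_xss by simp
    interpret kernel_input d k n m L "2 ^ w" word
    proof
      fix p assume p: "p < d * n"
      have "xss ! (p div d) ! (p mod d) \<in> set (xss ! (p div d))"
        using nth[OF p] len in_xss by (intro nth_mem) auto
      then show "word p < m" unfolding word_def nth(1)[OF p] using sub in_xss nth(2)[OF p] num_less by blast
    next
      fix p p' assume p: "p < d * n" "p' < d * n" and E: "p div d = p' div d" and eq: "word p = word p'"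
      let ?ys = "xss ! (p div d)"
      have ys: "?ys \<in> set xss" using in_xss nth(2)[OF p(1)] .
      have lt: "p mod d < length ?ys" "p' mod d < length ?ys" using nth(3) p len ys by auto
      then have "?ys ! (p mod d) \<in> U" "?ys ! (p' mod d) \<in> U" using sub[OF ys] nth_mem by blast+
      then have "?ys ! (p mod d) = ?ys ! (p' mod d)"
        using eq bij_betw_imp_inj_on[OF num] unfolding word_def nth(1)[OF p(1)] nth(1)[OF p(2)] E
        by (auto dest: inj_onD)
      then have "p mod d = p' mod d" using nth_eq_iff_index_eq[OF fam(1)[OF ys] lt] by simp
      then show "p = p'" using E by (metis div_mult_mod_eq)
    qed (use n LW L_def in auto)
    define e where "e = inv_into U num"
    have e_num: "e (num x) = x" if "x \<in> U" for x
      unfolding e_def using bij_betw_imp_inj_on[OF num] that by (rule inv_into_f_f)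
    have num_U: "num ` U = {..<m}" using bij_betw_imp_surj_on[OF num] by (simp add: m_def)
    have num_e: "num (e u) = u" if "u < m" for u
      unfolding e_def using num_U that by (intro f_inv_into_f) auto
    have e_inj: "inj_on e {..<m}" 
      by (rule inj_on_inverseI[where g = num]) (simp add: num_e)
    have e_image: "e ` num ` A = A" if "A \<subseteq> U" for A
    proof -
      have "e ` num ` A = (\<lambda>x. x) ` A"
        unfolding image_image using e_num that by (intro image_cong) auto
      then show ?thesis by simp
    qed
    have U_eq: "U = e ` {..<m}" using e_image[of U] num_U by simp
    have ES_eq: "ES E = num ` set (xss ! E)" if E: "E < n" for E
    proof -
      have ys: "xss ! E \<in> set xss" "length (xss ! E) = d" using in_xss[OF E] len by auto
      have "ES E = (\<lambda>p. num (xss ! E ! (p mod d))) ` {p. p < d * n \<and> p div d = E}"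
        unfolding ES_def word_def using nth(1) by (intro image_cong) auto
      also have "\<dots> = (\<lambda>j. num (xss ! E ! j)) ` {..<d}"
      proof -
        have mods: "(\<lambda>p. p mod d) ` {p. p < d * n \<and> p div d = E} = {..<d}"
        proof (intro equalityI subsetI)
          fix j assume "j \<in> {..<d}"
          then have j: "j < d" by simp
          have "E * d + j < d * n" using addr_less[of 0 0 1] mult_le_mono2[of "Suc E" n d] E j by (simp add: ac_simps)
          moreover have "(E * d + j) div d = E" "(E * d + j) mod d = j" using j by simp_all
          ultimately show "j \<in> (\<lambda>p. p mod d) ` {p. p < d * n \<and> p div d = E}"
            by (intro image_eqI[of _ _ "E * d + j"]) auto
        qed (use nth(3) in auto)
        show ?thesis unfolding mods[symmetric] image_image ..
      qed
      also have "\<dots> = num ` set (xss ! E)" using ys(2) by (auto simp: set_conv_nth)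
      finally show ?thesis .
    qed
    have F_eq: "F = (\<lambda>E. e ` ES E) ` {..<n}"
    proof -
      have "(\<lambda>E. e ` ES E) ` {..<n} = (\<lambda>E. set (xss ! E)) ` {..<n}"
        using ES_eq e_image sub in_xss by (intro image_cong) auto
      also have "\<dots> = set ` set xss" using len_xss by (auto simp: set_conv_nth)
      finally show ?thesis using fam(3) by simp
    qed
    let ?Zp = "(\<lambda>_ :: nat. 0 :: nat)(2 := 0, 5 := d, 7 := k, 9 := n, 11 := m, 0 := 0)"
    define R0 where "R0 v = ?Zp (2 * v + 1)" for v
    have R0: "R0 vD = d" "R0 vK = k" "R0 vN = n" "R0 vM = m" by (simp_all add: R0_def)
    have nm: "n < 2 ^ w" "m < 2 ^ w" using S n3 by linarith+
    \<comment> \<open>For array length 0 the relation says nothing about array contents, so the zero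
      function may stand for them.\<close>
    have sim0: "sim 0 w R0 (\<lambda>_ _. 0) ?Zp M"
      unfolding sim_def R0_def using M_less dk nm by auto
    have "wp 0 (2 ^ w) set_length (\<lambda>(R', A', t'). unchanged {vL, vI} R0 R' \<and>
      R' vL = 4 * (3 ^ d * n) + m + 8 \<and> t' \<le> 0 + 40 + 20 * d) (R0, \<lambda>_ _. 0, 0)"
      by (rule wp_set_length) (use R0 n LW L_def in auto)
    then obtain R1 A1 t1 where ex1: "exec 0 (2 ^ w) set_length (R0, \<lambda>_ _. 0, 0) (R1, A1, t1)"
      and R1: "unchanged {vL, vI} R0 R1" "R1 vL = L" "t1 \<le> 40 + 20 * d"
      unfolding wp_def L_def by auto
    have "reaches kernel_program w 0 t1 (12, ?Zp, M) pc R1 A1"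
      using compC_correct[OF ex1 _ w8(2) refl refl code(3) sim0] by (auto simp: pc_def)
    then obtain Z1 M1 where run1: "runs w kernel_program t1 (12, ?Zp, M) (pc, Z1, M1)"
      and sim1: "sim 0 w R1 A1 Z1 M1" and M1: "\<forall>a\<ge>32 * 0. M1 a = M a"
      unfolding reaches_def by auto
    \<comment> \<open>Since \<open>32 * 0 = 0\<close>, the region known to be untouched is the whole
      memory.\<close>
    have [simp]: "M1 = M" using M1 by auto
    have Z1: "Z1 13 = L" "\<And>v. Z1 v < 2 ^ w" "\<And>v. Z1 (2 * v + 1) = R1 v"
      using sim1 R1(2) unfolding sim_def by (auto dest!: spec[of _ 6])
    have run2: "runs w kernel_program 1 (pc, Z1, M) (pc + 1, Z1(0 := L), M)"
      by (rule runs_1[OF code(4)]) (simp add: Z1)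
    \<comment> \<open>The same memory, now read as arrays of length \<open>L\<close>. The input ends
      within array 0, so arrays 1 to 19 still hold the initial zeros.\<close>
    define A2 where "A2 j i = (if i < L then M (j * L + i) else 0)" for j i
    have sim2: "sim L w R1 A2 (Z1(0 := L)) M"
      unfolding sim_def A2_def using Z1 M_less LW(2) by auto
    have base: "base R1" unfolding base_def using R1 R0 by simp
    have "length xs \<le> L" using bounds(3) by (simp add: len_xs)
    then have A2_zero: "A2 j = (\<lambda>_. 0)" if "j \<in> {1..19}" for j
    proof -
      have "1 * L \<le> j * L" using that by (intro mult_le_mono1) simp
      then have "\<not> j * L + i < length xs" for i using \<open>length xs \<le> L\<close> by linarith
      then show ?thesis unfolding A2_def M_def by (simp add: fun_eq_iff)
    qed
    have A2_in: "A2 aIn (p + 4) = word p" if p: "p < d * n" for p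
    proof -
      have "p + 4 < L" using p bounds(3) by linarith
      moreover have "M (p + 4) = word p"
        using p length_concat_uniform[OF len] len_xss unfolding M_def len_xs by (simp add: xs word_def)
      ultimately show ?thesis by (simp add: A2_def)
    qed
    from wp_kernelize[where A = A2 and num = num and t = 0, OF base A2_in A2_zero e_inj U_eq F_eq num_e]
    obtain R3 A3 t3 us yss where ex3: "exec L (2 ^ w) kernelize (R1, A2, 0) (R3, A3, t3)"
      and out: "R3 vOut = aOut * L" "lists_set us (kernel_universe d k U F)"
        "lists_family yss (kernel_sets d k U F)" "written A3 (kernel_words num us yss)"
        "length (kernel_words num us yss) \<le> L" "t3 \<le> 300 + 2500 * (3 ^ d * n) + 80 * m"
      unfolding wp_def by auto
    have "reaches kernel_program w L t3 (pc + 1, Z1(0 := L), M) pc' R3 A3"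
      using compC_correct[OF ex3 LW(1) w8(2) refl refl code(5) sim2] by (auto simp: pc'_def)
    then obtain Z3 M3 where run3: "runs w kernel_program t3 (pc + 1, Z1(0 := L), M) (pc', Z3, M3)"
      and sim3: "sim L w R3 A3 Z3 M3" unfolding reaches_def by auto
    have Z3: "Z3 15 = aOut * L" using sim3 out(1) unfolding sim_def by (auto dest!: spec[of _ 7])
    let ?Z = "Z3(0 := aOut * L)"
    have run4: "runs w kernel_program 1 (pc', Z3, M3) (pc' + 1, ?Z, M3)"
      by (rule runs_1[OF code(6)]) (simp add: Z3)
    have "runs w kernel_program 12 (0, \<lambda>_. 0, M) (12, ?Zp, M)" using pro(2) n by simp
    note run = runs_trans[OF runs_trans[OF runs_trans[OF runs_trans[OF this run1[unfolded \<open>M1 = M\<close>]] run2] run3] run4]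
    have h: "halted kernel_program (pc' + 1, ?Z, M3)" by (simp add: halted_def code(1))
    have time: "12 + t1 + 1 + t3 + 1 \<le> 10000 * S"
    proof -
      have "d * 1 \<le> d * n" using n by (intro mult_le_mono2) simp
      then show ?thesis using R1(3) out(6) S(2,3) pow3_ge(3) by linarith
    qed
    have final: "(step w kernel_program ^^ (10000 * S)) (initial_config xs) = (pc' + 1, ?Z, M3)"
      unfolding init by (rule runs_halted[OF run h time])
    have "M3 (?Z 0 + i) = kernel_words num us yss ! i" if i: "i < length (kernel_words num us yss)" for i
    proof -
      have "M3 (20 * L + i) = A3 20 i" using sim3 i out(5) unfolding sim_def by simp
      then show ?thesis using out(4) i unfolding written_def by simp
    qed
    moreover have "?Z 0 + length (kernel_words num us yss) \<le> 2 ^ w" using out(5) LW by simp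
    ultimately have "outputs_within w kernel_program xs (10000 * S) (kernel_words num us yss)"
      unfolding outputs_within_def using final h by blast
    then show "\<exists>us yss. lists_set us (kernel_universe d k U F) \<and> lists_family yss (kernel_sets d k U F) \<and>
      outputs_within w kernel_program xs (10000 * S) (kernel_words num us yss)"
      using out(2,3) by blast
  qed
qed

end
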